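(* Let $\Omega\subset\mathbb{R}^2$ be the unit disk, let $M$ be the number of electrodes, and let $N$ be an even positive integer with $N<M$. Let $\sigma\in L^\infty(\Omega)$ be strictly positive and rotationally symmetric, i.e. $\sigma(z)=\sigma(|z|)$, with $\sigma\equiv1$ close to the boundary $\partial\Omega$, and assume that the matrix $\Psi\in\mathbb{R}^{N^2\times N^2}$ has full rank. Fix one $n\in\mathcal{N}$ and assume additionally that $(\hat\psi_n)_j\neq0$ for all $j\in\mathcal{N}$. Then the ND matrix $\mathbf{R}_{\sigma,1}$ of order $N$ can be recovered from the one measurement $g_n=\mathcal{R}_{\sigma,1}\psi_n$.
   Context: $L^2_\diamond(\partial\Omega)$ is the space of mean-free functions in $L^2(\partial\Omega)$; $(\cdot,\cdot)$ is the $L^2(\partial\Omega)$ inner product; $\nu$ is the outward unit normal; "strictly positive" means bounded below by a positive constant. Neumann-to-Dirichlet (ND) map: for a strictly positive $\sigma\in L^\infty(\Omega)$, $\mathcal{R}_\sigma:L^2_\diamond(\partial\Omega)\to L^2_\diamond(\partial\Omega)$, $\mathcal{R}_\sigma\psi=u|_{\partial\Omega}$, where $u$ is the (weak) solution of $\nabla\cdot\sigma\nabla u=0$ in $\Omega$, $\sigma\partial_\nu u=\psi$ on $\partial\Omega$, $\int_{\partial\Omega}u\,ds=0$. $\mathcal{R}_1$ is the ND map for the constant conductivity $1$, and $\mathcal{R}_{\sigma,1}=\mathcal{R}_\sigma-\mathcal{R}_1$. Electrodes: $E_1,\dots,E_M$ are mutually disjoint, connected, open subsets of $\partial\Omega$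 of equal length $|E_m|=|E|>0$, with characteristic functions $\chi_m$; extended electrodes $\widetilde E_1,\dots,\widetilde E_M$ are open, connected, mutually disjoint subsets of $\partial\Omega$ with $E_m\subset\overline{\widetilde E_m}$ and $\bigcup_m\overline{\widetilde E_m}=\partial\Omega$. $Q\varphi=\sum_{m=1}^M\frac{\chi_m}{|E_m|}\int_{\widetilde E_m}\varphi\,ds$ (which maps mean-free functions to mean-free functions). Basis: $\mathcal{N}=\{-N/2,\dots,-1,1,\dots,N/2\}$ and, in the angular variable $\theta$ on $\partial\Omega$, $\varphi_n(\theta)=\frac1{\sqrt\pi}\sin(n\theta)$ for $n<0$ and $\varphi_n(\theta)=\frac1{\sqrt\pi}\cos(n\theta)$ for $n>0$. Partial-boundary currents: $\psi_n=Q\varphi_n$, with coefficient vectors $\hat\psi_n\in\mathbb{R}^N$, $(\hat\psi_n)_j=(\psi_n,\varphi_j)$, $j\in\mathcal{N}$ (in increasing order). ND matrix of order $N$: $\mathbf{R}_{\sigma,1}\in\mathbb{R}^{N\times N}$, $(\mathbf{R}_{\sigma,1})_{n,j}=(\mathcal{R}_{\sigma,1}\varphi_n,\varphi_j)$, $n,j\in\mathcal{N}$. Matrix $\Psi$: for $n\in\mathcal{N}$, $\Psi_n\in\mathbb{R}^{N\times N^2}$ is the block-diagonal matrix with $N$ diagonal blocks each equal to the row vector $\hat\psi_n^T$; $\Psi\in\mathbb{R}^{N^2\times N^2}$ is obtained by stacking all $\Psi_n$, $n\in\mathcal{N}$, vertically. *)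

theory Defs
  imports "HOL-Analysis.Analysis" "Jordan_Normal_Form.DL_Rank"
begin

section \<open>The unit disk, its boundary, and square-integrable functions\<close>

text \<open>The plane is identified with the complex numbers, regarded as a two-dimensional real
  Euclidean space, on which \<^const>\<open>inner\<close> is the dot product.\<close>

definition disk_measure :: "complex measure" where
  "disk_measure = lebesgue_on (ball 0 1)"

text \<open>Arc length on the unit circle, the push-forward of Lebesgue measure under
  \<^term>\<open>\<lambda>\<theta>. cis \<theta>\<close>.\<close>

definition circle_measure :: "complex measure" where
  "circle_measure =
     distr (restrict_space lborel {0..<2 * pi}) (restrict_space borel (sphere 0 1)) cis"

definition L2 :: "'a measure \<Rightarrow> ('a \<Rightarrow> 'b::euclidean_space) set" where
  "L2 M = {f. f \<in> borel_measurable M \<and> integrable M (\<lambda>x. (norm (f x))\<^sup>2)}"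

definition circle_inner :: "(complex \<Rightarrow> real) \<Rightarrow> (complex \<Rightarrow> real) \<Rightarrow> real" where
  "circle_inner f g = (LINT z|circle_measure. f z * g z)"

section \<open>Sobolev functions and traces\<close>

definition C1_with_gradient :: "(complex \<Rightarrow> real) \<Rightarrow> (complex \<Rightarrow> complex) \<Rightarrow> bool" where
  "C1_with_gradient w dw \<longleftrightarrow> (\<forall>z. GDERIV w z :> dw z) \<and> continuous_on UNIV dw"

text \<open>\<open>weak_gradient u G\<close>: \<open>u\<close> belongs to \<open>H\<^sup>1\<close> of the disk and has distributional gradient \<open>G\<close>.
  Testing with compactly supported functions of class \<open>C\<^sup>1\<close> is, by mollification, the same as
  testing with smooth ones.\<close>

definition weak_gradient :: "(complex \<Rightarrow> real) \<Rightarrow> (complex \<Rightarrow> complex) \<Rightarrow> bool" where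
  "weak_gradient u G \<longleftrightarrow> u \<in> L2 disk_measure \<and> G \<in> L2 disk_measure \<and>
     (\<forall>\<phi> d\<phi>. C1_with_gradient \<phi> d\<phi> \<longrightarrow> closure {z. \<phi> z \<noteq> 0} \<subseteq> ball 0 1 \<longrightarrow>
        (LINT z|disk_measure. u z *\<^sub>R d\<phi> z) = - (LINT z|disk_measure. \<phi> z *\<^sub>R G z))"

text \<open>\<open>H1_trace u G f\<close>: \<open>u\<close> belongs to \<open>H\<^sup>1\<close>, its weak gradient is \<open>G\<close>, and its trace is \<open>f\<close>.
  The trace operator is the continuous extension from \<open>H\<^sup>1\<close> to \<open>L\<^sup>2\<close> of the boundary of the
  restriction map on functions that are \<open>C\<^sup>1\<close> up to the boundary; these are dense in \<open>H\<^sup>1\<close>.\<close>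

definition H1_trace ::
    "(complex \<Rightarrow> real) \<Rightarrow> (complex \<Rightarrow> complex) \<Rightarrow> (complex \<Rightarrow> real) \<Rightarrow> bool" where
  "H1_trace u G f \<longleftrightarrow> weak_gradient u G \<and> f \<in> L2 circle_measure \<and>
     (\<exists>w dw. (\<forall>k::nat. C1_with_gradient (w k) (dw k)) \<and>
        (\<lambda>k. LINT z|disk_measure. (w k z - u z)\<^sup>2) \<longlonglongrightarrow> 0 \<and>
        (\<lambda>k. LINT z|disk_measure. (norm (dw k z - G z))\<^sup>2) \<longlonglongrightarrow> 0 \<and>
        (\<lambda>k. LINT z|circle_measure. (w k z - f z)\<^sup>2) \<longlonglongrightarrow> 0)"

section \<open>The Neumann-to-Dirichlet map\<close>

definition admissible_conductivity :: "(complex \<Rightarrow> real) \<Rightarrow> bool" where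
  "admissible_conductivity \<sigma> \<longleftrightarrow> \<sigma> \<in> borel_measurable disk_measure \<and>
     (\<exists>C. AE z in disk_measure. \<bar>\<sigma> z\<bar> \<le> C) \<and>
     (\<exists>c>0. AE z in disk_measure. c \<le> \<sigma> z)"

text \<open>Elements of \<open>L\<^sup>\<infinity>\<close> are only determined almost everywhere, so rotational symmetry asks for
  an almost everywhere defined radial profile.\<close>

definition rotationally_symmetric :: "(complex \<Rightarrow> real) \<Rightarrow> bool" where
  "rotationally_symmetric \<sigma> \<longleftrightarrow> (\<exists>s :: real \<Rightarrow> real. AE z in disk_measure. \<sigma> z = s (cmod z))"

definition one_near_boundary :: "(complex \<Rightarrow> real) \<Rightarrow> bool" where
  "one_near_boundary \<sigma> \<longleftrightarrow> (\<exists>\<rho><1. AE z in disk_measure. \<rho> < cmod z \<longrightarrow> \<sigma> z = 1)"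

text \<open>Weak formulation of the Neumann problem with current \<open>\<psi>\<close>; the solution \<open>u\<close> has weak gradient
  \<open>G\<close> and boundary trace \<open>f\<close>, normalised to be mean-free.\<close>

definition weak_neumann_solution ::
    "(complex \<Rightarrow> real) \<Rightarrow> (complex \<Rightarrow> real) \<Rightarrow>
     (complex \<Rightarrow> real) \<Rightarrow> (complex \<Rightarrow> complex) \<Rightarrow> (complex \<Rightarrow> real) \<Rightarrow> bool" where
  "weak_neumann_solution \<sigma> \<psi> u G f \<longleftrightarrow> H1_trace u G f \<and>
     (\<forall>v H h. H1_trace v H h \<longrightarrow>
        (LINT z|disk_measure. \<sigma> z * inner (G z) (H z)) = (LINT z|circle_measure. \<psi> z * h z)) \<and>
     (LINT z|circle_measure. f z) = 0"

text \<open>The boundary values are unique only almost everywhere; \<open>nd_map \<sigma> \<psi>\<close> is a chosen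
  representative.\<close>

definition nd_map :: "(complex \<Rightarrow> real) \<Rightarrow> (complex \<Rightarrow> real) \<Rightarrow> (complex \<Rightarrow> real)" where
  "nd_map \<sigma> \<psi> = (SOME f. \<exists>u G. weak_neumann_solution \<sigma> \<psi> u G f)"

definition nd_diff :: "(complex \<Rightarrow> real) \<Rightarrow> (complex \<Rightarrow> real) \<Rightarrow> (complex \<Rightarrow> real)" where
  "nd_diff \<sigma> \<psi> = (\<lambda>z. nd_map \<sigma> \<psi> z - nd_map (\<lambda>_. 1) \<psi> z)"

section \<open>Electrodes\<close>

text \<open>The electrodes are \<open>E m\<close> and the extended electrodes \<open>Et m\<close>, with \<open>m < M\<close>.\<close>

definition electrode_configuration ::
    "nat \<Rightarrow> (nat \<Rightarrow> complex set) \<Rightarrow> (nat \<Rightarrow> complex set) \<Rightarrow> bool" where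
  "electrode_configuration M E Et \<longleftrightarrow>
     (\<forall>m<M. openin (top_of_set (sphere 0 1)) (E m) \<and> connected (E m)) \<and>
     disjoint_family_on E {..<M} \<and>
     (\<exists>L>0. \<forall>m<M. measure circle_measure (E m) = L) \<and>
     (\<forall>m<M. openin (top_of_set (sphere 0 1)) (Et m) \<and> connected (Et m)) \<and>
     disjoint_family_on Et {..<M} \<and>
     (\<forall>m<M. E m \<subseteq> closure (Et m)) \<and>
     (\<Union>m<M. closure (Et m)) = sphere 0 1"

definition Q_map ::
    "nat \<Rightarrow> (nat \<Rightarrow> complex set) \<Rightarrow> (nat \<Rightarrow> complex set) \<Rightarrow> (complex \<Rightarrow> real) \<Rightarrow> (complex \<Rightarrow> real)"
  where
  "Q_map M E Et \<phi> = (\<lambda>z. \<Sum>m<M. indicator (E m) z / measure circle_measure (E m) *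
     (LINT x:Et m|circle_measure. \<phi> x))"

section \<open>Trigonometric basis and matrices\<close>

definition modes :: "nat \<Rightarrow> int set" where
  "modes N = {- (int N div 2)..int N div 2} - {0}"

text \<open>\<open>mode N k\<close> is the \<open>k\<close>-th element of \<open>modes N\<close> in increasing order, counted from zero; it
  translates matrix indices into frequencies.\<close>

definition mode :: "nat \<Rightarrow> nat \<Rightarrow> int" where
  "mode N k = sorted_list_of_set (modes N) ! k"

definition trig :: "int \<Rightarrow> complex \<Rightarrow> real" where
  "trig n z = (if n < 0 then sin (of_int n * Arg z) else cos (of_int n * Arg z)) / sqrt pi"

definition current ::
    "nat \<Rightarrow> (nat \<Rightarrow> complex set) \<Rightarrow> (nat \<Rightarrow> complex set) \<Rightarrow> int \<Rightarrow> (complex \<Rightarrow> real)" where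
  "current M E Et n = Q_map M E Et (trig n)"

definition current_vec ::
    "nat \<Rightarrow> (nat \<Rightarrow> complex set) \<Rightarrow> (nat \<Rightarrow> complex set) \<Rightarrow> nat \<Rightarrow> int \<Rightarrow> real Matrix.vec" where
  "current_vec M E Et N n = Matrix.vec N (\<lambda>k. circle_inner (current M E Et n) (trig (mode N k)))"

definition Psi_block ::
    "nat \<Rightarrow> (nat \<Rightarrow> complex set) \<Rightarrow> (nat \<Rightarrow> complex set) \<Rightarrow> nat \<Rightarrow> int \<Rightarrow> real Matrix.mat" where
  "Psi_block M E Et N n = diag_block_mat (replicate N (mat_of_row (current_vec M E Et N n)))"

definition Psi ::
    "nat \<Rightarrow> (nat \<Rightarrow> complex set) \<Rightarrow> (nat \<Rightarrow> complex set) \<Rightarrow> nat \<Rightarrow> real Matrix.mat" where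
  "Psi M E Et N =
     mat_of_rows (N\<^sup>2) (concat (map (\<lambda>k. Matrix.rows (Psi_block M E Et N (mode N k))) [0..<N]))"

definition nd_matrix :: "nat \<Rightarrow> (complex \<Rightarrow> real) \<Rightarrow> real Matrix.mat" where
  "nd_matrix N \<sigma> = Matrix.mat N N
     (\<lambda>(k, l). circle_inner (nd_diff \<sigma> (trig (mode N k))) (trig (mode N l)))"

end

(*
For a rotationally symmetric conductivity the bilinear form b(phi, psi) = (R_sigma phi, psi) is
symmetric and invariant under simultaneous rotation of phi and psi.  Averaging the rotation
invariance over the circle against cos (j theta) and sin (j theta) shows that every trigonometric
function phi_j is an eigenfunction of R_sigma, hence of R_{sigma,1}, tested against mean-free
functions.  So the ND matrix is diagonal, and since (g_n, phi_j) = mu_j (psi_n, phi_j) with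
(psi_n, phi_j) <> 0, its entries mu_j are read off from g_n.  Uniqueness for the Neumann problem is
never needed, but existence is: without it nd_map would be a choice from an empty set.  Existence
follows from the direct method and a trace inequality of Poincare type in polar coordinates.
*)

theory Submission
  imports Defs
begin

text \<open>\<open>nd_map\<close> is a choice of representative, so linearity or equivariance cannot
  be expected of it pointwise. Every property is therefore stated for the pairing
  \<open>circle_inner (nd_map \<sigma> \<phi>) \<psi>\<close> with mean-free data: reciprocity
  identifies such a pairing with an energy, so its value does not depend on the choice, and scaling
  or rotating a current is moved to the other argument. A rotation turns each mode into a
  combination of the cosine and the sine of the same frequency, so the two are averaged together.
  Rotation invariance alone would leave a multiple of the identity plus an antisymmetric part on
  their span; symmetry of the form removes the latter, and the multiple is read off from the trace.
  Traces in \<open>H1_trace\<close> are limits of C1 functions. Minimising over C1 functions thus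
  yields solution, weak gradient and trace as limits of one sequence, once the gradient controls the
  function both in the disk and on the circle. The polar formula behind these bounds rests on
  rotation invariance of area, which is obtained from shears.\<close>

no_notation Matrix.scalar_prod (infix "\<bullet>" 70)

section \<open>The Lebesgue measure of the complex plane\<close>

text \<open>Lebesgue measure is determined by the volumes of boxes (\<open>lborel_eqI\<close>), and
  the preimage of a complex box is a product of two intervals.\<close>

lemma lborel_complex_eq_distr:
  "lborel = distr (lborel \<Otimes>\<^sub>M lborel) borel (\<lambda>(x, y). Complex x y)"
proof (rule lborel_eqI)
  have [measurable]: "(\<lambda>p. Complex (fst p) (snd p)) \<in> borel_measurable borel"
    by (intro borel_measurable_continuous_onI continuous_intros)
  have m: "(\<lambda>(x, y). Complex x y) \<in> (lborel \<Otimes>\<^sub>M lborel) \<rightarrow>\<^sub>M borel"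
    by (simp add: lborel_prod split_beta)
  fix l u :: complex
  assume le: "\<And>b. b \<in> Basis \<Longrightarrow> l \<bullet> b \<le> u \<bullet> b"
  have le': "Re l \<le> Re u" "Im l \<le> Im u"
    using le[of 1] le[of \<i>] by (auto simp: Basis_complex_def)
  have "(\<lambda>(x, y). Complex x y) -` box l u \<inter> space (lborel \<Otimes>\<^sub>M lborel) =
      box (Re l) (Re u) \<times> box (Im l) (Im u)"
    by (auto simp: in_box_complex_iff space_pair_measure)
  then show "emeasure (distr (lborel \<Otimes>\<^sub>M lborel) borel (\<lambda>(x, y). Complex x y)) (box l u) =
      ennreal (\<Prod>b\<in>Basis. (u - l) \<bullet> b)"
    using le' m
    by (simp add: emeasure_distr lborel.emeasure_pair_measure_Times Basis_complex_def ennreal_mult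
        emeasure_lborel_box_eq)
qed simp

text \<open>Both orders are recorded because a shear moves only one coordinate, and that coordinate
  has to be the inner variable.\<close>

lemma nn_integral_lborel_complex:
  assumes [measurable]: "f \<in> borel_measurable borel"
  shows "(\<integral>\<^sup>+z. f z \<partial>lborel) = (\<integral>\<^sup>+x. \<integral>\<^sup>+y. f (Complex x y) \<partial>lborel \<partial>lborel)"
    and "(\<integral>\<^sup>+z. f z \<partial>lborel) = (\<integral>\<^sup>+y. \<integral>\<^sup>+x. f (Complex x y) \<partial>lborel \<partial>lborel)"
proof -
  have "(\<lambda>p. Complex (fst p) (snd p)) \<in> borel_measurable borel"
    by (intro borel_measurable_continuous_onI continuous_intros)
  then have [measurable]: "(\<lambda>(x, y). Complex x y) \<in> (lborel \<Otimes>\<^sub>M lborel) \<rightarrow>\<^sub>M borel"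
    by (simp add: lborel_prod split_beta)
  have "(\<integral>\<^sup>+z. f z \<partial>lborel) = (\<integral>\<^sup>+p. f (case p of (x, y) \<Rightarrow> Complex x y) \<partial>(lborel \<Otimes>\<^sub>M lborel))"
    by (subst lborel_complex_eq_distr, subst nn_integral_distr) simp_all
  also have "\<dots> = (\<integral>\<^sup>+x. \<integral>\<^sup>+y. f (Complex x y) \<partial>lborel \<partial>lborel)"
    by (subst lborel.nn_integral_fst[symmetric]) simp_all
  finally show 1: "(\<integral>\<^sup>+z. f z \<partial>lborel) = (\<integral>\<^sup>+x. \<integral>\<^sup>+y. f (Complex x y) \<partial>lborel \<partial>lborel)" .
  have m: "(\<lambda>(x, y). f (Complex x y)) \<in> borel_measurable (lborel \<Otimes>\<^sub>M lborel)"
    using measurable_compose[OF \<open>(\<lambda>(x, y). Complex x y) \<in> _\<close> assms] by (simp add: split_beta)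
  show "(\<integral>\<^sup>+z. f z \<partial>lborel) = (\<integral>\<^sup>+y. \<integral>\<^sup>+x. f (Complex x y) \<partial>lborel \<partial>lborel)"
    unfolding 1 using lborel_pair.Fubini'[OF m] by simp
qed

text \<open>Both orders serve the integration of a gradient: each partial derivative is integrated
  first along its own axis.\<close>

lemma integral_lborel_complex:
  fixes f :: "complex \<Rightarrow> 'b::{banach, second_countable_topology}"
  assumes "integrable lborel f"
  shows "(LBINT z. f z) = (LBINT x. LBINT y. f (Complex x y))"
    and "(LBINT z. f z) = (LBINT y. LBINT x. f (Complex x y))"
proof -
  have [measurable]: "f \<in> borel_measurable borel"
    using assms by auto
  have "(\<lambda>p. Complex (fst p) (snd p)) \<in> borel_measurable borel"
    by (intro borel_measurable_continuous_onI continuous_intros)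
  then have [measurable]: "(\<lambda>(x, y). Complex x y) \<in> (lborel \<Otimes>\<^sub>M lborel) \<rightarrow>\<^sub>M borel"
    by (simp add: lborel_prod split_beta)
  have "integrable (lborel \<Otimes>\<^sub>M lborel) (\<lambda>p. f (case p of (x, y) \<Rightarrow> Complex x y))"
    using assms by (subst (asm) lborel_complex_eq_distr, subst (asm) integrable_distr_eq) simp_all
  then have i: "integrable (lborel \<Otimes>\<^sub>M lborel) (\<lambda>(x, y). f (Complex x y))"
    by (simp add: split_beta')
  have "(LBINT z. f z) = (LINT p|(lborel \<Otimes>\<^sub>M lborel). f (case p of (x, y) \<Rightarrow> Complex x y))"
    by (subst lborel_complex_eq_distr, subst integral_distr) simp_all
  also have "\<dots> = (LINT p|(lborel \<Otimes>\<^sub>M lborel). (case p of (x, y) \<Rightarrow> f (Complex x y)))"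
    by (simp add: split_beta')
  finally have 1: "(LBINT z. f z) = (LINT p|(lborel \<Otimes>\<^sub>M lborel). (case p of (x, y) \<Rightarrow> f (Complex x y)))" .
  show "(LBINT z. f z) = (LBINT x. LBINT y. f (Complex x y))"
    unfolding 1 lborel_pair.integral_fst[OF i] ..
  show "(LBINT z. f z) = (LBINT y. LBINT x. f (Complex x y))"
    unfolding 1 lborel_pair.integral_fst[OF i, symmetric] lborel_pair.Fubini_integral[OF i] ..
qed

text \<open>On every line parallel to the sheared axis the map is a translation by a fixed amount,
  so the inner integral is unchanged.\<close>

lemma nn_integral_shear:
  fixes k :: real and f :: "complex \<Rightarrow> ennreal"
  assumes [measurable]: "f \<in> borel_measurable borel"
  shows "(\<integral>\<^sup>+z. f (Complex (Re z + k * Im z) (Im z)) \<partial>lborel) = (\<integral>\<^sup>+z. f z \<partial>lborel)"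
    and "(\<integral>\<^sup>+z. f (Complex (Re z) (Im z + k * Re z)) \<partial>lborel) = (\<integral>\<^sup>+z. f z \<partial>lborel)"
proof -
  have c: "(\<lambda>z. Complex (Re z + k * Im z) (Im z)) \<in> borel_measurable borel"
    "(\<lambda>z. Complex (Re z) (Im z + k * Re z)) \<in> borel_measurable borel"
    by (intro borel_measurable_continuous_onI continuous_intros)+
  have m: "(\<lambda>z. f (Complex (Re z + k * Im z) (Im z))) \<in> borel_measurable borel"
    "(\<lambda>z. f (Complex (Re z) (Im z + k * Re z))) \<in> borel_measurable borel"
    using measurable_compose[OF c(1) assms] measurable_compose[OF c(2) assms] by simp_all
  have c2: "(\<lambda>x. Complex x y) \<in> borel_measurable borel" "(\<lambda>x. Complex y x) \<in> borel_measurable borel" for y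
    by (intro borel_measurable_continuous_onI continuous_intros)+
  have s1: "(\<integral>\<^sup>+x. f (Complex (x + k * y) y) \<partial>lborel) = (\<integral>\<^sup>+x. f (Complex x y) \<partial>lborel)" for y
    using nn_integral_real_affine[OF measurable_compose[OF c2(1) assms], of 1 y "k * y"]
    by (simp add: add.commute)
  have s2: "(\<integral>\<^sup>+x. f (Complex y (x + k * y)) \<partial>lborel) = (\<integral>\<^sup>+x. f (Complex y x) \<partial>lborel)" for y
    using nn_integral_real_affine[OF measurable_compose[OF c2(2) assms], of 1 y "k * y"]
    by (simp add: add.commute)
  show "(\<integral>\<^sup>+z. f (Complex (Re z + k * Im z) (Im z)) \<partial>lborel) = (\<integral>\<^sup>+z. f z \<partial>lborel)"
    by (simp add: nn_integral_lborel_complex(2)[OF m(1)] nn_integral_lborel_complex(2)[OF assms] s1)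
  show "(\<integral>\<^sup>+z. f (Complex (Re z) (Im z + k * Re z)) \<partial>lborel) = (\<integral>\<^sup>+z. f z \<partial>lborel)"
    by (simp add: nn_integral_lborel_complex(1)[OF m(2)] nn_integral_lborel_complex(1)[OF assms] s2)
qed

text \<open>A rotation by an angle other than \<open>\<pi>\<close> is a product of three shears.\<close>

lemma nn_integral_rotation_shears:
  fixes f :: "complex \<Rightarrow> ennreal"
  assumes [measurable]: "f \<in> borel_measurable borel" and c: "cmod c = 1" "c \<noteq> -1"
  shows "(\<integral>\<^sup>+z. f (c * z) \<partial>lborel) = (\<integral>\<^sup>+z. f z \<partial>lborel)"
proof -
  \<comment> \<open>For \<open>c = cis \<alpha>\<close> these are
    \<open>t = - tan (\<alpha> / 2)\<close> and \<open>s = sin \<alpha>\<close>, from the classical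
    factorisation horizontal, vertical, horizontal. The denominator vanishes exactly at the half
    turn.\<close>
  define t where "t = - Im c / (1 + Re c)"
  define s where "s = Im c"
  have sq: "Re c * Re c + Im c * Im c = 1"
    using c(1) by (simp add: cmod_def power2_eq_square)
  have nz: "1 + Re c \<noteq> 0"
  proof
    assume "1 + Re c = 0"
    then have "Re c = -1" by simp
    with sq have "Im c = 0" by simp
    with \<open>Re c = -1\<close> c(2) show False by (simp add: complex_eq_iff)
  qed
  define T where "T = (\<lambda>z. Complex (Re z + t * Im z) (Im z))"
  define S where "S = (\<lambda>z. Complex (Re z) (Im z + s * Re z))"
  have ts: "t * (1 + Re c) = - Im c"
    using nz by (simp add: t_def)
  have e1: "1 + t * s = Re c"
  proof -
    have "(1 + Re c) * (1 + t * s) = (1 + Re c) + (t * (1 + Re c)) * s"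
      by (simp add: algebra_simps)
    also have "\<dots> = (1 + Re c) * Re c"
      unfolding ts s_def using sq by (simp add: algebra_simps)
    finally have "(1 + Re c) * (1 + t * s) = (1 + Re c) * Re c" .
    then show ?thesis using nz by simp
  qed
  have e2: "t + Re c * t = - s"
    using ts by (simp add: s_def algebra_simps)
  have dec: "T (S (T z)) = c * z" for z
  proof -
    have "T (S (T z)) = Complex ((1 + t * s) * Re z + (t + (1 + t * s) * t) * Im z)
        (s * Re z + (1 + t * s) * Im z)"
      by (simp add: T_def S_def algebra_simps)
    also have "\<dots> = c * z"
      unfolding e1 e2 by (simp add: complex_eq_iff s_def)
    finally show ?thesis .
  qed
  have [measurable]: "T \<in> borel_measurable borel" "S \<in> borel_measurable borel"
    unfolding T_def S_def by (intro borel_measurable_continuous_onI continuous_intros)+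
  have "(\<integral>\<^sup>+z. f z \<partial>lborel) = (\<integral>\<^sup>+z. f (T z) \<partial>lborel)"
    unfolding T_def by (rule nn_integral_shear(1)[symmetric]) simp
  also have "\<dots> = (\<integral>\<^sup>+z. f (T (S z)) \<partial>lborel)"
    unfolding S_def by (rule nn_integral_shear(2)[where f="\<lambda>z. f (T z)", symmetric]) simp
  also have "\<dots> = (\<integral>\<^sup>+z. f (T (S (T z))) \<partial>lborel)"
    by (subst (3) T_def, rule nn_integral_shear(1)[where f="\<lambda>z. f (T (S z))", symmetric]) simp
  finally show ?thesis by (simp add: dec)
qed

text \<open>The half turn excluded by the shears is two quarter turns by
  \<open>\<i>\<close>.\<close>

lemma nn_integral_rotation:
  fixes f :: "complex \<Rightarrow> ennreal"
  assumes [measurable]: "f \<in> borel_measurable borel" and c: "cmod c = 1"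
  shows "(\<integral>\<^sup>+z. f (c * z) \<partial>lborel) = (\<integral>\<^sup>+z. f z \<partial>lborel)"
proof (cases "c = -1")
  case True
  have "(\<integral>\<^sup>+z. f (c * z) \<partial>lborel) = (\<integral>\<^sup>+z. f (\<i> * (\<i> * z)) \<partial>lborel)"
    using True by (simp flip: mult.assoc)
  also have "\<dots> = (\<integral>\<^sup>+z. f (\<i> * z) \<partial>lborel)"
    by (rule nn_integral_rotation_shears[where f="\<lambda>z. f (\<i> * z)"]) (auto simp: complex_eq_iff)
  also have "\<dots> = (\<integral>\<^sup>+z. f z \<partial>lborel)"
    by (rule nn_integral_rotation_shears) (auto simp: complex_eq_iff)
  finally show ?thesis .
qed (use assms nn_integral_rotation_shears in blast)

lemma lborel_distr_rotation:
  assumes "cmod c = 1"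
  shows "distr lborel borel ((*) c) = (lborel :: complex measure)"
proof (rule measure_eqI)
  fix A assume "A \<in> sets (distr lborel borel ((*) c))"
  then have [measurable]: "A \<in> sets borel" by simp
  have "emeasure (distr lborel borel ((*) c)) A = (\<integral>\<^sup>+z. indicator A z \<partial>distr lborel borel ((*) c))"
    by simp
  also have "\<dots> = (\<integral>\<^sup>+z. indicator A (c * z) \<partial>lborel)"
    by (rule nn_integral_distr) simp_all
  also have "\<dots> = emeasure lborel A"
    by (subst nn_integral_rotation[where f="indicator A"]) (simp_all add: assms)
  finally show "emeasure (distr lborel borel ((*) c)) A = emeasure lborel A" .
qed simp

section \<open>Arc length and polar coordinates\<close>

lemma space_circle_measure [simp]: "space circle_measure = sphere 0 1"
  by (simp add: circle_measure_def space_restrict_space)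

lemma sets_circle_measure [measurable_cong]:
  "sets circle_measure = sets (restrict_space borel (sphere 0 1))"
  by (simp add: circle_measure_def)

lemma measurable_cis_circle [measurable]: "cis \<in> borel \<rightarrow>\<^sub>M restrict_space borel (sphere 0 1)"
  by (intro measurable_restrict_space2 borel_measurable_continuous_onI continuous_intros) auto

lemma measurable_cis_circle_measure [measurable]: "cis \<in> borel \<rightarrow>\<^sub>M circle_measure"
  using measurable_cis_circle by (simp add: sets_circle_measure cong: measurable_cong_sets)

lemma measurable_cis_restrict [measurable]:
  "cis \<in> restrict_space lborel A \<rightarrow>\<^sub>M restrict_space borel (sphere 0 1)"
  by (rule measurable_restrict_space1) simp

lemma nn_integral_circle_measure:
  assumes [measurable]: "f \<in> borel_measurable circle_measure"
  shows "(\<integral>\<^sup>+z. f z \<partial>circle_measure) = (\<integral>\<^sup>+\<theta>. f (cis \<theta>) * indicator {0..<2 * pi} \<theta> \<partial>lborel)"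
proof -
  have "f \<in> borel_measurable (restrict_space borel (sphere 0 1))"
    using assms by (simp add: sets_circle_measure cong: measurable_cong_sets)
  then show ?thesis
    unfolding circle_measure_def
    by (subst nn_integral_distr) (simp_all add: nn_integral_restrict_space)
qed

lemma emeasure_circle_measure_space: "emeasure circle_measure (sphere 0 1) = ennreal (2 * pi)"
proof -
  have "emeasure circle_measure (sphere 0 1) = (\<integral>\<^sup>+z. 1 \<partial>circle_measure)"
    by simp
  also have "\<dots> = (\<integral>\<^sup>+\<theta>. 1 * indicator {0..<2 * pi} \<theta> \<partial>lborel)"
    by (rule nn_integral_circle_measure) simp
  also have "\<dots> = ennreal (2 * pi)" by simp
  finally show ?thesis .
qed

interpretation circle: finite_measure circle_measure
  by standard (simp add: emeasure_circle_measure_space)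

lemma measurable_circle_rotation:
  assumes "cmod c = 1"
  shows "(*) c \<in> circle_measure \<rightarrow>\<^sub>M circle_measure"
proof -
  have "(*) c \<in> restrict_space borel (sphere 0 1) \<rightarrow>\<^sub>M restrict_space borel (sphere 0 1)"
    by (intro measurable_restrict_space2 measurable_restrict_space1)
       (auto simp: space_restrict_space norm_mult assms)
  then show ?thesis by (simp add: sets_circle_measure cong: measurable_cong_sets)
qed

text \<open>In the angle a rotation is a translation by \<open>\<alpha>\<close>. The shifted window
  from \<open>\<alpha>\<close> to \<open>\<alpha> + 2 * pi\<close> is cut at \<open>2 * pi\<close>,
  and periodicity moves the overhang back to the start.\<close>

lemma nn_integral_circle_rotation:
  assumes f [measurable]: "f \<in> borel_measurable circle_measure" and c: "cmod c = 1"
  shows "(\<integral>\<^sup>+z. f (c * z) \<partial>circle_measure) = (\<integral>\<^sup>+z. f z \<partial>circle_measure)"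
proof -
  define \<alpha> where "\<alpha> = Arg2pi c"
  have \<alpha>: "0 \<le> \<alpha>" "\<alpha> < 2 * pi" "c = cis \<alpha>"
    using c Arg2pi_eq[of c] Arg2pi_ge_0[of c] Arg2pi_lt_2pi[of c] by (auto simp: \<alpha>_def cis_conv_exp)
  define h where "h = (\<lambda>\<theta>. f (cis \<theta>))"
  have h [measurable]: "h \<in> borel_measurable borel"
    unfolding h_def by measurable
  have per: "h (\<theta> + 2 * pi) = h \<theta>" for \<theta>
    by (simp add: h_def cis.code sin_add cos_add)
  have "(\<integral>\<^sup>+z. f (c * z) \<partial>circle_measure) = (\<integral>\<^sup>+\<theta>. f (c * cis \<theta>) * indicator {0..<2 * pi} \<theta> \<partial>lborel)"
    by (rule nn_integral_circle_measure) (rule measurable_compose[OF measurable_circle_rotation[OF c] f])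
  also have "\<dots> = (\<integral>\<^sup>+\<theta>. h (\<alpha> + 1 * \<theta>) * indicator {\<alpha>..<\<alpha> + 2 * pi} (\<alpha> + 1 * \<theta>) \<partial>lborel)"
    by (intro nn_integral_cong) (auto simp: h_def \<alpha>(3) cis_mult split: split_indicator)
  also have "\<dots> = (\<integral>\<^sup>+\<theta>. h \<theta> * indicator {\<alpha>..<\<alpha> + 2 * pi} \<theta> \<partial>lborel)"
    using nn_integral_real_affine[where c=1 and t=\<alpha> and f="\<lambda>\<theta>. h \<theta> * indicator {\<alpha>..<\<alpha> + 2 * pi} \<theta>"]
    by simp
  also have "\<dots> = (\<integral>\<^sup>+\<theta>. h \<theta> * indicator {\<alpha>..<2 * pi} \<theta> + h \<theta> * indicator {2 * pi..<2 * pi + \<alpha>} \<theta> \<partial>lborel)"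
    using \<alpha> by (intro nn_integral_cong) (auto split: split_indicator)
  also have "\<dots> = (\<integral>\<^sup>+\<theta>. h \<theta> * indicator {\<alpha>..<2 * pi} \<theta> \<partial>lborel) +
      (\<integral>\<^sup>+\<theta>. h \<theta> * indicator {2 * pi..<2 * pi + \<alpha>} \<theta> \<partial>lborel)"
    by (rule nn_integral_add) simp_all
  also have "(\<integral>\<^sup>+\<theta>. h \<theta> * indicator {2 * pi..<2 * pi + \<alpha>} \<theta> \<partial>lborel) =
      (\<integral>\<^sup>+\<theta>. h (2 * pi + 1 * \<theta>) * indicator {2 * pi..<2 * pi + \<alpha>} (2 * pi + 1 * \<theta>) \<partial>lborel)"
    using nn_integral_real_affine[where c=1 and t="2 * pi"
        and f="\<lambda>\<theta>. h \<theta> * indicator {2 * pi..<2 * pi + \<alpha>} \<theta>"]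
    by simp
  also have "\<dots> = (\<integral>\<^sup>+\<theta>. h \<theta> * indicator {0..<\<alpha>} \<theta> \<partial>lborel)"
    using per by (intro nn_integral_cong) (auto simp: add.commute split: split_indicator)
  also have "(\<integral>\<^sup>+\<theta>. h \<theta> * indicator {\<alpha>..<2 * pi} \<theta> \<partial>lborel) + \<dots> =
      (\<integral>\<^sup>+\<theta>. h \<theta> * indicator {\<alpha>..<2 * pi} \<theta> + h \<theta> * indicator {0..<\<alpha>} \<theta> \<partial>lborel)"
    by (rule nn_integral_add[symmetric]) simp_all
  also have "\<dots> = (\<integral>\<^sup>+\<theta>. f (cis \<theta>) * indicator {0..<2 * pi} \<theta> \<partial>lborel)"
    unfolding h_def using \<alpha> by (intro nn_integral_cong) (auto split: split_indicator)
  also have "\<dots> = (\<integral>\<^sup>+z. f z \<partial>circle_measure)"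
    by (rule nn_integral_circle_measure[symmetric]) simp
  finally show ?thesis .
qed

text \<open>Two measures on the line with finite and equal masses on all rays \<open>{x<..}\<close>
  coincide. Here the masses are areas of annuli, which yields the density \<open>2 * pi * r\<close>
  of the radius.\<close>

lemma nn_integral_radial:
  assumes [measurable]: "G \<in> borel_measurable borel"
  shows "(\<integral>\<^sup>+z. G (cmod z) * indicator (ball (0::complex) 1) z \<partial>lborel) =
    (\<integral>\<^sup>+r. G r * (ennreal (2 * pi * r) * indicator {0..<1} r) \<partial>lborel)"
proof -
  define M1 where "M1 = distr (restrict_space lborel (ball (0::complex) 1)) borel cmod"
  define M2 where "M2 = density lborel (\<lambda>r. ennreal (2 * pi * r) * indicator {0..<1} r)"
  have m: "cmod \<in> borel_measurable (restrict_space lborel (ball 0 1))"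
    by (intro measurable_restrict_space1) simp
  \<comment> \<open>Clamping \<open>x\<close> to the unit interval covers the degenerate cases: the
    full disk for negative \<open>x\<close>, the empty set from 1 on.\<close>
  have e1: "emeasure M1 {x<..} = ennreal (pi * (1 - (max 0 (min x 1))\<^sup>2))" for x
  proof -
    have "emeasure M1 {x<..} = emeasure lborel ({z::complex. x < cmod z} \<inter> ball 0 1)"
      unfolding M1_def using m
      by (subst emeasure_distr) (auto simp: space_restrict_space emeasure_restrict_space
          intro!: arg_cong[where f="emeasure lborel"])
    also have "{z::complex. x < cmod z} \<inter> ball 0 1 = (if x < 0 then ball 0 1 else ball 0 1 - cball 0 (min x 1))"
      by (auto simp: min_def intro: less_le_trans)
    also have "emeasure lborel \<dots> = ennreal (pi * (1 - (max 0 (min x 1))\<^sup>2))"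
    proof (cases "x < 0")
      case True
      then show ?thesis by (simp add: emeasure_ball unit_ball_vol_2)
    next
      case False
      show ?thesis
      proof (cases "x < 1")
        case True
        have "emeasure lborel (ball (0::complex) 1 - cball 0 x) =
            emeasure lborel (ball (0::complex) 1) - emeasure lborel (cball (0::complex) x)"
          using True using False by (intro emeasure_Diff) (auto simp: emeasure_cball)
        then show ?thesis
          using True False
          by (simp add: emeasure_ball emeasure_cball unit_ball_vol_2 ennreal_minus algebra_simps)
      next
        case False
        have "ball (0::complex) 1 - cball 0 1 = {}" by auto
        then have "emeasure lborel (ball (0::complex) 1 - cball 0 1) = 0"
          by (metis emeasure_empty)
        with False show ?thesis by simp
      qed
    qed
    finally show ?thesis .
  qed
  have e2: "emeasure M2 {x<..} = ennreal (pi * (1 - (max 0 (min x 1))\<^sup>2))" for x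
  proof -
    define a where "a = max 0 (min x 1)"
    have a: "0 \<le> a" "a \<le> 1" by (auto simp: a_def)
    have "emeasure M2 {x<..} = (\<integral>\<^sup>+r. ennreal (2 * pi * r) * indicator {0..<1} r * indicator {x<..} r \<partial>lborel)"
      unfolding M2_def by (subst emeasure_density) simp_all
    \<comment> \<open>The two endpoints are null sets; passing to the closed interval makes the
      fundamental theorem applicable.\<close>
    also have "\<dots> = (\<integral>\<^sup>+r. ennreal (2 * pi * r) * indicator {a..1} r \<partial>lborel)"
      using AE_lborel_singleton[of a] AE_lborel_singleton[of 1]
      by (intro nn_integral_cong_AE, eventually_elim) (auto simp: a_def split: split_indicator)
    also have "\<dots> = ennreal (pi * 1\<^sup>2 - pi * a\<^sup>2)"
      using a by (intro nn_integral_FTC_Icc) (auto intro!: derivative_eq_intros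
          simp: has_real_derivative_iff_has_vector_derivative[symmetric])
    finally show ?thesis by (simp add: a_def algebra_simps)
  qed
  have "M1 = M2"
    by (rule measure_eqI_lessThan) (simp_all add: e1 e2, simp_all add: M1_def M2_def)
  have "(\<integral>\<^sup>+z. G (cmod z) * indicator (ball (0::complex) 1) z \<partial>lborel) = (\<integral>\<^sup>+r. G r \<partial>M1)"
    unfolding M1_def using m by (subst nn_integral_distr) (simp_all add: nn_integral_restrict_space)
  also have "\<dots> = (\<integral>\<^sup>+r. G r * (ennreal (2 * pi * r) * indicator {0..<1} r) \<partial>lborel)"
    unfolding \<open>M1 = M2\<close> M2_def by (subst nn_integral_density) (simp_all add: mult_ac)
  finally show ?thesis .
qed

text \<open>Averaging over all rotations reduces an integral over the disk to the integral of a radial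
  function.\<close>

lemma nn_integral_polar:
  fixes f :: "complex \<Rightarrow> ennreal"
  assumes [measurable]: "f \<in> borel_measurable borel"
  shows "(\<integral>\<^sup>+z. f z * indicator (ball 0 1) z \<partial>lborel) =
    (\<integral>\<^sup>+r. \<integral>\<^sup>+\<theta>. ennreal r * f (of_real r * cis \<theta>) * indicator {0..<2 * pi} \<theta> * indicator {0..<1} r \<partial>lborel \<partial>lborel)"
proof -
  have [measurable]: "cis \<in> borel_measurable borel"
    by (intro borel_measurable_continuous_onI continuous_intros)
  have [measurable]: "ball (0::complex) 1 \<in> sets borel"
    by simp
  \<comment> \<open>\<open>A z\<close> is \<open>2 * pi\<close> times the mean of \<open>f\<close>
    over the circle through \<open>z\<close> about the origin.\<close>
  define A where "A = (\<lambda>z. \<integral>\<^sup>+\<theta>. f (z * cis \<theta>) * indicator {0..<2 * pi} \<theta> \<partial>lborel)"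
  have A [measurable]: "A \<in> borel_measurable borel"
    unfolding A_def by measurable
  \<comment> \<open>The angle of \<open>z\<close> is absorbed by rotating the variable on the unit
    circle by \<open>cis (Arg z)\<close>.\<close>
  have rad: "A z = A (of_real (cmod z))" for z
  proof -
    have [measurable]: "(\<lambda>w. f (v * w)) \<in> borel_measurable circle_measure" for v
    proof -
      have "(\<lambda>w. f (v * w)) \<in> borel_measurable (restrict_space borel (sphere 0 1))"
        by (intro measurable_restrict_space1) simp
      then show ?thesis by (simp add: sets_circle_measure cong: measurable_cong_sets)
    qed
    have A': "A v = (\<integral>\<^sup>+w. f (v * w) \<partial>circle_measure)" for v
      unfolding A_def by (rule nn_integral_circle_measure[symmetric]) simp
    have "A (of_real (cmod z)) = (\<integral>\<^sup>+w. f (of_real (cmod z) * (cis (Arg z) * w)) \<partial>circle_measure)"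
      unfolding A' by (rule nn_integral_circle_rotation[symmetric]) simp_all
    also have "\<dots> = A z"
      unfolding A' mult.assoc[symmetric] by (simp flip: rcis_def add: rcis_cmod_Arg)
    finally show ?thesis ..
  qed
  \<comment> \<open>The area integral is written as an average over \<open>\<theta>\<close> of
    copies of itself, and each copy is then rotated by its own angle. The factor
    \<open>2 * pi\<close> is cancelled at the end.\<close>
  have "(\<integral>\<^sup>+z. f z * indicator (ball 0 1) z \<partial>lborel) * ennreal (2 * pi) =
      (\<integral>\<^sup>+\<theta>. (\<integral>\<^sup>+z. f z * indicator (ball 0 1) z \<partial>lborel) * indicator {0..<2 * pi} \<theta> \<partial>lborel)"
    by (simp add: nn_integral_cmult_indicator)
  also have "\<dots> = (\<integral>\<^sup>+\<theta>. (\<integral>\<^sup>+z. f (cis \<theta> * z) * indicator (ball 0 1) (cis \<theta> * z) \<partial>lborel)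
      * indicator {0..<2 * pi} \<theta> \<partial>lborel)"
    by (subst nn_integral_rotation[where f="\<lambda>z. f z * indicator (ball 0 1) z"]) simp_all
  also have "\<dots> = (\<integral>\<^sup>+\<theta>. (\<integral>\<^sup>+z. f (z * cis \<theta>) * indicator (ball 0 1) z * indicator {0..<2 * pi} \<theta> \<partial>lborel) \<partial>lborel)"
    by (subst nn_integral_multc[symmetric])
       (auto simp: indicator_def norm_mult mult.commute intro!: nn_integral_cong)
  also have "\<dots> = (\<integral>\<^sup>+z. (\<integral>\<^sup>+\<theta>. f (z * cis \<theta>) * indicator (ball 0 1) z * indicator {0..<2 * pi} \<theta> \<partial>lborel) \<partial>lborel)"
    by (rule lborel_pair.Fubini') measurable
  also have "\<dots> = (\<integral>\<^sup>+z. A z * indicator (ball 0 1) z \<partial>lborel)"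
    unfolding A_def by (subst nn_integral_multc[symmetric]) (auto simp: mult_ac)
  also have "\<dots> = (\<integral>\<^sup>+z. A (of_real (cmod z)) * indicator (ball (0::complex) 1) z \<partial>lborel)"
    by (simp flip: rad)
  also have "\<dots> = (\<integral>\<^sup>+r. A (of_real r) * (ennreal (2 * pi * r) * indicator {0..<1} r) \<partial>lborel)"
    by (rule nn_integral_radial) simp
  also have "\<dots> = (\<integral>\<^sup>+r. (ennreal r * A (of_real r) * indicator {0..<1} r) * ennreal (2 * pi) \<partial>lborel)"
    by (intro nn_integral_cong) (auto simp: ennreal_mult mult_ac split: split_indicator)
  also have "\<dots> = (\<integral>\<^sup>+r. (ennreal r * A (of_real r) * indicator {0..<1} r) \<partial>lborel) * ennreal (2 * pi)"
    by (rule nn_integral_multc) simp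
  finally have "(\<integral>\<^sup>+z. f z * indicator (ball 0 1) z \<partial>lborel) =
      (\<integral>\<^sup>+r. (ennreal r * A (of_real r) * indicator {0..<1} r) \<partial>lborel)"
    by (subst (asm) (1 2) mult.commute, subst (asm) ennreal_mult_cancel_left) auto
  also have "\<dots> = (\<integral>\<^sup>+r. \<integral>\<^sup>+\<theta>. ennreal r * f (of_real r * cis \<theta>) * indicator {0..<2 * pi} \<theta> * indicator {0..<1} r \<partial>lborel \<partial>lborel)"
    unfolding A_def
    by (subst nn_integral_cmult[symmetric], simp, subst nn_integral_multc[symmetric]) (simp_all add: mult_ac)
  finally show ?thesis .
qed

section \<open>Square-integrable functions\<close>

lemma L2D:
  assumes "f \<in> L2 M"
  shows "f \<in> borel_measurable M" "integrable M (\<lambda>x. (norm (f x))\<^sup>2)"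
  using assms by (auto simp: L2_def)

lemma integrable_inner_L2:
  fixes f g :: "'a \<Rightarrow> 'b::euclidean_space"
  assumes f: "f \<in> L2 M" and g: "g \<in> L2 M"
  shows "integrable M (\<lambda>x. f x \<bullet> g x)"
proof (rule Bochner_Integration.integrable_bound)
  show "integrable M (\<lambda>x. (norm (f x))\<^sup>2 + (norm (g x))\<^sup>2)"
    using L2D[OF f] L2D[OF g] by auto
  show "(\<lambda>x. f x \<bullet> g x) \<in> borel_measurable M"
    using L2D[OF f] L2D[OF g] by measurable
  have "\<bar>f x \<bullet> g x\<bar> \<le> (norm (f x))\<^sup>2 + (norm (g x))\<^sup>2" for x
  proof -
    have "\<bar>f x \<bullet> g x\<bar> \<le> norm (f x) * norm (g x)"
      by (rule Cauchy_Schwarz_ineq2)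
    also have "\<dots> \<le> (norm (f x))\<^sup>2 + (norm (g x))\<^sup>2"
      using sum_squares_bound[of "norm (f x)" "norm (g x)"]
        mult_nonneg_nonneg[OF norm_ge_zero[of "f x"] norm_ge_zero[of "g x"]] by linarith
    finally show ?thesis .
  qed
  then show "AE x in M. norm (f x \<bullet> g x) \<le> norm ((norm (f x))\<^sup>2 + (norm (g x))\<^sup>2)"
    by simp
qed

lemma integrable_mult_L2:
  fixes f g :: "'a \<Rightarrow> real"
  shows "f \<in> L2 M \<Longrightarrow> g \<in> L2 M \<Longrightarrow> integrable M (\<lambda>x. f x * g x)"
  using integrable_inner_L2[of f M g] by simp

lemma integrable_scaleR_L2:
  fixes f :: "'a \<Rightarrow> real" and g :: "'a \<Rightarrow> 'b::euclidean_space"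
  assumes f: "f \<in> L2 M" and g: "g \<in> L2 M"
  shows "integrable M (\<lambda>x. f x *\<^sub>R g x)"
proof (rule Bochner_Integration.integrable_bound)
  show "integrable M (\<lambda>x. (norm (f x))\<^sup>2 + (norm (g x))\<^sup>2)"
    using L2D[OF f] L2D[OF g] by auto
  show "(\<lambda>x. f x *\<^sub>R g x) \<in> borel_measurable M"
    using L2D[OF f] L2D[OF g] by measurable
  have "norm (f x *\<^sub>R g x) \<le> (norm (f x))\<^sup>2 + (norm (g x))\<^sup>2" for x
    using sum_squares_bound[of "norm (f x)" "norm (g x)"]
      mult_nonneg_nonneg[OF norm_ge_zero[of "f x"] norm_ge_zero[of "g x"]]
    unfolding norm_scaleR real_norm_def by linarith
  then show "AE x in M. norm (f x *\<^sub>R g x) \<le> norm ((norm (f x))\<^sup>2 + (norm (g x))\<^sup>2)"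
    by simp
qed

lemma L2_scaleR:
  "f \<in> L2 M \<Longrightarrow> (\<lambda>x. c *\<^sub>R f x) \<in> L2 M"
  by (auto simp: L2_def power_mult_distrib)

lemma L2_add:
  assumes f: "f \<in> L2 M" and g: "g \<in> L2 M"
  shows "(\<lambda>x. f x + g x) \<in> L2 M"
proof -
  have "(norm (f x + g x))\<^sup>2 = (norm (f x))\<^sup>2 + 2 * (f x \<bullet> g x) + (norm (g x))\<^sup>2" for x
    by (simp add: power2_norm_eq_inner inner_add_left inner_add_right inner_commute)
  then show ?thesis
    using L2D[OF f] L2D[OF g] integrable_inner_L2[OF f g] by (auto simp: L2_def)
qed

lemma L2_diff:
  "f \<in> L2 M \<Longrightarrow> g \<in> L2 M \<Longrightarrow> (\<lambda>x. f x - g x) \<in> L2 M"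
  using L2_add[of f M "\<lambda>x. (-1) *\<^sub>R g x"] L2_scaleR[of g M "-1"] by simp

lemma L2_cong_AE:
  assumes "f \<in> L2 M" "g \<in> borel_measurable M" "AE x in M. f x = g x"
  shows "g \<in> L2 M"
proof -
  have [measurable]: "f \<in> borel_measurable M" "g \<in> borel_measurable M"
    using assms L2D by auto
  have "integrable M (\<lambda>x. (norm (f x))\<^sup>2) \<longleftrightarrow> integrable M (\<lambda>x. (norm (g x))\<^sup>2)"
    by (rule integrable_cong_AE) (use assms(3) in \<open>auto elim: eventually_mono\<close>)
  then show ?thesis
    using assms by (auto simp: L2_def)
qed

lemma L2_bounded_mult:
  fixes \<sigma> :: "'a \<Rightarrow> real"
  assumes f: "f \<in> L2 M" and [measurable]: "\<sigma> \<in> borel_measurable M" and C: "AE x in M. \<bar>\<sigma> x\<bar> \<le> C"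
  shows "(\<lambda>x. \<sigma> x *\<^sub>R f x) \<in> L2 M"
proof -
  have [measurable]: "f \<in> borel_measurable M"
    using L2D[OF f] by auto
  have "integrable M (\<lambda>x. (norm (\<sigma> x *\<^sub>R f x))\<^sup>2)"
  proof (rule Bochner_Integration.integrable_bound)
    show "integrable M (\<lambda>x. C\<^sup>2 * (norm (f x))\<^sup>2)"
      using L2D[OF f] by auto
    show "AE x in M. norm ((norm (\<sigma> x *\<^sub>R f x))\<^sup>2) \<le> norm (C\<^sup>2 * (norm (f x))\<^sup>2)"
      using C by eventually_elim
        (simp add: power_mult_distrib, intro mult_right_mono, metis abs_ge_zero power2_abs power_mono, simp)
  qed measurable
  then show ?thesis by (simp add: L2_def)
qed

lemma (in finite_measure) L2_bounded:
  fixes f :: "'a \<Rightarrow> 'b::euclidean_space"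
  assumes [measurable]: "f \<in> borel_measurable M" and C: "\<And>x. x \<in> space M \<Longrightarrow> norm (f x) \<le> C"
  shows "f \<in> L2 M"
proof -
  have "integrable M (\<lambda>x. (norm (f x))\<^sup>2)"
    by (rule integrable_const_bound[where B="C\<^sup>2"]) (auto intro!: AE_I2 power_mono C)
  then show ?thesis by (simp add: L2_def)
qed

lemma (in finite_measure) integrable_L2:
  fixes f :: "'a \<Rightarrow> 'b::euclidean_space"
  assumes f: "f \<in> L2 M"
  shows "integrable M f"
proof (rule Bochner_Integration.integrable_bound)
  show "integrable M (\<lambda>x. 1 + (norm (f x))\<^sup>2)"
    using L2D[OF f] by auto
  have "norm (f x) \<le> 1 + (norm (f x))\<^sup>2" for x
    using sum_squares_bound[of 1 "norm (f x)"] norm_ge_zero[of "f x"] unfolding one_power2 by linarith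
  then show "AE x in M. norm (f x) \<le> norm (1 + (norm (f x))\<^sup>2)"
    by simp
qed (use L2D[OF f] in auto)

lemma integral_norm_diff_L2:
  fixes f g :: "'a \<Rightarrow> 'b::euclidean_space"
  assumes f: "f \<in> L2 M" and g: "g \<in> L2 M"
  shows "(LINT x|M. (norm (f x - g x))\<^sup>2) =
    (LINT x|M. (norm (f x))\<^sup>2) - 2 * (LINT x|M. f x \<bullet> g x) + (LINT x|M. (norm (g x))\<^sup>2)"
proof -
  have "(norm (f x - g x))\<^sup>2 = (norm (f x))\<^sup>2 - 2 * (f x \<bullet> g x) + (norm (g x))\<^sup>2" for x
    by (simp add: power2_norm_eq_inner inner_diff_left inner_diff_right inner_commute)
  then show ?thesis
    using L2D[OF f] L2D[OF g] integrable_inner_L2[OF f g] by simp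
qed

lemma Cauchy_Schwarz_L2:
  fixes f g :: "'a \<Rightarrow> 'b::euclidean_space"
  assumes f: "f \<in> L2 M" and g: "g \<in> L2 M"
  shows "\<bar>LINT x|M. f x \<bullet> g x\<bar> \<le> sqrt (LINT x|M. (norm (f x))\<^sup>2) * sqrt (LINT x|M. (norm (g x))\<^sup>2)"
proof -
  define A B c where "A = (LINT x|M. (norm (f x))\<^sup>2)" and "B = (LINT x|M. (norm (g x))\<^sup>2)"
    and "c = (LINT x|M. f x \<bullet> g x)"
  \<comment> \<open>The squared norm of \<open>f - t g\<close> is a nonnegative quadratic polynomial
    in \<open>t\<close>; the two cases below evaluate it at a suitable point.\<close>
  have q: "0 \<le> A - 2 * (t * c) + t\<^sup>2 * B" for t
  proof -
    have "0 \<le> (LINT x|M. (norm (f x - t *\<^sub>R g x))\<^sup>2)"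
      by (rule Bochner_Integration.integral_nonneg) simp
    also have "\<dots> = A - 2 * (t * c) + t\<^sup>2 * B"
      unfolding A_def B_def c_def integral_norm_diff_L2[OF f L2_scaleR[OF g]]
      by (simp add: power_mult_distrib)
    finally show ?thesis .
  qed
  have AB: "0 \<le> A" "0 \<le> B"
    unfolding A_def B_def by (auto intro!: Bochner_Integration.integral_nonneg)
  have "c\<^sup>2 \<le> A * B"
  proof (cases "B = 0")
    case True
    have "c = 0"
    proof (rule ccontr)
      assume "c \<noteq> 0"
      \<comment> \<open>With \<open>B = 0\<close> the polynomial is affine in \<open>t\<close>, and
        this value of \<open>t\<close> makes it equal to -1.\<close>
      then show False
        using q[of "(A + 1) / (2 * c)"] True by (simp add: field_simps)
    qed
    with AB show ?thesis by simp
  next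
    case False
    with AB have "0 < B" by simp
    \<comment> \<open>\<open>c / B\<close> is the minimiser of the quadratic.\<close>
    have "0 \<le> A - c\<^sup>2 / B"
      using q[of "c / B"] \<open>0 < B\<close> by (simp add: power2_eq_square field_simps)
    then show ?thesis using \<open>0 < B\<close> by (simp add: field_simps)
  qed
  then have "sqrt (c\<^sup>2) \<le> sqrt (A * B)"
    by (rule real_sqrt_le_mono)
  then show ?thesis
    by (simp add: A_def B_def c_def real_sqrt_mult)
qed

text \<open>The difference of the pairings splits bilinearly into three terms, each with at least
  one vanishing factor after Cauchy-Schwarz.\<close>

lemma tendsto_inner_L2:
  fixes f g :: "'a \<Rightarrow> 'b::euclidean_space"
  assumes f: "f \<in> L2 M" and g: "g \<in> L2 M"
    and fk: "\<And>k. fk k \<in> L2 M" and gk: "\<And>k. gk k \<in> L2 M"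
    and lf: "(\<lambda>k. LINT x|M. (norm (fk k x - f x))\<^sup>2) \<longlonglongrightarrow> 0"
    and lg: "(\<lambda>k. LINT x|M. (norm (gk k x - g x))\<^sup>2) \<longlonglongrightarrow> 0"
  shows "(\<lambda>k. LINT x|M. fk k x \<bullet> gk k x) \<longlonglongrightarrow> (LINT x|M. f x \<bullet> g x)"
proof -
  define F G where "F = (\<lambda>k. sqrt (LINT x|M. (norm (fk k x - f x))\<^sup>2))"
    and "G = (\<lambda>k. sqrt (LINT x|M. (norm (gk k x - g x))\<^sup>2))"
  define f0 g0 where "f0 = sqrt (LINT x|M. (norm (f x))\<^sup>2)" and "g0 = sqrt (LINT x|M. (norm (g x))\<^sup>2)"
  have F: "F \<longlonglongrightarrow> 0" and G: "G \<longlonglongrightarrow> 0"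
    unfolding F_def G_def using tendsto_real_sqrt[OF lf] tendsto_real_sqrt[OF lg] by simp_all
  have b: "\<bar>(LINT x|M. fk k x \<bullet> gk k x) - (LINT x|M. f x \<bullet> g x)\<bar> \<le> F k * G k + F k * g0 + f0 * G k" for k
  proof -
    note d = L2_diff[OF fk[of k] f] L2_diff[OF gk[of k] g]
    have "fk k x \<bullet> gk k x = (fk k x - f x) \<bullet> (gk k x - g x) + (fk k x - f x) \<bullet> g x +
        f x \<bullet> (gk k x - g x) + f x \<bullet> g x" for x
      by (simp add: inner_diff_left inner_diff_right)
    then have "(LINT x|M. fk k x \<bullet> gk k x) - (LINT x|M. f x \<bullet> g x) =
        (LINT x|M. (fk k x - f x) \<bullet> (gk k x - g x)) + (LINT x|M. (fk k x - f x) \<bullet> g x) +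
        (LINT x|M. f x \<bullet> (gk k x - g x))"
      using integrable_inner_L2[OF d] integrable_inner_L2[OF d(1) g] integrable_inner_L2[OF f d(2)]
        integrable_inner_L2[OF f g] by simp
    also have "\<bar>\<dots>\<bar> \<le> F k * G k + F k * g0 + f0 * G k"
      using Cauchy_Schwarz_L2[OF d] Cauchy_Schwarz_L2[OF d(1) g] Cauchy_Schwarz_L2[OF f d(2)]
      unfolding F_def G_def f0_def g0_def by linarith
    finally show ?thesis .
  qed
  have "(\<lambda>k. F k * G k + F k * g0 + f0 * G k) \<longlonglongrightarrow> 0 * 0 + 0 * g0 + f0 * 0"
    by (intro tendsto_add tendsto_mult tendsto_const F G)
  then have lim: "(\<lambda>k. F k * G k + F k * g0 + f0 * G k) \<longlonglongrightarrow> 0"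
    by simp
  have "(\<lambda>k. (LINT x|M. fk k x \<bullet> gk k x) - (LINT x|M. f x \<bullet> g x)) \<longlonglongrightarrow> 0"
    by (rule Lim_null_comparison[OF _ lim]) (simp add: b)
  then show ?thesis by (rule LIM_zero_cancel)
qed

lemma tendsto_inner_left_L2:
  fixes f g :: "'a \<Rightarrow> 'b::euclidean_space"
  assumes "f \<in> L2 M" "g \<in> L2 M" "\<And>k. fk k \<in> L2 M"
    and "(\<lambda>k. LINT x|M. (norm (fk k x - f x))\<^sup>2) \<longlonglongrightarrow> 0"
  shows "(\<lambda>k. LINT x|M. fk k x \<bullet> g x) \<longlonglongrightarrow> (LINT x|M. f x \<bullet> g x)"
  by (rule tendsto_inner_L2) (use assms in auto)

lemma nn_integral_L2:
  assumes "f \<in> L2 M"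
  shows "(\<integral>\<^sup>+x. ennreal ((norm (f x))\<^sup>2) \<partial>M) = ennreal (LINT x|M. (norm (f x))\<^sup>2)"
  by (rule nn_integral_eq_integral) (use L2D[OF assms] in auto)

text \<open>Riesz-Fischer. On a finite measure space small L2 increments give summable L1
  increments, hence an almost everywhere convergent subsequence; Fatou's lemma turns its pointwise
  limit into the L2 limit of the whole sequence.\<close>

lemma L2_complete:
  fixes f :: "nat \<Rightarrow> 'a \<Rightarrow> 'b::euclidean_space"
  assumes "finite_measure M" and f: "\<And>k. f k \<in> L2 M"
    and Cauchy: "\<And>e. 0 < e \<Longrightarrow> \<exists>N. \<forall>m\<ge>N. \<forall>n\<ge>N. (LINT x|M. (norm (f m x - f n x))\<^sup>2) < e"
  shows "\<exists>g\<in>L2 M. (\<lambda>k. LINT x|M. (norm (f k x - g x))\<^sup>2) \<longlonglongrightarrow> 0"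
proof -
  interpret finite_measure M by fact
  have [measurable]: "f k \<in> borel_measurable M" for k
    using L2D[OF f] by auto
  \<comment> \<open>The bound is for squared norms, so consecutive terms of the subsequence will
    differ by at most \<open>(1/2)^j\<close> in norm.\<close>
  have "\<exists>N. \<forall>j. \<forall>m\<ge>N j. \<forall>n\<ge>N j. (LINT x|M. (norm (f m x - f n x))\<^sup>2) < (1/4)^j"
    by (rule choice) (auto intro!: Cauchy)
  then obtain N where N: "\<And>j m n. m \<ge> N j \<Longrightarrow> n \<ge> N j \<Longrightarrow> (LINT x|M. (norm (f m x - f n x))\<^sup>2) < (1/4)^j"
    by blast
  \<comment> \<open>The maximum makes the indices nondecreasing, so both \<open>r j\<close> and
    \<open>r (Suc j)\<close> lie beyond \<open>N j\<close>.\<close>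
  define r where "r = (\<lambda>j. Max (N ` {..j}))"
  have r: "N j \<le> r j" "r j \<le> r (Suc j)" for j
    unfolding r_def by (auto intro!: Max_ge Max_mono)
  define d where "d = (\<lambda>j x. f (r (Suc j)) x - f (r j) x)"
  have [measurable]: "d j \<in> borel_measurable M" for j
    unfolding d_def by measurable
  have d2: "d j \<in> L2 M" "(LINT x|M. (norm (d j x))\<^sup>2) \<le> (1/4)^j" for j
    unfolding d_def using N[OF order_trans[OF r] r(1)] by (auto intro!: L2_diff f less_imp_le)
  define \<mu> where "\<mu> = measure M (space M)"
  have d1: "(\<integral>\<^sup>+x. ennreal (norm (d j x)) \<partial>M) \<le> ennreal ((\<mu> + 1) * (1/2)^j)" for j
  proof -
    \<comment> \<open>Arithmetic-geometric mean with weight \<open>2^j\<close>: after integration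
      the square contributes \<open>2^j * (1/4)^j\<close>, so both terms decay like
      \<open>(1/2)^j\<close>.\<close>
    have p: "norm (d j x) \<le> (1/2)^j + 2^j * (norm (d j x))\<^sup>2" for x
    proof -
      have "0 \<le> (1 - 2^j * norm (d j x))\<^sup>2" by simp
      then have "2 * (2^j * norm (d j x)) \<le> 1 + 2^j * 2^j * (norm (d j x))\<^sup>2"
        by (simp add: power2_eq_square algebra_simps)
      moreover have "0 \<le> 2^j * norm (d j x)" by simp
      moreover have "2^j * ((1/2)^j + 2^j * (norm (d j x))\<^sup>2) = 1 + 2^j * 2^j * (norm (d j x))\<^sup>2"
        by (simp add: algebra_simps power_one_over)
      ultimately have "2^j * norm (d j x) \<le> 2^j * ((1/2)^j + 2^j * (norm (d j x))\<^sup>2)"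
        by linarith
      then show ?thesis by simp
    qed
    have "(\<integral>\<^sup>+x. ennreal (norm (d j x)) \<partial>M) = ennreal (LINT x|M. norm (d j x))"
      by (rule nn_integral_eq_integral) (use integrable_L2[OF d2(1)] in auto)
    also have "(LINT x|M. norm (d j x)) \<le> (LINT x|M. (1/2)^j + 2^j * (norm (d j x))\<^sup>2)"
      using integrable_L2[OF d2(1)] L2D(2)[OF d2(1)] p by (intro integral_mono) auto
    also have "\<dots> = \<mu> * (1/2)^j + 2^j * (LINT x|M. (norm (d j x))\<^sup>2)"
      using L2D(2)[OF d2(1)] by (simp add: \<mu>_def)
    also have "\<dots> \<le> \<mu> * (1/2)^j + 2^j * (1/4)^j"
      using d2(2)[of j] by simp
    also have "\<dots> = (\<mu> + 1) * (1/2)^j"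
      by (simp add: algebra_simps flip: power_mult_distrib)
    finally show ?thesis by (simp add: ennreal_leI)
  qed
  have "(\<integral>\<^sup>+x. (\<Sum>j. ennreal (norm (d j x))) \<partial>M) = (\<Sum>j. \<integral>\<^sup>+x. ennreal (norm (d j x)) \<partial>M)"
    by (rule nn_integral_suminf) simp
  also have "\<dots> \<le> (\<Sum>j. ennreal ((\<mu> + 1) * (1/2)^j))"
    by (rule suminf_le) (auto intro: d1)
  also have "\<dots> = ennreal (\<Sum>j. (\<mu> + 1) * (1/2)^j)"
    by (rule suminf_ennreal2) (auto simp: \<mu>_def intro!: summable_mult summable_geometric)
  also have "\<dots> < \<infinity>" by simp
  finally have "AE x in M. (\<Sum>j. ennreal (norm (d j x))) \<noteq> \<infinity>"
    by (intro nn_integral_PInf_AE) auto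
  then have conv: "AE x in M. (\<lambda>j. f (r j) x) \<longlonglongrightarrow> lim (\<lambda>j. f (r j) x)"
  proof eventually_elim
    case (elim x)
    have tel: "(\<Sum>j<n. d j x) = f (r n) x - f (r 0) x" for n
      unfolding d_def by (rule sum_lessThan_telescope)
    have "summable (\<lambda>j. norm (d j x))"
      by (rule summable_suminf_not_top[OF norm_ge_zero elim[unfolded infinity_ennreal_def]])
    then have "summable (\<lambda>j. d j x)"
      by (rule summable_norm_cancel)
    from summable_LIMSEQ[OF this]
    have "(\<lambda>n. f (r n) x - f (r 0) x) \<longlonglongrightarrow> (\<Sum>j. d j x)"
      unfolding tel .
    from tendsto_add[OF this tendsto_const[of "f (r 0) x"]]
    have "convergent (\<lambda>n. f (r n) x)"
      unfolding convergent_def diff_add_cancel by blast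
    then show ?case
      by (simp only: convergent_LIMSEQ_iff)
  qed
  \<comment> \<open>Where the subsequence diverges \<open>lim\<close> is some unspecified value,
    which matters only on a null set.\<close>
  define g where "g = (\<lambda>x. lim (\<lambda>j. f (r j) x))"
  have [measurable]: "g \<in> borel_measurable M"
    unfolding g_def by measurable
  \<comment> \<open>Fatou's lemma along the subsequence \<open>r j\<close> with \<open>m\<close>
    fixed; it also supplies the integrability from which \<open>g\<close> is seen to be
    square-integrable.\<close>
  have fat: "(\<integral>\<^sup>+x. ennreal ((norm (f m x - g x))\<^sup>2) \<partial>M) \<le> ennreal ((1/4)^i)" if m: "N i \<le> m" for m i
  proof -
    have ev: "\<forall>\<^sub>F j in sequentially. (\<integral>\<^sup>+x. ennreal ((norm (f m x - f (r j) x))\<^sup>2) \<partial>M) \<le> ennreal ((1/4)^i)"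
        using eventually_ge_at_top[of i]
      proof eventually_elim
        case (elim j)
        have "N i \<le> r j"
          unfolding r_def by (rule Max_ge) (use elim in simp_all)
        from N[OF m this] show ?case
          unfolding nn_integral_L2[OF L2_diff[OF f f]] by (intro ennreal_leI less_imp_le)
      qed
    have "AE x in M. ennreal ((norm (f m x - g x))\<^sup>2) =
        liminf (\<lambda>j. ennreal ((norm (f m x - f (r j) x))\<^sup>2))"
      using conv
    proof eventually_elim
      case (elim x)
      have "(\<lambda>j. ennreal ((norm (f m x - f (r j) x))\<^sup>2)) \<longlonglongrightarrow> ennreal ((norm (f m x - g x))\<^sup>2)"
        unfolding g_def by (rule tendsto_ennrealI[OF tendsto_power[OF tendsto_norm[OF tendsto_diff[OF tendsto_const elim]]]])
      then show ?case
        by (rule lim_imp_Liminf[OF trivial_limit_sequentially, symmetric])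
    qed
    then have "(\<integral>\<^sup>+x. ennreal ((norm (f m x - g x))\<^sup>2) \<partial>M) =
        (\<integral>\<^sup>+x. liminf (\<lambda>j. ennreal ((norm (f m x - f (r j) x))\<^sup>2)) \<partial>M)"
      by (rule nn_integral_cong_AE)
    also have "\<dots> \<le> liminf (\<lambda>j. \<integral>\<^sup>+x. ennreal ((norm (f m x - f (r j) x))\<^sup>2) \<partial>M)"
      by (rule nn_integral_liminf) simp
    also have "\<dots> \<le> ennreal ((1/4)^i)"
      by (rule Liminf_le[OF _ ev]) simp
    finally show ?thesis .
  qed
  have int: "(\<lambda>x. f m x - g x) \<in> L2 M" if m: "N i \<le> m" for m i
    using fat[OF m] by (simp add: L2_def integrable_iff_bounded le_less_trans[OF _ ennreal_less_top])
  have g: "g \<in> L2 M"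
    using L2_diff[OF f[of "N 0"] int[of 0 "N 0"]] by simp
  have bd: "(LINT x|M. (norm (f m x - g x))\<^sup>2) \<le> (1/4)^i" if m: "N i \<le> m" for m i
    using fat[OF m] nn_integral_L2[OF int[OF m]] by (simp add: ennreal_le_iff)
  have "(\<lambda>k. LINT x|M. (norm (f k x - g x))\<^sup>2) \<longlonglongrightarrow> 0"
  proof (rule LIMSEQ_I)
    fix e :: real assume "0 < e"
    then obtain i where "(1/4)^i < e"
      using real_arch_pow_inv[of e "1/4"] by auto
    then show "\<exists>no. \<forall>n\<ge>no. norm ((LINT x|M. (norm (f n x - g x))\<^sup>2) - 0) < e"
      using bd[of i] by (intro exI[of _ "N i"]) (auto intro!: le_less_trans[of _ "(1/4)^i" e])
  qed
  with g show ?thesis by blast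
qed

section \<open>Functions of class \<open>C\<^sup>1\<close>\<close>

lemma measurable_cis [measurable]: "cis \<in> borel_measurable borel"
  by (intro borel_measurable_continuous_onI continuous_intros)

lemma space_disk_measure [simp]: "space disk_measure = ball 0 1"
  by (simp add: disk_measure_def)

interpretation disk: finite_measure disk_measure
  by standard (simp add: disk_measure_def emeasure_restrict_space emeasure_ball)

lemma borel_measurable_disk_measure:
  "f \<in> borel_measurable borel \<Longrightarrow> f \<in> borel_measurable disk_measure"
  unfolding disk_measure_def
  by (rule measurable_restrict_space1) (simp add: measurable_completion)

lemma borel_measurable_circle_measure:
  "f \<in> borel_measurable borel \<Longrightarrow> f \<in> borel_measurable circle_measure"
  unfolding measurable_cong_sets[OF sets_circle_measure refl] by (rule measurable_restrict_space1)

lemma nn_integral_disk_measure: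
  fixes f :: "complex \<Rightarrow> ennreal"
  assumes "f \<in> borel_measurable borel"
  shows "(\<integral>\<^sup>+z. f z \<partial>disk_measure) = (\<integral>\<^sup>+z. f z * indicator (ball 0 1) z \<partial>lborel)"
  using assms by (simp add: disk_measure_def nn_integral_restrict_space nn_integral_completion)

lemma integral_disk_measure:
  fixes f :: "complex \<Rightarrow> 'b::{banach, second_countable_topology}"
  assumes "f \<in> borel_measurable borel"
  shows "(LINT z|disk_measure. f z) = (LBINT z. indicator (ball 0 1) z *\<^sub>R f z)"
proof -
  have [measurable]: "f \<in> borel_measurable borel" "ball (0::complex) 1 \<in> sets borel"
    using assms by simp_all
  have "(\<lambda>z. indicator (ball 0 1) z *\<^sub>R f z) \<in> borel_measurable lborel"
    by measurable
  from integral_completion[OF this] show ?thesis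
    by (simp add: disk_measure_def integral_restrict_space)
qed

text \<open>The increment is the integral of the derivative, and Cauchy-Schwarz against the constant
  1 on the interval produces the length \<open>b - a\<close>.\<close>

lemma FTC_square_bound:
  fixes f f' :: "real \<Rightarrow> real"
  assumes ab: "a \<le> b" and f: "\<And>x. (f has_real_derivative f' x) (at x)"
    and f': "continuous_on UNIV f'"
  shows "ennreal ((f b - f a)\<^sup>2) \<le> ennreal (b - a) * (\<integral>\<^sup>+x. ennreal ((f' x)\<^sup>2) * indicator {a..<b} x \<partial>lborel)"
proof -
  have [measurable]: "f' \<in> borel_measurable borel"
    by (rule borel_measurable_continuous_onI[OF f'])
  have "f b - f a = (LBINT x. indicator {a..b} x *\<^sub>R f' x)"
    by (rule integral_FTC_atLeastAtMost[symmetric])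
       (use ab f f' in \<open>auto intro: continuous_on_subset has_field_derivative_at_within
          simp: has_real_derivative_iff_has_vector_derivative[symmetric]\<close>)
  then have "ennreal \<bar>f b - f a\<bar> \<le> (\<integral>\<^sup>+x. ennreal (norm (indicator {a..b} x *\<^sub>R f' x)) \<partial>lborel)"
    using integral_norm_bound_ennreal[of lborel "\<lambda>x. indicator {a..b} x *\<^sub>R f' x"]
      borel_integrable_atLeastAtMost'[of a b f'] f'
    by (auto simp: set_integrable_def intro: continuous_on_subset)
  \<comment> \<open>The indicator is written twice so that its second copy can play the constant 1
    in Cauchy-Schwarz.\<close>
  also have "\<dots> = (\<integral>\<^sup>+x. (ennreal \<bar>f' x\<bar> * indicator {a..<b} x) * indicator {a..<b} x \<partial>lborel)"
    using AE_lborel_singleton[of b]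
    by (intro nn_integral_cong_AE, eventually_elim) (auto split: split_indicator)
  finally have "(ennreal \<bar>f b - f a\<bar>)\<^sup>2 \<le> \<dots>\<^sup>2"
    by (rule power_mono) simp
  also have "\<dots> \<le> (\<integral>\<^sup>+x. (ennreal \<bar>f' x\<bar> * indicator {a..<b} x)\<^sup>2 \<partial>lborel) * (\<integral>\<^sup>+x. (indicator {a..<b} x)\<^sup>2 \<partial>lborel)"
    by (rule Cauchy_Schwarz_nn_integral) simp_all
  also have "(\<integral>\<^sup>+x. (indicator {a..<b} x :: ennreal)\<^sup>2 \<partial>lborel) = (\<integral>\<^sup>+x. indicator {a..<b} x \<partial>lborel)"
    by (intro nn_integral_cong) (auto split: split_indicator)
  also have "\<dots> = ennreal (b - a)"
    using ab by simp
  also have "(\<integral>\<^sup>+x. (ennreal \<bar>f' x\<bar> * indicator {a..<b} x)\<^sup>2 \<partial>lborel) =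
      (\<integral>\<^sup>+x. ennreal ((f' x)\<^sup>2) * indicator {a..<b} x \<partial>lborel)"
    by (intro nn_integral_cong) (auto simp: ennreal_power split: split_indicator)
  finally show ?thesis
    by (simp add: ennreal_power mult.commute)
qed

lemma C1_with_gradientD:
  assumes "C1_with_gradient w dw"
  shows "continuous_on A w" "continuous_on A dw"
    "w \<in> borel_measurable borel" "dw \<in> borel_measurable borel"
    "(w has_derivative (\<lambda>h. h \<bullet> dw z)) (at z within B)"
proof -
  have d: "(w has_derivative (\<lambda>h. h \<bullet> dw z)) (at z within B)" for z B
    using assms by (auto simp: C1_with_gradient_def gderiv_def intro: has_derivative_at_withinI)
  show "(w has_derivative (\<lambda>h. h \<bullet> dw z)) (at z within B)" by fact
  show w: "continuous_on A w" for A
    by (rule has_derivative_continuous_on[OF d])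
  show dw: "continuous_on A dw" for A
    using assms by (auto simp: C1_with_gradient_def intro: continuous_on_subset)
  show "w \<in> borel_measurable borel" "dw \<in> borel_measurable borel"
    using w dw by (auto intro: borel_measurable_continuous_onI)
qed

lemma C1_with_gradient_add:
  "C1_with_gradient v dv \<Longrightarrow> C1_with_gradient w dw \<Longrightarrow>
    C1_with_gradient (\<lambda>z. v z + w z) (\<lambda>z. dv z + dw z)"
  by (auto simp: C1_with_gradient_def intro!: GDERIV_add continuous_intros)

lemma C1_with_gradient_const: "C1_with_gradient (\<lambda>_. c) (\<lambda>_. 0)"
  by (auto simp: C1_with_gradient_def intro!: GDERIV_const continuous_intros)

lemma C1_with_gradient_mult:
  "C1_with_gradient v dv \<Longrightarrow> C1_with_gradient w dw \<Longrightarrow>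
    C1_with_gradient (\<lambda>z. v z * w z) (\<lambda>z. v z *\<^sub>R dw z + w z *\<^sub>R dv z)"
  using C1_with_gradientD[of v dv] C1_with_gradientD[of w dw]
  by (auto simp: C1_with_gradient_def intro!: GDERIV_mult continuous_intros)

lemma C1_with_gradient_scale:
  "C1_with_gradient w dw \<Longrightarrow> C1_with_gradient (\<lambda>z. c * w z) (\<lambda>z. c *\<^sub>R dw z)"
  using C1_with_gradient_mult[OF C1_with_gradient_const[of c], of w dw] by simp

text \<open>Chain rule: for the real inner product on the plane, the adjoint of multiplication by
  \<open>c\<close> is multiplication by \<open>cnj c\<close>.\<close>

lemma C1_with_gradient_rotation:
  assumes "C1_with_gradient w dw"
  shows "C1_with_gradient (\<lambda>z. w (c * z)) (\<lambda>z. cnj c * dw (c * z))"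
proof -
  have "((\<lambda>z. w (c * z)) has_derivative (\<lambda>h. h \<bullet> (cnj c * dw (c * z)))) (at z)" for z
  proof -
    have "((\<lambda>z. w (c * z)) has_derivative (\<lambda>h. (c * h) \<bullet> dw (c * z))) (at z)"
      by (rule has_derivative_compose[where f="\<lambda>z. c * z" and g=w, OF _ C1_with_gradientD(5)[OF assms]])
         (auto intro!: derivative_eq_intros)
    also have "(\<lambda>h. (c * h) \<bullet> dw (c * z)) = (\<lambda>h. h \<bullet> (cnj c * dw (c * z)))"
      by (simp add: fun_eq_iff inner_complex_def algebra_simps)
    finally show ?thesis .
  qed
  moreover have "continuous_on UNIV (\<lambda>z. cnj c * dw (c * z))"
    by (intro continuous_intros continuous_on_compose2[OF C1_with_gradientD(2)[OF assms, of UNIV]]) auto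
  ultimately show ?thesis
    by (auto simp: C1_with_gradient_def gderiv_def)
qed

text \<open>Both measures are finite and live on the compact closed disk, where \<open>f\<close> is
  bounded.\<close>

lemma continuous_L2:
  fixes f :: "complex \<Rightarrow> 'b::euclidean_space"
  assumes f: "continuous_on UNIV f"
  shows "f \<in> L2 disk_measure" "f \<in> L2 circle_measure"
proof -
  have "bounded (f ` cball 0 1)"
    using f by (intro compact_imp_bounded compact_continuous_image) (auto intro: continuous_on_subset)
  then obtain B where B: "\<And>z. z \<in> cball 0 1 \<Longrightarrow> norm (f z) \<le> B"
    unfolding bounded_iff by (metis imageI)
  note m = borel_measurable_continuous_onI[OF f]
  show "f \<in> L2 disk_measure"
    by (rule disk.L2_bounded[OF borel_measurable_disk_measure[OF m]]) (rule B, simp)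
  show "f \<in> L2 circle_measure"
    by (rule circle.L2_bounded[OF borel_measurable_circle_measure[OF m]]) (rule B, simp)
qed

lemma C1_with_gradient_L2:
  assumes "C1_with_gradient w dw"
  shows "w \<in> L2 disk_measure" "dw \<in> L2 disk_measure" "w \<in> L2 circle_measure"
  using C1_with_gradientD[OF assms] by (auto intro: continuous_L2)

text \<open>The derivative along a ray is the component of the gradient in the unit direction
  \<open>cis \<theta>\<close>; the factor \<open>1 - r\<close> is the length of the path to the
  boundary.\<close>

lemma C1_radial_bound:
  assumes w: "C1_with_gradient w dw" and r: "r \<le> 1"
  shows "ennreal ((w (cis \<theta>) - w (of_real r * cis \<theta>))\<^sup>2) \<le>
    ennreal (1 - r) * (\<integral>\<^sup>+s. ennreal ((norm (dw (of_real s * cis \<theta>)))\<^sup>2) * indicator {r..<1} s \<partial>lborel)"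
proof -
  define f' where "f' = (\<lambda>s::real. cis \<theta> \<bullet> dw (of_real s * cis \<theta>))"
  have "((\<lambda>s::real. w (of_real s * cis \<theta>)) has_real_derivative f' s) (at s)" for s
  proof -
    have "((\<lambda>s::real. w (of_real s * cis \<theta>)) has_derivative (\<lambda>h. (of_real h * cis \<theta>) \<bullet> dw (of_real s * cis \<theta>))) (at s)"
      by (rule has_derivative_compose[where f="\<lambda>s. of_real s * cis \<theta>" and g=w, OF _ C1_with_gradientD(5)[OF w]])
         (auto intro!: derivative_eq_intros)
    also have "(\<lambda>h::real. (of_real h * cis \<theta>) \<bullet> dw (of_real s * cis \<theta>)) = (*) (f' s)"
      by (simp add: f'_def fun_eq_iff flip: scaleR_conv_of_real)
    finally show ?thesis
      by (simp add: has_field_derivative_def)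
  qed
  moreover have "continuous_on UNIV f'"
    unfolding f'_def
    by (intro continuous_intros continuous_on_compose2[OF C1_with_gradientD(2)[OF w, of UNIV]]) auto
  ultimately have "ennreal ((w (of_real 1 * cis \<theta>) - w (of_real r * cis \<theta>))\<^sup>2) \<le>
      ennreal (1 - r) * (\<integral>\<^sup>+s. ennreal ((f' s)\<^sup>2) * indicator {r..<1} s \<partial>lborel)"
    by (intro FTC_square_bound[where f="\<lambda>s::real. w (of_real s * cis \<theta>)"] r)
  also have "\<dots> \<le> ennreal (1 - r) *
      (\<integral>\<^sup>+s. ennreal ((norm (dw (of_real s * cis \<theta>)))\<^sup>2) * indicator {r..<1} s \<partial>lborel)"
  proof (intro mult_left_mono nn_integral_mono mult_right_mono ennreal_leI)
    show "(f' s)\<^sup>2 \<le> (norm (dw (of_real s * cis \<theta>)))\<^sup>2" for s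
      using Cauchy_Schwarz_ineq2[of "cis \<theta>" "dw (of_real s * cis \<theta>)"]
      by (simp add: f'_def abs_le_square_iff[symmetric])
  qed auto
  finally show ?thesis by simp
qed

text \<open>Along the circle of radius \<open>r \<le> 1\<close> the tangent has length
  \<open>r\<close>, so the gradient dominates the derivative. Enlarging the arc to the full circle
  makes the bound uniform in \<open>\<theta>\<close>.\<close>

lemma C1_angular_bound:
  assumes w: "C1_with_gradient w dw" and r: "0 \<le> r" "r \<le> 1" and \<theta>: "0 \<le> \<theta>" "\<theta> \<le> 2 * pi"
  shows "ennreal ((w (of_real r * cis \<theta>) - w (of_real r))\<^sup>2) \<le>
    ennreal (2 * pi) * (\<integral>\<^sup>+t. ennreal ((norm (dw (of_real r * cis t)))\<^sup>2) * indicator {0..<2 * pi} t \<partial>lborel)"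
proof -
  define f' where "f' = (\<lambda>t::real. (of_real r * (\<i> * cis t)) \<bullet> dw (of_real r * cis t))"
  have "((\<lambda>t::real. w (of_real r * cis t)) has_real_derivative f' t) (at t)" for t
  proof -
    have "((\<lambda>t::real. w (of_real r * cis t)) has_derivative
        (\<lambda>h. (of_real r * (h *\<^sub>R (\<i> * cis t))) \<bullet> dw (of_real r * cis t))) (at t)"
      by (rule has_derivative_compose[where f="\<lambda>t. of_real r * cis t" and g=w, OF _ C1_with_gradientD(5)[OF w]])
         (auto intro!: derivative_eq_intros simp: scaleR_conv_of_real)
    also have "(\<lambda>h::real. (of_real r * (h *\<^sub>R (\<i> * cis t))) \<bullet> dw (of_real r * cis t)) = (*) (f' t)"
      by (simp add: f'_def fun_eq_iff)
    finally show ?thesis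
      by (simp add: has_field_derivative_def)
  qed
  moreover have "continuous_on UNIV f'"
    unfolding f'_def
    by (intro continuous_intros continuous_on_compose2[OF C1_with_gradientD(2)[OF w, of UNIV]]) auto
  ultimately have "ennreal ((w (of_real r * cis \<theta>) - w (of_real r * cis 0))\<^sup>2) \<le>
      ennreal (\<theta> - 0) * (\<integral>\<^sup>+t. ennreal ((f' t)\<^sup>2) * indicator {0..<\<theta>} t \<partial>lborel)"
    by (intro FTC_square_bound[where f="\<lambda>t::real. w (of_real r * cis t)"] \<theta>)
  also have "\<dots> \<le> ennreal (2 * pi) *
      (\<integral>\<^sup>+t. ennreal ((norm (dw (of_real r * cis t)))\<^sup>2) * indicator {0..<2 * pi} t \<partial>lborel)"
  proof (intro mult_mono nn_integral_mono ennreal_leI)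
    fix t
    have "\<bar>f' t\<bar> \<le> norm (of_real r * (\<i> * cis t)) * norm (dw (of_real r * cis t))"
      unfolding f'_def by (rule Cauchy_Schwarz_ineq2)
    also have "\<dots> \<le> 1 * norm (dw (of_real r * cis t))"
      using r by (intro mult_right_mono) (auto simp: norm_mult)
    finally show "(f' t)\<^sup>2 \<le> (norm (dw (of_real r * cis t)))\<^sup>2"
      by (simp add: abs_le_square_iff[symmetric])
  qed (use \<theta> in \<open>auto split: split_indicator\<close>)
  finally show ?thesis by simp
qed

section \<open>Trace and Poincare inequalities\<close>

text \<open>A boundary point is joined to the real point \<open>r\<close> by a radial segment
  followed by an arc, and the estimate is averaged over \<open>1/2 \<le> r < 1\<close>. Staying away
  from the origin keeps the polar weight bounded below, which produces the constant.\<close>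

lemma trace_Poincare:
  assumes w: "C1_with_gradient w dw" and mean: "(LINT z|circle_measure. w z) = 0"
  shows "(LINT z|circle_measure. (w z)\<^sup>2) \<le> (2 + 32 * pi\<^sup>2) * (LINT z|disk_measure. (norm (dw z))\<^sup>2)"
proof -
  note [measurable] = C1_with_gradientD(3,4)[OF w]
  define g where "g = (\<lambda>z. ennreal ((norm (dw z))\<^sup>2))"
  have g [measurable]: "g \<in> borel_measurable borel"
    unfolding g_def by measurable
  \<comment> \<open>\<open>Y r\<close> is the gradient energy in the angle on the circle of radius
    \<open>r\<close>, and \<open>X\<close> that of the annulus, both without the polar
    weight.\<close>
  define Y where "Y = (\<lambda>r::real. \<integral>\<^sup>+t. g (of_real r * cis t) * indicator {0..<2 * pi} t \<partial>lborel)"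
  define X where "X = (\<integral>\<^sup>+\<theta>. \<integral>\<^sup>+s. g (of_real s * cis \<theta>) * indicator {1/2..<1} s * indicator {0..<2 * pi} \<theta> \<partial>lborel \<partial>lborel)"
  have [measurable]: "Y \<in> borel_measurable borel"
    unfolding Y_def by measurable
  define D where "D = (LINT z|disk_measure. (norm (dw z))\<^sup>2)"
  define S where "S = (LINT z|circle_measure. (w z)\<^sup>2)"
  have D0: "0 \<le> 2 * D" and S0: "0 \<le> S"
    by (simp_all add: D_def S_def Bochner_Integration.integral_nonneg)
  have w2: "w \<in> L2 circle_measure"
    by (rule C1_with_gradient_L2[OF w])
  have gD: "(\<integral>\<^sup>+z. g z \<partial>disk_measure) = ennreal D"
    unfolding g_def D_def by (rule nn_integral_L2[OF C1_with_gradient_L2(2)[OF w]])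
  have X_swap: "X = (\<integral>\<^sup>+s. \<integral>\<^sup>+\<theta>. g (of_real s * cis \<theta>) * indicator {1/2..<1} s * indicator {0..<2 * pi} \<theta> \<partial>lborel \<partial>lborel)"
    unfolding X_def by (rule lborel_pair.Fubini') measurable
  \<comment> \<open>On the annulus the missing polar weight \<open>s\<close> is at least 1/2, hence
    the factor 2.\<close>
  have "X \<le> (\<integral>\<^sup>+s. \<integral>\<^sup>+\<theta>. 2 * (ennreal s * g (of_real s * cis \<theta>) * indicator {0..<2 * pi} \<theta> * indicator {0..<1} s) \<partial>lborel \<partial>lborel)"
    unfolding X_swap
  proof (intro nn_integral_mono)
    fix s \<theta> :: real
    show "g (of_real s * cis \<theta>) * indicator {1/2..<1} s * indicator {0..<2 * pi} \<theta>
        \<le> 2 * (ennreal s * g (of_real s * cis \<theta>) * indicator {0..<2 * pi} \<theta> * indicator {0..<1} s)"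
    proof (cases "1/2 \<le> s \<and> s < 1 \<and> 0 \<le> \<theta> \<and> \<theta> < 2 * pi")
      case True
      then have "ennreal 1 \<le> ennreal (2 * s)"
        by (intro ennreal_leI) simp
      then have "1 * g (of_real s * cis \<theta>) \<le> ennreal (2 * s) * g (of_real s * cis \<theta>)"
        by (intro mult_right_mono) simp_all
      with True show ?thesis
        by (simp add: ennreal_mult mult_ac)
    qed (auto split: split_indicator)
  qed
  also have "\<dots> = 2 * (\<integral>\<^sup>+z. g z \<partial>disk_measure)"
    unfolding nn_integral_disk_measure[OF g] nn_integral_polar[OF g]
    by (simp add: nn_integral_cmult)
  finally have X: "X \<le> ennreal (2 * D)"
    unfolding gD by (simp add: ennreal_mult')
  have YX: "(\<integral>\<^sup>+r. Y r * indicator {1/2..<1} r \<partial>lborel) = X"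
    unfolding X_swap Y_def
    by (subst nn_integral_multc[symmetric]) (simp_all add: mult_ac)
  \<comment> \<open>\<open>Y r\<close> for a single \<open>r\<close> is not controlled by the
    Dirichlet integral; only its integral over \<open>r\<close> is, so \<open>r\<close> stays free
    until the end.\<close>
  have main: "ennreal S \<le> X + ennreal (8 * pi\<^sup>2) * Y r" if r: "1/2 \<le> r" "r < 1" for r
  proof -
    define c where "c = w (of_real r)"
    have cL2: "(\<lambda>_. c) \<in> L2 circle_measure"
      by (rule circle.L2_bounded[where C="\<bar>c\<bar>"]) auto
    \<comment> \<open>Vanishing mean enters here: subtracting a constant from \<open>w\<close> can
      only increase its L2 norm on the circle.\<close>
    have "S \<le> S - 2 * (LINT z|circle_measure. w z * c) + (LINT z|circle_measure. c\<^sup>2)"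
      using mean by (simp add: Bochner_Integration.integral_nonneg)
    also have "\<dots> = (LINT z|circle_measure. (norm (w z - c))\<^sup>2)"
      unfolding S_def integral_norm_diff_L2[OF w2 cL2] by simp
    finally have "ennreal S \<le> ennreal (LINT z|circle_measure. (norm (w z - c))\<^sup>2)"
      by (rule ennreal_leI)
    also have "\<dots> = (\<integral>\<^sup>+z. ennreal ((w z - c)\<^sup>2) \<partial>circle_measure)"
      by (subst nn_integral_L2[OF L2_diff[OF w2 cL2], symmetric]) simp
    also have "\<dots> = (\<integral>\<^sup>+\<theta>. ennreal ((w (cis \<theta>) - c)\<^sup>2) * indicator {0..<2 * pi} \<theta> \<partial>lborel)"
      by (intro nn_integral_circle_measure borel_measurable_circle_measure) measurable
    also have "\<dots> \<le> (\<integral>\<^sup>+\<theta>. (\<integral>\<^sup>+s. g (of_real s * cis \<theta>) * indicator {1/2..<1} s \<partial>lborel) * indicator {0..<2 * pi} \<theta>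
        + ennreal (4 * pi) * Y r * indicator {0..<2 * pi} \<theta> \<partial>lborel)"
    proof (intro nn_integral_mono)
      fix \<theta> :: real
      show "ennreal ((w (cis \<theta>) - c)\<^sup>2) * indicator {0..<2 * pi} \<theta>
        \<le> (\<integral>\<^sup>+s. g (of_real s * cis \<theta>) * indicator {1/2..<1} s \<partial>lborel) * indicator {0..<2 * pi} \<theta>
          + ennreal (4 * pi) * Y r * indicator {0..<2 * pi} \<theta>"
      proof (cases "0 \<le> \<theta> \<and> \<theta> < 2 * pi")
        case True
        define a b where "a = w (cis \<theta>) - w (of_real r * cis \<theta>)" and "b = w (of_real r * cis \<theta>) - c"
        have "(a + b)\<^sup>2 \<le> 2 * a\<^sup>2 + 2 * b\<^sup>2"
          using sum_squares_bound[of a b] by (simp add: power2_eq_square algebra_simps)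
        then have "ennreal ((w (cis \<theta>) - c)\<^sup>2) \<le> ennreal (2 * a\<^sup>2 + 2 * b\<^sup>2)"
          by (intro ennreal_leI) (simp add: a_def b_def)
        also have "\<dots> = 2 * ennreal (a\<^sup>2) + 2 * ennreal (b\<^sup>2)"
          by (simp add: ennreal_mult)
        finally have *: "ennreal ((w (cis \<theta>) - c)\<^sup>2) \<le> 2 * ennreal (a\<^sup>2) + 2 * ennreal (b\<^sup>2)" .
        have "2 * ennreal (a\<^sup>2) \<le> 2 * (ennreal (1 - r) * (\<integral>\<^sup>+s. g (of_real s * cis \<theta>) * indicator {r..<1} s \<partial>lborel))"
          unfolding a_def g_def using r by (intro mult_left_mono C1_radial_bound[OF w]) simp_all
        also have "\<dots> = ennreal (2 * (1 - r)) * (\<integral>\<^sup>+s. g (of_real s * cis \<theta>) * indicator {r..<1} s \<partial>lborel)"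
          using r by (subst ennreal_mult) (simp_all add: mult.assoc)
        \<comment> \<open>The path length \<open>1 - r\<close> is at most 1/2, which absorbs the
          factor 2 from squaring the sum.\<close>
        also have "\<dots> \<le> 1 * (\<integral>\<^sup>+s. g (of_real s * cis \<theta>) * indicator {1/2..<1} s \<partial>lborel)"
          using r by (intro mult_mono nn_integral_mono mult_left_mono) (auto split: split_indicator)
        finally have a: "2 * ennreal (a\<^sup>2) \<le> (\<integral>\<^sup>+s. g (of_real s * cis \<theta>) * indicator {1/2..<1} s \<partial>lborel)"
          by simp
        have "2 * ennreal (b\<^sup>2) \<le> 2 * (ennreal (2 * pi) * Y r)"
          unfolding b_def c_def g_def Y_def using r True
          by (intro mult_left_mono C1_angular_bound[OF w]) simp_all
        also have "\<dots> = ennreal (4 * pi) * Y r"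
          by (simp add: ennreal_mult mult.assoc[symmetric])
        finally have b: "2 * ennreal (b\<^sup>2) \<le> ennreal (4 * pi) * Y r" .
        from order_trans[OF * add_mono[OF a b]] show ?thesis
          using True by simp
      qed simp
    qed
    also have "\<dots> = (\<integral>\<^sup>+\<theta>. (\<integral>\<^sup>+s. g (of_real s * cis \<theta>) * indicator {1/2..<1} s \<partial>lborel) * indicator {0..<2 * pi} \<theta> \<partial>lborel)
        + ennreal (4 * pi) * Y r * ennreal (2 * pi)"
      by (simp add: nn_integral_add nn_integral_cmult_indicator)
    also have "(\<integral>\<^sup>+\<theta>. (\<integral>\<^sup>+s. g (of_real s * cis \<theta>) * indicator {1/2..<1} s \<partial>lborel) * indicator {0..<2 * pi} \<theta> \<partial>lborel) = X"
      unfolding X_def by (subst nn_integral_multc[symmetric]) simp_all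
    also have "ennreal (4 * pi) * Y r * ennreal (2 * pi) = ennreal (8 * pi\<^sup>2) * Y r"
    proof -
      have "ennreal (8 * pi\<^sup>2) = ennreal (4 * pi) * ennreal (2 * pi)"
        by (subst ennreal_mult[symmetric]) (simp_all add: power2_eq_square)
      then show ?thesis by (simp add: mult_ac)
    qed
    finally show ?thesis .
  qed
  \<comment> \<open>Integration over the interval of length 1/2 turns \<open>Y\<close> into
    \<open>X\<close>. With \<open>X \<le> 2 * D\<close> this gives
    \<open>S / 2 \<le> D + 16 * pi^2 * D\<close>, the source of
    \<open>2 + 32 * pi^2\<close>.\<close>
  have "ennreal S * ennreal (1/2) = (\<integral>\<^sup>+r. ennreal S * indicator {1/2..<1::real} r \<partial>lborel)"
    by (simp add: nn_integral_cmult_indicator)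
  also have "\<dots> \<le> (\<integral>\<^sup>+r. X * indicator {1/2..<1} r + ennreal (8 * pi\<^sup>2) * (Y r * indicator {1/2..<1} r) \<partial>lborel)"
    using main by (intro nn_integral_mono) (auto split: split_indicator)
  also have "\<dots> = ennreal (1/2) * X + ennreal (8 * pi\<^sup>2) * X"
    by (simp add: nn_integral_add nn_integral_cmult nn_integral_cmult_indicator YX mult.commute)
  also have "\<dots> \<le> ennreal (1/2) * ennreal (2 * D) + ennreal (8 * pi\<^sup>2) * ennreal (2 * D)"
    by (intro add_mono mult_left_mono X) simp_all
  also have "\<dots> = ennreal (1/2 * (2 * D) + 8 * pi\<^sup>2 * (2 * D))"
    unfolding ennreal_mult''[OF D0, symmetric] using D0 by (intro ennreal_plus[symmetric]) simp_all
  finally have "S * (1/2) \<le> 1/2 * (2 * D) + 8 * pi\<^sup>2 * (2 * D)"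
    unfolding ennreal_mult'[OF S0, symmetric] using D0 by (subst (asm) ennreal_le_iff) simp_all
  then show ?thesis
    unfolding S_def[symmetric] D_def[symmetric] by (simp add: algebra_simps)
qed

text \<open>Interior values are compared with the boundary value on the same ray. Together with
  \<open>trace_Poincare\<close> this makes the functions themselves, and not only their gradients, a
  Cauchy sequence.\<close>

lemma disk_L2_le:
  assumes w: "C1_with_gradient w dw"
  shows "(LINT z|disk_measure. (w z)\<^sup>2) \<le>
    2 * (LINT z|circle_measure. (w z)\<^sup>2) + 2 * (LINT z|disk_measure. (norm (dw z))\<^sup>2)"
proof -
  note [measurable] = C1_with_gradientD(3,4)[OF w]
  define g where "g = (\<lambda>z. ennreal ((norm (dw z))\<^sup>2))"
  have g [measurable]: "g \<in> borel_measurable borel"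
    unfolding g_def by measurable
  \<comment> \<open>The gradient energy on one ray with its polar weight; integrated over the angle
    it is exactly \<open>D\<close>.\<close>
  define Z where "Z = (\<lambda>\<theta>. \<integral>\<^sup>+s. ennreal s * g (of_real s * cis \<theta>) * indicator {0..<1} s \<partial>lborel)"
  have [measurable]: "Z \<in> borel_measurable borel"
    unfolding Z_def by measurable
  define D where "D = (LINT z|disk_measure. (norm (dw z))\<^sup>2)"
  define S where "S = (LINT z|circle_measure. (w z)\<^sup>2)"
  have gD: "(\<integral>\<^sup>+z. g z \<partial>disk_measure) = ennreal D"
    unfolding g_def D_def by (rule nn_integral_L2[OF C1_with_gradient_L2(2)[OF w]])
  have S: "(\<integral>\<^sup>+\<theta>. ennreal ((w (cis \<theta>))\<^sup>2) * indicator {0..<2 * pi} \<theta> \<partial>lborel) = ennreal S"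
  proof -
    have "ennreal S = (\<integral>\<^sup>+z. ennreal ((w z)\<^sup>2) \<partial>circle_measure)"
      unfolding S_def using nn_integral_L2[OF C1_with_gradient_L2(3)[OF w]] by simp
    also have "\<dots> = (\<integral>\<^sup>+\<theta>. ennreal ((w (cis \<theta>))\<^sup>2) * indicator {0..<2 * pi} \<theta> \<partial>lborel)"
      by (intro nn_integral_circle_measure borel_measurable_circle_measure) measurable
    finally show ?thesis ..
  qed
  have Z: "(\<integral>\<^sup>+\<theta>. Z \<theta> * indicator {0..<2 * pi} \<theta> \<partial>lborel) = ennreal D"
  proof -
    have "(\<integral>\<^sup>+\<theta>. Z \<theta> * indicator {0..<2 * pi} \<theta> \<partial>lborel) =
        (\<integral>\<^sup>+\<theta>. \<integral>\<^sup>+s. ennreal s * g (of_real s * cis \<theta>) * indicator {0..<2 * pi} \<theta> * indicator {0..<1} s \<partial>lborel \<partial>lborel)"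
      unfolding Z_def by (subst nn_integral_multc[symmetric]) (simp_all add: mult_ac)
    also have "\<dots> = (\<integral>\<^sup>+s. \<integral>\<^sup>+\<theta>. ennreal s * g (of_real s * cis \<theta>) * indicator {0..<2 * pi} \<theta> * indicator {0..<1} s \<partial>lborel \<partial>lborel)"
      by (rule lborel_pair.Fubini') measurable
    also have "\<dots> = ennreal D"
      unfolding gD[symmetric] nn_integral_disk_measure[OF g] nn_integral_polar[OF g] ..
    finally show ?thesis .
  qed
  have "ennreal (LINT z|disk_measure. (w z)\<^sup>2) = (\<integral>\<^sup>+z. ennreal ((w z)\<^sup>2) \<partial>disk_measure)"
    using nn_integral_L2[OF C1_with_gradient_L2(1)[OF w]] by simp
  also have "\<dots> = (\<integral>\<^sup>+r. \<integral>\<^sup>+\<theta>. ennreal r * ennreal ((w (of_real r * cis \<theta>))\<^sup>2) * indicator {0..<2 * pi} \<theta> * indicator {0..<1} r \<partial>lborel \<partial>lborel)"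
    by (subst nn_integral_disk_measure, measurable, rule nn_integral_polar) measurable
  also have "\<dots> \<le> (\<integral>\<^sup>+r. \<integral>\<^sup>+\<theta>. (2 * (ennreal ((w (cis \<theta>))\<^sup>2) * indicator {0..<2 * pi} \<theta>) + 2 * (Z \<theta> * indicator {0..<2 * pi} \<theta>)) * indicator {0..<1::real} r \<partial>lborel \<partial>lborel)"
  proof (intro nn_integral_mono)
    fix r \<theta> :: real
    show "ennreal r * ennreal ((w (of_real r * cis \<theta>))\<^sup>2) * indicator {0..<2 * pi} \<theta> * indicator {0..<1} r \<le>
      (2 * (ennreal ((w (cis \<theta>))\<^sup>2) * indicator {0..<2 * pi} \<theta>) + 2 * (Z \<theta> * indicator {0..<2 * pi} \<theta>)) * indicator {0..<1::real} r"
    proof (cases "0 \<le> r \<and> r < 1 \<and> 0 \<le> \<theta> \<and> \<theta> < 2 * pi")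
      case True
      define a b where "a = w (cis \<theta>)" and "b = w (cis \<theta>) - w (of_real r * cis \<theta>)"
      have "(a - b)\<^sup>2 \<le> 2 * a\<^sup>2 + 2 * b\<^sup>2"
        using sum_squares_bound[of a "-b"] by (simp add: power2_eq_square algebra_simps)
      then have "r * (w (of_real r * cis \<theta>))\<^sup>2 \<le> r * (2 * a\<^sup>2 + 2 * b\<^sup>2)"
        using True by (intro mult_left_mono) (simp_all add: a_def b_def)
      also have "\<dots> \<le> 2 * a\<^sup>2 + 2 * (r * b\<^sup>2)"
        using True mult_right_mono[of r 1 "2 * a\<^sup>2"] by (simp add: algebra_simps)
      finally have "ennreal r * ennreal ((w (of_real r * cis \<theta>))\<^sup>2) \<le> ennreal (2 * a\<^sup>2 + 2 * (r * b\<^sup>2))"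
        using True by (simp add: ennreal_mult[symmetric] ennreal_leI del: ennreal_plus)
      also have "\<dots> = 2 * ennreal (a\<^sup>2) + 2 * (ennreal r * ennreal (b\<^sup>2))"
        using True by (simp add: ennreal_mult)
      finally have *: "ennreal r * ennreal ((w (of_real r * cis \<theta>))\<^sup>2) \<le> \<dots>" .
      have "ennreal r * ennreal (b\<^sup>2) \<le> ennreal r * (ennreal (1 - r) * (\<integral>\<^sup>+s. g (of_real s * cis \<theta>) * indicator {r..<1} s \<partial>lborel))"
        unfolding b_def g_def using True by (intro mult_left_mono C1_radial_bound[OF w]) simp_all
      also have "\<dots> = ennreal (1 - r) * (\<integral>\<^sup>+s. ennreal r * (g (of_real s * cis \<theta>) * indicator {r..<1} s) \<partial>lborel)"
        by (simp add: nn_integral_cmult mult_ac)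
      also have "\<dots> \<le> 1 * Z \<theta>"
        unfolding Z_def
      \<comment> \<open>The area weight \<open>r\<close> of the inner point is at most the weight
        \<open>s\<close> of any point farther out, so it can be moved under the integral.\<close>
      proof (rule mult_mono, use True in simp, rule nn_integral_mono)
        fix s :: real
        show "ennreal r * (g (of_real s * cis \<theta>) * indicator {r..<1} s) \<le> ennreal s * g (of_real s * cis \<theta>) * indicator {0..<1} s"
          using True by (auto split: split_indicator intro!: mult_right_mono ennreal_leI)
      qed (use True in auto)
      finally have "2 * (ennreal r * ennreal (b\<^sup>2)) \<le> 2 * Z \<theta>"
        by (intro mult_left_mono) simp_all
      from order_trans[OF * add_left_mono[OF this]] show ?thesis
        using True by (simp add: a_def)
    qed (auto split: split_indicator)
  qed
  also have "\<dots> = (\<integral>\<^sup>+r. (2 * ennreal S + 2 * ennreal D) * indicator {0..<1::real} r \<partial>lborel)"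
    by (simp add: nn_integral_multc nn_integral_add nn_integral_cmult S Z)
  also have "\<dots> = 2 * ennreal S + 2 * ennreal D"
    by (subst nn_integral_cmult_indicator) simp_all
  also have "\<dots> = ennreal (2 * S + 2 * D)"
    using S_def D_def by (simp add: ennreal_mult ennreal_plus Bochner_Integration.integral_nonneg)
  finally show ?thesis
    unfolding S_def[symmetric] D_def[symmetric]
    by (subst (asm) ennreal_le_iff) (simp_all add: S_def D_def Bochner_Integration.integral_nonneg)
qed

section \<open>Weak gradients and traces as limits\<close>

text \<open>By Fubini each component is integrated along lines in its own direction, where it is the
  derivative of a function vanishing at both ends.\<close>

lemma integral_gradient_compact_support:
  assumes h: "C1_with_gradient h dh" and supp: "closure {z. h z \<noteq> 0} \<subseteq> ball 0 1"
  shows "(LINT z|disk_measure. dh z) = 0"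
proof -
  have out: "h z = 0" "dh z = 0" if z: "z \<notin> ball 0 1" for z
  proof -
    have z': "z \<in> - closure {z. h z \<noteq> 0}"
      using z supp by auto
    then show "h z = 0"
      using closure_subset[of "{z. h z \<noteq> 0}"] by auto
    have "(h has_derivative (\<lambda>k. k \<bullet> dh z)) (at z)"
      by (rule C1_with_gradientD(5)[OF h])
    \<comment> \<open>Near \<open>z\<close> the function is identically zero, since the complement
      of the closed support is open; uniqueness of derivatives gives a zero gradient.\<close>
    moreover have "(h has_derivative (\<lambda>_. 0)) (at z)"
    proof (rule has_derivative_transform_within_open)
      show "((\<lambda>_. 0) has_derivative (\<lambda>_. 0)) (at z)" by simp
      show "open (- closure {z. h z \<noteq> 0})" by (rule open_Compl) (rule closed_closure)
      show "0 = h y" if "y \<in> - closure {z. h z \<noteq> 0}" for y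
        using that closure_subset[of "{z. h z \<noteq> 0}"] by auto
    qed (use z' in auto)
    ultimately have "(\<lambda>k. k \<bullet> dh z) = (\<lambda>_. 0)"
      by (rule has_derivative_unique)
    then show "dh z = 0"
      by (metis inner_eq_zero_iff)
  qed
  have ind: "indicator (ball 0 1) z *\<^sub>R dh z = dh z" "indicator (cball 0 1) z *\<^sub>R dh z = dh z" for z
    using out[of z] by (auto split: split_indicator)
  have "integrable lborel (\<lambda>z. indicator (cball 0 1) z *\<^sub>R dh z)"
    by (rule borel_integrable_compact) (use C1_with_gradientD(2)[OF h] in auto)
  then have int: "integrable lborel dh"
    by (simp only: ind)
  \<comment> \<open>One statement for horizontal and vertical lines \<open>p + t v\<close>; the
    conditions say that the disk is met only for parameters strictly between -1 and 1.\<close>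
  have slice: "(LBINT t. v \<bullet> dh (p + of_real t * v)) = 0"
    if pv: "cmod (p + v) \<ge> 1" "cmod (p - v) \<ge> 1" "\<And>t. \<bar>t\<bar> > 1 \<Longrightarrow> cmod (p + of_real t * v) \<ge> 1" for p v
  proof -
    have d: "((\<lambda>t::real. h (p + of_real t * v)) has_real_derivative v \<bullet> dh (p + of_real t * v)) (at t)" for t
    proof -
      have "((\<lambda>t::real. h (p + of_real t * v)) has_derivative (\<lambda>k. (of_real k * v) \<bullet> dh (p + of_real t * v))) (at t)"
        by (rule has_derivative_compose[where f="\<lambda>t. p + of_real t * v" and g=h, OF _ C1_with_gradientD(5)[OF h]])
           (auto intro!: derivative_eq_intros)
      also have "(\<lambda>k::real. (of_real k * v) \<bullet> dh (p + of_real t * v)) = (*) (v \<bullet> dh (p + of_real t * v))"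
        by (simp add: fun_eq_iff flip: scaleR_conv_of_real)
      finally show ?thesis
        by (simp add: has_field_derivative_def)
    qed
    have c: "continuous_on UNIV (\<lambda>t::real. v \<bullet> dh (p + of_real t * v))"
      by (intro continuous_intros continuous_on_compose2[OF C1_with_gradientD(2)[OF h, of UNIV]]) auto
    have "(LBINT t. v \<bullet> dh (p + of_real t * v)) =
        (LBINT t. indicator {-1..1} t *\<^sub>R (v \<bullet> dh (p + of_real t * v)))"
    proof (intro Bochner_Integration.integral_cong refl)
      fix t :: real
      have "dh (p + of_real t * v) = 0" if "t \<notin> {-1..1}"
        using out(2)[of "p + of_real t * v"] pv(3)[of t] that by (force simp: not_le)
      then show "v \<bullet> dh (p + of_real t * v) = indicator {-1..1} t *\<^sub>R (v \<bullet> dh (p + of_real t * v))"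
        by (cases "t \<in> {-1..1}") simp_all
    qed
    also have "\<dots> = h (p + of_real 1 * v) - h (p + of_real (-1) * v)"
      using d c by (intro integral_FTC_atLeastAtMost)
        (auto intro: continuous_on_subset has_field_derivative_at_within
          simp: has_real_derivative_iff_has_vector_derivative[symmetric])
    also have "\<dots> = 0"
      using out(1) pv(1,2) by simp
    finally show ?thesis .
  qed
  have C: "Complex x y = \<i> * of_real y + of_real x * 1" "Complex x y = of_real x + of_real y * \<i>" for x y
    by (simp_all add: complex_eq_iff)
  have re0: "(LBINT x. 1 \<bullet> dh (Complex x y)) = 0" for y
  proof -
    have "1 \<le> cmod (\<i> * of_real y + of_real t * 1)" if "\<bar>t\<bar> \<ge> 1" for t
      using abs_Re_le_cmod[of "\<i> * of_real y + of_real t * 1"] that by simp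
    from slice[OF this[of 1, simplified] this[of "-1", simplified] this] show ?thesis
      unfolding C(1) by simp
  qed
  have "Re (LBINT z. dh z) = (LBINT z. 1 \<bullet> dh z)"
    using int by (simp add: inner_complex_def)
  also have "\<dots> = (LBINT y. LBINT x. 1 \<bullet> dh (Complex x y))"
    by (rule integral_lborel_complex(2)) (use int in auto)
  also have "\<dots> = 0"
    unfolding re0 by simp
  finally have re: "Re (LBINT z. dh z) = 0" .
  have im0: "(LBINT y. \<i> \<bullet> dh (Complex x y)) = 0" for x
  proof -
    have "1 \<le> cmod (of_real x + of_real t * \<i>)" if "\<bar>t\<bar> \<ge> 1" for t
      using abs_Im_le_cmod[of "of_real x + of_real t * \<i>"] that by simp
    from slice[OF this[of 1, simplified] this[of "-1", simplified] this] show ?thesis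
      unfolding C(2) by simp
  qed
  have "Im (LBINT z. dh z) = (LBINT z. \<i> \<bullet> dh z)"
    using int by (simp add: inner_complex_def)
  also have "\<dots> = (LBINT x. LBINT y. \<i> \<bullet> dh (Complex x y))"
    by (rule integral_lborel_complex(1)) (use int in auto)
  also have "\<dots> = 0"
    unfolding im0 by simp
  finally have im: "Im (LBINT z. dh z) = 0" .
  show ?thesis
    unfolding integral_disk_measure[OF C1_with_gradientD(4)[OF h]] ind
    using re im by (simp add: complex_eq_iff)
qed

text \<open>By the product rule the sum of the two integrands is the gradient of
  \<open>\<phi> * w\<close>, which inherits its support from \<open>\<phi>\<close>.\<close>

lemma C1_weak_gradient_identity:
  assumes w: "C1_with_gradient w dw" and \<phi>: "C1_with_gradient \<phi> d\<phi>"
    and supp: "closure {z. \<phi> z \<noteq> 0} \<subseteq> ball 0 1"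
  shows "(LINT z|disk_measure. w z *\<^sub>R d\<phi> z) = - (LINT z|disk_measure. \<phi> z *\<^sub>R dw z)"
proof -
  have "closure {z. \<phi> z * w z \<noteq> 0} \<subseteq> closure {z. \<phi> z \<noteq> 0}"
    by (rule closure_mono) auto
  then have "(LINT z|disk_measure. \<phi> z *\<^sub>R dw z + w z *\<^sub>R d\<phi> z) = 0"
    using supp by (intro integral_gradient_compact_support[OF C1_with_gradient_mult[OF \<phi> w]]) auto
  moreover have "integrable disk_measure (\<lambda>z. \<phi> z *\<^sub>R dw z)" "integrable disk_measure (\<lambda>z. w z *\<^sub>R d\<phi> z)"
    using C1_with_gradientD[OF w] C1_with_gradientD[OF \<phi>]
    by (auto intro!: disk.integrable_L2 continuous_L2 continuous_intros)
  ultimately show ?thesis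
    by (simp add: eq_neg_iff_add_eq_0 add.commute)
qed

text \<open>For a fixed test function both sides of the defining identity are continuous under L2
  convergence.\<close>

lemma weak_gradient_limit:
  assumes w: "\<And>k::nat. C1_with_gradient (w k) (dw k)"
    and u: "u \<in> L2 disk_measure" and G: "G \<in> L2 disk_measure"
    and lu: "(\<lambda>k. LINT z|disk_measure. (w k z - u z)\<^sup>2) \<longlonglongrightarrow> 0"
    and lG: "(\<lambda>k. LINT z|disk_measure. (norm (dw k z - G z))\<^sup>2) \<longlonglongrightarrow> 0"
  shows "weak_gradient u G"
  unfolding weak_gradient_def
proof (intro conjI allI impI)
  fix \<phi> d\<phi>
  assume \<phi>: "C1_with_gradient \<phi> d\<phi>" and supp: "closure {z. \<phi> z \<noteq> 0} \<subseteq> ball 0 1"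
  note c\<phi> = C1_with_gradientD[OF \<phi>]
  show "(LINT z|disk_measure. u z *\<^sub>R d\<phi> z) = - (LINT z|disk_measure. \<phi> z *\<^sub>R G z)"
  \<comment> \<open>The vector identity is tested on one direction \<open>b\<close> at a time, which
    turns both sides into scalar L2 pairings.\<close>
  proof (rule euclidean_eqI)
    fix b :: complex
    have L2: "(\<lambda>z. d\<phi> z \<bullet> b) \<in> L2 disk_measure" "(\<lambda>z. \<phi> z *\<^sub>R b) \<in> L2 disk_measure"
      by (intro continuous_L2 continuous_intros c\<phi>)+
    have i: "(LINT z|disk_measure. f z *\<^sub>R d\<phi> z) \<bullet> b = (LINT z|disk_measure. f z \<bullet> (d\<phi> z \<bullet> b))"
      "(LINT z|disk_measure. \<phi> z *\<^sub>R H z) \<bullet> b = (LINT z|disk_measure. H z \<bullet> (\<phi> z *\<^sub>R b))"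
      if f: "f \<in> L2 disk_measure" and H: "H \<in> L2 disk_measure" for f H
    proof -
      have "integrable disk_measure (\<lambda>z. f z *\<^sub>R d\<phi> z)" "integrable disk_measure (\<lambda>z. \<phi> z *\<^sub>R H z)"
        using C1_with_gradient_L2[OF \<phi>] f H by (auto intro: integrable_scaleR_L2)
      then show "(LINT z|disk_measure. f z *\<^sub>R d\<phi> z) \<bullet> b = (LINT z|disk_measure. f z \<bullet> (d\<phi> z \<bullet> b))"
        "(LINT z|disk_measure. \<phi> z *\<^sub>R H z) \<bullet> b = (LINT z|disk_measure. H z \<bullet> (\<phi> z *\<^sub>R b))"
        by (simp_all flip: integral_inner_left)
    qed
    have eq: "(LINT z|disk_measure. w k z \<bullet> (d\<phi> z \<bullet> b)) = - (LINT z|disk_measure. dw k z \<bullet> (\<phi> z *\<^sub>R b))" for k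
      using C1_weak_gradient_identity[OF w[of k] \<phi> supp] i[OF C1_with_gradient_L2(1,2)[OF w[of k]]]
      by (metis inner_minus_left)
    have "(\<lambda>k. LINT z|disk_measure. w k z \<bullet> (d\<phi> z \<bullet> b)) \<longlonglongrightarrow> (LINT z|disk_measure. u z \<bullet> (d\<phi> z \<bullet> b))"
      using lu by (intro tendsto_inner_left_L2[OF u L2(1) C1_with_gradient_L2(1)[OF w]]) simp
    then have 1: "(\<lambda>k. - (LINT z|disk_measure. dw k z \<bullet> (\<phi> z *\<^sub>R b))) \<longlonglongrightarrow> (LINT z|disk_measure. u z \<bullet> (d\<phi> z \<bullet> b))"
      by (simp only: eq)
    have 2: "(\<lambda>k. - (LINT z|disk_measure. dw k z \<bullet> (\<phi> z *\<^sub>R b))) \<longlonglongrightarrow> - (LINT z|disk_measure. G z \<bullet> (\<phi> z *\<^sub>R b))"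
      by (intro tendsto_minus tendsto_inner_left_L2[OF G L2(2) C1_with_gradient_L2(2)[OF w]] lG)
    from LIMSEQ_unique[OF 1 2]
    show "(LINT z|disk_measure. u z *\<^sub>R d\<phi> z) \<bullet> b = - (LINT z|disk_measure. \<phi> z *\<^sub>R G z) \<bullet> b"
      using i[OF u G] by simp
  qed
qed (use u G in auto)

text \<open>The weak gradient comes for free from the approximation. Existence of solutions and
  their rotation both obtain membership in \<open>H1_trace\<close> this way.\<close>

lemma H1_trace_limit:
  assumes w: "\<And>k::nat. C1_with_gradient (w k) (dw k)"
    and "u \<in> L2 disk_measure" "G \<in> L2 disk_measure" "f \<in> L2 circle_measure"
    and "(\<lambda>k. LINT z|disk_measure. (w k z - u z)\<^sup>2) \<longlonglongrightarrow> 0"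
    and "(\<lambda>k. LINT z|disk_measure. (norm (dw k z - G z))\<^sup>2) \<longlonglongrightarrow> 0"
    and "(\<lambda>k. LINT z|circle_measure. (w k z - f z)\<^sup>2) \<longlonglongrightarrow> 0"
  shows "H1_trace u G f"
  unfolding H1_trace_def using assms weak_gradient_limit[OF assms(1-3,5,6)] by blast

section \<open>The Neumann problem\<close>

lemma admissible_energy:
  assumes "admissible_conductivity \<sigma>"
  shows admissible_L2: "G \<in> L2 disk_measure \<Longrightarrow> (\<lambda>z. \<sigma> z *\<^sub>R (G z :: complex)) \<in> L2 disk_measure"
    and admissible_integrable: "G \<in> L2 disk_measure \<Longrightarrow> H \<in> L2 disk_measure \<Longrightarrow>
      integrable disk_measure (\<lambda>z. \<sigma> z * (G z \<bullet> (H z :: complex)))"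
proof -
  obtain C where \<sigma>: "\<sigma> \<in> borel_measurable disk_measure" "AE z in disk_measure. \<bar>\<sigma> z\<bar> \<le> C"
    using assms by (auto simp: admissible_conductivity_def)
  show *: "(\<lambda>z. \<sigma> z *\<^sub>R G z) \<in> L2 disk_measure" if "G \<in> L2 disk_measure" for G :: "complex \<Rightarrow> complex"
    by (rule L2_bounded_mult[OF that \<sigma>])
  show "integrable disk_measure (\<lambda>z. \<sigma> z * (G z \<bullet> H z))"
    if "G \<in> L2 disk_measure" "H \<in> L2 disk_measure"
    using integrable_inner_L2[OF *[OF that(1)] that(2)] by simp
qed

text \<open>The bounded weight \<open>\<sigma>\<close> is absorbed into the fixed factor
  \<open>G\<close>, which leaves an ordinary L2 pairing.\<close>

lemma tendsto_energy:
  fixes G H :: "complex \<Rightarrow> complex"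
  assumes \<sigma>: "admissible_conductivity \<sigma>" and G: "G \<in> L2 disk_measure" and H: "H \<in> L2 disk_measure"
    and Hk: "\<And>k. Hk k \<in> L2 disk_measure"
    and lim: "(\<lambda>k. LINT z|disk_measure. (norm (Hk k z - H z))\<^sup>2) \<longlonglongrightarrow> 0"
  shows "(\<lambda>k. LINT z|disk_measure. \<sigma> z * (G z \<bullet> Hk k z)) \<longlonglongrightarrow> (LINT z|disk_measure. \<sigma> z * (G z \<bullet> H z))"
    and "(\<lambda>k. LINT z|disk_measure. \<sigma> z * (Hk k z \<bullet> G z)) \<longlonglongrightarrow> (LINT z|disk_measure. \<sigma> z * (H z \<bullet> G z))"
  using tendsto_inner_left_L2[OF H admissible_L2[OF \<sigma> G] Hk lim]
  by (simp_all add: inner_commute)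

text \<open>The approximants carried by \<open>H1_trace\<close> converge both in the gradient and on
  the boundary, so the equation passes from C1 test functions to all of
  \<open>H1_trace\<close>.\<close>

lemma Neumann_test_H1:
  assumes \<sigma>: "admissible_conductivity \<sigma>" and G: "G \<in> L2 disk_measure" and \<psi>: "\<psi> \<in> L2 circle_measure"
    and C1: "\<And>v dv. C1_with_gradient v dv \<Longrightarrow>
      (LINT z|disk_measure. \<sigma> z * (G z \<bullet> dv z)) = (LINT z|circle_measure. \<psi> z * v z)"
    and H1: "H1_trace v H h"
  shows "(LINT z|disk_measure. \<sigma> z * (G z \<bullet> H z)) = (LINT z|circle_measure. \<psi> z * h z)"
proof -
  have H: "H \<in> L2 disk_measure" and h: "h \<in> L2 circle_measure"
    using H1 by (auto simp: H1_trace_def weak_gradient_def)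
  obtain w dw where w: "\<And>k::nat. C1_with_gradient (w k) (dw k)"
    and l1: "(\<lambda>k. LINT z|disk_measure. (norm (dw k z - H z))\<^sup>2) \<longlonglongrightarrow> 0"
    and l2: "(\<lambda>k. LINT z|circle_measure. (w k z - h z)\<^sup>2) \<longlonglongrightarrow> 0"
    using H1 unfolding H1_trace_def by blast
  note L2w = C1_with_gradient_L2[OF w]
  have 1: "(\<lambda>k. LINT z|circle_measure. \<psi> z * w k z) \<longlonglongrightarrow> (LINT z|disk_measure. \<sigma> z * (G z \<bullet> H z))"
    using tendsto_energy(1)[OF \<sigma> G H L2w(2) l1] by (simp only: C1[OF w])
  have 2: "(\<lambda>k. LINT z|circle_measure. \<psi> z * w k z) \<longlonglongrightarrow> (LINT z|circle_measure. \<psi> z * h z)"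
    using tendsto_inner_left_L2[OF h \<psi> L2w(3)] l2 by (simp add: mult.commute)
  show ?thesis
    by (rule LIMSEQ_unique[OF 1 2])
qed

text \<open>The first-order condition at a minimum, used to derive the weak equation from
  minimality.\<close>

lemma quadratic_nonneg_imp_linear_zero:
  fixes L Q :: real
  assumes "\<And>t. 0 \<le> 2 * t * L + t\<^sup>2 * Q" "0 \<le> Q"
  shows "L = 0"
proof (rule ccontr)
  assume "L \<noteq> 0"
  \<comment> \<open>At \<open>t = - s\<close> the expression equals
    \<open>- (s^2 * (Q + 2))\<close>. Adding 1 in the denominator covers the case
    \<open>Q = 0\<close>.\<close>
  define s where "s = L / (Q + 1)"
  have L: "L = s * (Q + 1)" and "s \<noteq> 0"
    using \<open>L \<noteq> 0\<close> assms(2) by (simp_all add: s_def)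
  have "0 \<le> 2 * (- s) * L + (- s)\<^sup>2 * Q"
    by (rule assms(1))
  also have "\<dots> = - (s\<^sup>2 * (Q + 2))"
    unfolding L by (simp add: power2_eq_square algebra_simps)
  finally have "s\<^sup>2 * (Q + 2) \<le> 0" by simp
  moreover have "0 < s\<^sup>2 * (Q + 2)"
    using \<open>s \<noteq> 0\<close> assms(2) by (intro mult_pos_pos) auto
  ultimately show False by simp
qed

text \<open>\<open>x\<close> and \<open>y\<close> are the energies at the ends of a segment, and the
  first hypothesis compares the infimum \<open>m\<close> with the midpoint. Eliminating
  \<open>L\<close> gives \<open>Q / 4 \<le> (x + y) / 2 - m\<close>.\<close>

lemma parallelogram_bound:
  fixes m x y L Q d e :: real
  assumes "m \<le> x + L + Q / 4" "y = x + 2 * L + Q" "y < m + d" "x < m + e"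
  shows "Q \<le> 2 * (d + e)"
  using assms by (simp add: algebra_simps)

text \<open>The solution is the limit of a minimising sequence of \<open>C\<^sup>1\<close> functions for the energy functional
  \<open>\<integral> \<sigma> |\<nabla>w|\<^sup>2 - 2 \<integral> \<psi> w\<close>; the parallelogram identity makes the gradients a Cauchy sequence.\<close>

theorem weak_neumann_solution_exists:
  assumes \<sigma>: "admissible_conductivity \<sigma>" and \<psi>: "\<psi> \<in> L2 circle_measure"
    and mean: "(LINT z|circle_measure. \<psi> z) = 0"
  shows "\<exists>u G f. weak_neumann_solution \<sigma> \<psi> u G f"
proof -
  obtain c where c: "0 < c" "AE z in disk_measure. c \<le> \<sigma> z"
    using \<sigma> by (auto simp: admissible_conductivity_def)
  define A where "A = (\<lambda>G H :: complex \<Rightarrow> complex. LINT z|disk_measure. \<sigma> z * (G z \<bullet> H z))"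
  define b where "b = (\<lambda>w. LINT z|circle_measure. \<psi> z * w z)"
  define J where "J = (\<lambda>w dw. A dw dw - 2 * b w)"
  \<comment> \<open>The gradient does not see constants; fixing the boundary mean lets the trace
    inequality bound \<open>J\<close> from below.\<close>
  define adm where "adm = (\<lambda>w dw. C1_with_gradient w dw \<and> (LINT z|circle_measure. w z) = 0)"
  define K where "K = 2 + 32 * pi\<^sup>2"
  have K: "0 < K" by (simp add: K_def add_pos_nonneg)
  have coercive: "c * (LINT z|disk_measure. (norm (G z))\<^sup>2) \<le> A G G" if G: "G \<in> L2 disk_measure" for G
  proof -
    have "(LINT z|disk_measure. c * (norm (G z))\<^sup>2) \<le> (LINT z|disk_measure. \<sigma> z * (G z \<bullet> G z))"
    proof (rule integral_mono_AE)
      show "AE z in disk_measure. c * (norm (G z))\<^sup>2 \<le> \<sigma> z * (G z \<bullet> G z)"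
        using c(2) by eventually_elim (auto simp: power2_norm_eq_inner intro!: mult_right_mono)
    qed (use L2D[OF G] admissible_integrable[OF \<sigma> G G] in auto)
    then show ?thesis by (simp add: A_def)
  qed
  have trace: "(LINT z|circle_measure. (w z)\<^sup>2) \<le> K * (LINT z|disk_measure. (norm (dw z))\<^sup>2)"
    if "adm w dw" for w dw
    using that unfolding adm_def K_def by (intro trace_Poincare) auto
  \<comment> \<open>Along a line the energy is a quadratic polynomial in \<open>t\<close>. It is
    used at \<open>t = 1/2\<close> and \<open>t = 1\<close> for the Cauchy property and with
    arbitrary \<open>t\<close> for the weak equation.\<close>
  have expand: "J (\<lambda>z. w z + t * v z) (\<lambda>z. dw z + t *\<^sub>R dv z) =
      J w dw + 2 * t * (A dw dv - b v) + t\<^sup>2 * A dv dv"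
    if w: "C1_with_gradient w dw" and v: "C1_with_gradient v dv" for w dw v dv t
  proof -
    note Lw = C1_with_gradient_L2[OF w] and Lv = C1_with_gradient_L2[OF v]
    note int = admissible_integrable[OF \<sigma> Lw(2) Lw(2)] admissible_integrable[OF \<sigma> Lw(2) Lv(2)]
      admissible_integrable[OF \<sigma> Lv(2) Lv(2)] integrable_mult_L2[OF \<psi> Lw(3)] integrable_mult_L2[OF \<psi> Lv(3)]
    have "A (\<lambda>z. dw z + t *\<^sub>R dv z) (\<lambda>z. dw z + t *\<^sub>R dv z) =
        (LINT z|disk_measure. \<sigma> z * (dw z \<bullet> dw z) + 2 * t * (\<sigma> z * (dw z \<bullet> dv z)) + t\<^sup>2 * (\<sigma> z * (dv z \<bullet> dv z)))"
      unfolding A_def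
      by (intro Bochner_Integration.integral_cong refl)
         (simp add: inner_add_left inner_add_right inner_commute power2_eq_square algebra_simps)
    also have "\<dots> = A dw dw + 2 * t * A dw dv + t\<^sup>2 * A dv dv"
      using int by (simp add: A_def)
    finally have 1: "A (\<lambda>z. dw z + t *\<^sub>R dv z) (\<lambda>z. dw z + t *\<^sub>R dv z) = \<dots>" .
    have "b (\<lambda>z. w z + t * v z) = (LINT z|circle_measure. \<psi> z * w z + t * (\<psi> z * v z))"
      unfolding b_def by (simp add: algebra_simps)
    also have "\<dots> = b w + t * b v"
      using int by (simp add: b_def)
    finally have 2: "b (\<lambda>z. w z + t * v z) = \<dots>" .
    show ?thesis
      unfolding J_def 1 2 by (simp add: algebra_simps)
  qed
  have adm_comb: "adm (\<lambda>z. w z + t * v z) (\<lambda>z. dw z + t *\<^sub>R dv z)" if "adm w dw" "adm v dv" for w dw v dv t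
  proof -
    have C1: "C1_with_gradient w dw" "C1_with_gradient v dv"
      using that by (auto simp: adm_def)
    have "integrable circle_measure w" "integrable circle_measure v"
      using C1_with_gradient_L2[OF C1(1)] C1_with_gradient_L2[OF C1(2)] by (auto intro: circle.integrable_L2)
    then show ?thesis
      using that by (auto simp: adm_def intro: C1_with_gradient_add C1_with_gradient_scale)
  qed
  define P where "P = (LINT z|circle_measure. (norm (\<psi> z))\<^sup>2)"
  \<comment> \<open>Completing the square with \<open>(K / c) \<psi> - w\<close> on the circle; the
    boundary norm of \<open>w\<close> is absorbed by the energy through trace inequality and
    coercivity.\<close>
  have bounded: "- (K / c * P) \<le> J w dw" if "adm w dw" for w dw
  proof -
    have C1: "C1_with_gradient w dw" using that by (simp add: adm_def)
    note Lw = C1_with_gradient_L2[OF C1]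
    have "0 \<le> (LINT z|circle_measure. (norm ((K / c) *\<^sub>R \<psi> z - w z))\<^sup>2)"
      by (rule Bochner_Integration.integral_nonneg) simp
    also have "\<dots> = (K / c)\<^sup>2 * P - 2 * (K / c) * b w + (LINT z|circle_measure. (w z)\<^sup>2)"
      using integral_norm_diff_L2[OF L2_scaleR[OF \<psi>, of "K / c"] Lw(3)]
      by (simp add: P_def b_def power_mult_distrib mult.assoc abs_mult power_divide)
    also have "(LINT z|circle_measure. (w z)\<^sup>2) \<le> K * (LINT z|disk_measure. (norm (dw z))\<^sup>2)"
      by (rule trace[OF that])
    also have "\<dots> \<le> (K / c) * A dw dw"
      using mult_left_mono[OF coercive[OF Lw(2)], of "K / c"] K c by (simp add: field_simps)
    finally have "0 \<le> (K / c)\<^sup>2 * P - 2 * (K / c) * b w + (K / c) * A dw dw" by simp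
    also have "\<dots> = (K / c) * (K / c * P + J w dw)"
      by (simp add: J_def power2_eq_square algebra_simps)
    finally have "0 \<le> K / c * P + J w dw"
      using divide_pos_pos[OF K c(1)] by (metis mult_le_cancel_left_pos mult_zero_right)
    then show ?thesis by simp
  qed
  define m where "m = Inf {J w dw |w dw. adm w dw}"
  have ne: "{J w dw |w dw. adm w dw} \<noteq> {}"
  proof -
    have "adm (\<lambda>_. 0) (\<lambda>_. 0)"
      by (simp add: adm_def C1_with_gradient_const)
    then show ?thesis by blast
  qed
  have bdd: "bdd_below {J w dw |w dw. adm w dw}"
    using bounded by (intro bdd_belowI[of _ "- (K / c * P)"]) auto
  have m_le: "m \<le> J w dw" if "adm w dw" for w dw
    unfolding m_def by (rule cInf_lower[OF _ bdd]) (use that in auto)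
  define \<delta> where "\<delta> = (\<lambda>k. 1 / real (Suc k))"
  have "\<exists>w dw. adm w dw \<and> J w dw < m + \<delta> k" for k
  proof -
    have "Inf {J w dw |w dw. adm w dw} < m + \<delta> k"
      by (simp add: m_def \<delta>_def)
    from cInf_lessD[OF ne this] show ?thesis by auto
  qed
  then obtain w dw where adm: "\<And>k. adm (w k) (dw k)" and Jk: "\<And>k. J (w k) (dw k) < m + \<delta> k"
    by metis
  have C1: "C1_with_gradient (w k) (dw k)" for k
    using adm by (simp add: adm_def)
  note Lw = C1_with_gradient_L2[OF C1]
  \<comment> \<open>\<open>parallelogram_bound\<close> gives the energy bound
    \<open>2 * (\<delta> k + \<delta> l)\<close> for the difference, and coercivity divides it by
    \<open>c\<close>.\<close>
  define \<epsilon> where "\<epsilon> = (\<lambda>k l. (2 / c) * (\<delta> k + \<delta> l))"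
  have grad_Cauchy: "(LINT z|disk_measure. (norm (dw k z - dw l z))\<^sup>2) \<le> \<epsilon> k l" for k l
  proof -
    define v dv where "v = (\<lambda>z. w k z - w l z)" and "dv = (\<lambda>z. dw k z - dw l z)"
    have "adm (\<lambda>z. w k z + (-1) * w l z) (\<lambda>z. dw k z + (-1) *\<^sub>R dw l z)"
      by (intro adm_comb adm)
    then have v: "adm v dv" by (simp add: v_def dv_def)
    then have vC: "C1_with_gradient v dv" by (simp add: adm_def)
    have "m \<le> J (\<lambda>z. w l z + (1/2) * v z) (\<lambda>z. dw l z + (1/2) *\<^sub>R dv z)"
      by (intro m_le adm_comb adm v)
    also have "\<dots> = J (w l) (dw l) + (A (dw l) dv - b v) + A dv dv / 4"
      unfolding expand[OF C1 vC] by (simp add: power2_eq_square)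
    finally have 1: "m \<le> J (w l) (dw l) + (A (dw l) dv - b v) + A dv dv / 4" .
    have "J (w k) (dw k) = J (\<lambda>z. w l z + 1 * v z) (\<lambda>z. dw l z + 1 *\<^sub>R dv z)"
      by (simp add: v_def dv_def)
    also have "\<dots> = J (w l) (dw l) + 2 * (A (dw l) dv - b v) + A dv dv"
      unfolding expand[OF C1 vC] by simp
    finally have 2: "J (w k) (dw k) = \<dots>" .
    have "A dv dv \<le> 2 * (\<delta> k + \<delta> l)"
      using parallelogram_bound[OF 1 2 Jk Jk] .
    moreover have "c * (LINT z|disk_measure. (norm (dv z))\<^sup>2) \<le> A dv dv"
      by (rule coercive[OF C1_with_gradient_L2(2)[OF vC]])
    ultimately show ?thesis
      using c by (simp add: dv_def \<epsilon>_def field_simps)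
  qed
  have diff_adm: "adm (\<lambda>z. w k z - w l z) (\<lambda>z. dw k z - dw l z)" for k l
    using adm_comb[OF adm[of k] adm[of l], of "-1"] by simp
  have circ_Cauchy: "(LINT z|circle_measure. (norm (w k z - w l z))\<^sup>2) \<le> K * \<epsilon> k l" for k l
    using order_trans[OF trace[OF diff_adm] mult_left_mono[OF grad_Cauchy less_imp_le[OF K]]]
    by simp
  \<comment> \<open>The constant combines twice the circle bound \<open>K * \<epsilon> k l\<close>
    with twice the gradient bound.\<close>
  have disk_Cauchy: "(LINT z|disk_measure. (norm (w k z - w l z))\<^sup>2) \<le> (2 * K + 2) * \<epsilon> k l" for k l
    using disk_L2_le[of "\<lambda>z. w k z - w l z" "\<lambda>z. dw k z - dw l z"] diff_adm[of k l]
      circ_Cauchy[of k l] grad_Cauchy[of k l]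
    by (simp add: adm_def algebra_simps)
  have \<delta>_lim: "\<delta> \<longlonglongrightarrow> 0"
    using LIMSEQ_inverse_real_of_nat by (simp add: \<delta>_def inverse_eq_divide)
  have \<epsilon>: "\<exists>N. \<forall>k\<ge>N. \<forall>l\<ge>N. B * \<epsilon> k l < e" if "0 < e" "0 < B" for e B
  proof -
    have "0 < e * c / (4 * B)"
      using that c by simp
    from LIMSEQ_D[OF \<delta>_lim this] obtain N where "\<And>k. N \<le> k \<Longrightarrow> norm (\<delta> k) < e * c / (4 * B)"
      by auto
    then have N: "\<delta> k < e * c / (4 * B)" if "N \<le> k" for k
      using that by force
    have "B * \<epsilon> k l < e" if "N \<le> k" "N \<le> l" for k l
    proof -
      have "\<delta> k + \<delta> l < e * c / (4 * B) + e * c / (4 * B)"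
        using N that by (intro add_strict_mono)
      also have "\<dots> = e * c / (2 * B)" by simp
      finally have "(B * (2 / c)) * (\<delta> k + \<delta> l) < (B * (2 / c)) * (e * c / (2 * B))"
        using c \<open>0 < B\<close> by (intro mult_strict_left_mono) auto
      then show ?thesis
        using c \<open>0 < B\<close> by (simp add: \<epsilon>_def mult.assoc)
    qed
    then show ?thesis by blast
  qed
  have "\<exists>G\<in>L2 disk_measure. (\<lambda>k. LINT z|disk_measure. (norm (dw k z - G z))\<^sup>2) \<longlonglongrightarrow> 0"
  proof (rule L2_complete[OF disk.finite_measure_axioms Lw(2)])
    fix e :: real assume "0 < e"
    from \<epsilon>[OF this, of 1] obtain N where N: "\<And>k l. N \<le> k \<Longrightarrow> N \<le> l \<Longrightarrow> \<epsilon> k l < e"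
      by auto
    then show "\<exists>N. \<forall>k\<ge>N. \<forall>l\<ge>N. (LINT z|disk_measure. (norm (dw k z - dw l z))\<^sup>2) < e"
      using le_less_trans[OF grad_Cauchy N] by blast
  qed
  then obtain G where G: "G \<in> L2 disk_measure"
    and lG: "(\<lambda>k. LINT z|disk_measure. (norm (dw k z - G z))\<^sup>2) \<longlonglongrightarrow> 0" by blast
  have "\<exists>u\<in>L2 disk_measure. (\<lambda>k. LINT z|disk_measure. (norm (w k z - u z))\<^sup>2) \<longlonglongrightarrow> 0"
  proof (rule L2_complete[OF disk.finite_measure_axioms Lw(1)])
    fix e :: real assume "0 < e"
    have "0 < 2 * K + 2" using K by simp
    from \<epsilon>[OF \<open>0 < e\<close> this] obtain N where N: "\<And>k l. N \<le> k \<Longrightarrow> N \<le> l \<Longrightarrow> (2 * K + 2) * \<epsilon> k l < e"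
      by blast
    then show "\<exists>N. \<forall>k\<ge>N. \<forall>l\<ge>N. (LINT z|disk_measure. (norm (w k z - w l z))\<^sup>2) < e"
      using le_less_trans[OF disk_Cauchy N] by blast
  qed
  then obtain u where u: "u \<in> L2 disk_measure"
    and lu: "(\<lambda>k. LINT z|disk_measure. (norm (w k z - u z))\<^sup>2) \<longlonglongrightarrow> 0" by blast
  have "\<exists>f\<in>L2 circle_measure. (\<lambda>k. LINT z|circle_measure. (norm (w k z - f z))\<^sup>2) \<longlonglongrightarrow> 0"
  proof (rule L2_complete[OF circle.finite_measure_axioms Lw(3)])
    fix e :: real assume "0 < e"
    from \<epsilon>[OF this K] obtain N where N: "\<And>k l. N \<le> k \<Longrightarrow> N \<le> l \<Longrightarrow> K * \<epsilon> k l < e"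
      by blast
    then show "\<exists>N. \<forall>k\<ge>N. \<forall>l\<ge>N. (LINT z|circle_measure. (norm (w k z - w l z))\<^sup>2) < e"
      using le_less_trans[OF circ_Cauchy N] by blast
  qed
  then obtain f where f: "f \<in> L2 circle_measure"
    and lf: "(\<lambda>k. LINT z|circle_measure. (norm (w k z - f z))\<^sup>2) \<longlonglongrightarrow> 0" by blast
  have H1: "H1_trace u G f"
    by (rule H1_trace_limit[OF C1 u G f]) (use lu lG lf in simp_all)
  \<comment> \<open>The variation is taken at the approximants: \<open>m \<le> J (w k + t v)\<close>
    and \<open>J (w k) < m + \<delta> k\<close> leave an inequality that is affine in the gradient
    \<open>dw k\<close>, so it survives the limit.\<close>
  have EL0: "A G dv = b v" if v: "adm v dv" for v dv
  proof -
    have vC: "C1_with_gradient v dv" using v by (simp add: adm_def)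
    note Lv = C1_with_gradient_L2[OF vC]
    have "0 \<le> 2 * t * (A G dv - b v) + t\<^sup>2 * A dv dv" for t
    proof (rule LIMSEQ_le_const)
      have "(\<lambda>k. A (dw k) dv) \<longlonglongrightarrow> A G dv"
        unfolding A_def by (rule tendsto_energy(2)[OF \<sigma> Lv(2) G Lw(2) lG])
      with \<delta>_lim have "(\<lambda>k. \<delta> k + 2 * t * (A (dw k) dv - b v) + t\<^sup>2 * A dv dv) \<longlonglongrightarrow>
          0 + 2 * t * (A G dv - b v) + t\<^sup>2 * A dv dv"
        by (intro tendsto_add tendsto_mult tendsto_diff tendsto_const)
      then show "(\<lambda>k. \<delta> k + 2 * t * (A (dw k) dv - b v) + t\<^sup>2 * A dv dv) \<longlonglongrightarrow>
          2 * t * (A G dv - b v) + t\<^sup>2 * A dv dv" by simp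
      have "0 \<le> \<delta> k + 2 * t * (A (dw k) dv - b v) + t\<^sup>2 * A dv dv" for k
        using m_le[OF adm_comb[OF adm[of k] v, of t]] Jk[of k] unfolding expand[OF C1 vC] by linarith
      then show "\<exists>N. \<forall>k\<ge>N. 0 \<le> \<delta> k + 2 * t * (A (dw k) dv - b v) + t\<^sup>2 * A dv dv" by blast
    qed
    moreover have "0 \<le> c * (LINT z|disk_measure. (norm (dv z))\<^sup>2)"
      using c by (simp add: Bochner_Integration.integral_nonneg)
    then have "0 \<le> A dv dv"
      using coercive[OF Lv(2)] by linarith
    ultimately have "A G dv - b v = 0"
      by (rule quadratic_nonneg_imp_linear_zero)
    then show ?thesis by simp
  qed
  have EL: "(LINT z|disk_measure. \<sigma> z * (G z \<bullet> dv z)) = (LINT z|circle_measure. \<psi> z * v z)"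
    if v: "C1_with_gradient v dv" for v dv
  proof -
    \<comment> \<open>Subtracting its boundary mean makes \<open>v\<close> admissible without
      changing its gradient; the right-hand side is unchanged because \<open>\<psi>\<close> has mean
      zero.\<close>
    define \<mu> where "\<mu> = (LINT z|circle_measure. v z) / (2 * pi)"
    note Lv = C1_with_gradient_L2[OF v]
    have v': "C1_with_gradient (\<lambda>z. v z + (- \<mu>)) dv"
      using C1_with_gradient_add[OF v C1_with_gradient_const[of "- \<mu>"]] by simp
    have "measure circle_measure (sphere 0 1) = 2 * pi"
      by (simp add: measure_def emeasure_circle_measure_space)
    then have "(LINT z|circle_measure. v z + (- \<mu>)) = 0"
      using circle.integrable_L2[OF Lv(3)] by (simp add: \<mu>_def)
    with v' have "A G dv = b (\<lambda>z. v z + (- \<mu>))"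
      by (intro EL0) (simp add: adm_def)
    also have "\<dots> = (LINT z|circle_measure. \<psi> z * v z - \<mu> * \<psi> z)"
      unfolding b_def by (simp add: algebra_simps)
    also have "\<dots> = b v"
      using integrable_mult_L2[OF \<psi> Lv(3)] circle.integrable_L2[OF \<psi>] mean by (simp add: b_def)
    finally show ?thesis by (simp add: A_def b_def)
  qed
  have "(LINT z|circle_measure. f z) = 0"
  proof -
    have one: "(\<lambda>_. 1 :: real) \<in> L2 circle_measure"
      by (rule circle.L2_bounded[where C=1]) auto
    \<comment> \<open>The boundary mean is the pairing with 1, hence continuous in L2.\<close>
    have "(\<lambda>k. LINT z|circle_measure. w k z \<bullet> 1) \<longlonglongrightarrow> (LINT z|circle_measure. f z \<bullet> 1)"
      by (rule tendsto_inner_left_L2[OF f one Lw(3) lf])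
    moreover have "(LINT z|circle_measure. w k z \<bullet> 1) = 0" for k
      using adm[of k] by (simp add: adm_def)
    ultimately show ?thesis
      by (simp add: LIMSEQ_const_iff)
  qed
  with H1 show ?thesis
    unfolding weak_neumann_solution_def
    using Neumann_test_H1[OF \<sigma> G \<psi> EL] by blast
qed

section \<open>Rotations\<close>

text \<open>The disk carries the completed measure, so invariance on Borel sets has to be lifted to
  the completion, where preimages of null sets must again be null.\<close>

lemma lebesgue_rotation:
  assumes c: "cmod c = 1"
  shows measurable_lebesgue_rotation: "(*) c \<in> lebesgue \<rightarrow>\<^sub>M lebesgue"
    and lebesgue_distr_rotation: "distr lebesgue lebesgue ((*) c) = (lebesgue :: complex measure)"
proof -
  have m: "(*) c \<in> lebesgue \<rightarrow>\<^sub>M lborel"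
    by (rule measurable_completion) simp
  have d: "distr lebesgue lborel ((*) c) = lborel"
    using lborel_distr_rotation[OF c] by (subst distr_completion) (simp_all cong: distr_cong)
  show "(*) c \<in> lebesgue \<rightarrow>\<^sub>M lebesgue"
    by (rule completion.measurable_completion2[OF m]) (simp add: d)
  show "distr lebesgue lebesgue ((*) c) = lebesgue"
    using completion.completion_distr_eq[OF m] by (simp add: d)
qed

lemma disk_rotation:
  assumes c: "cmod c = 1"
  shows measurable_disk_rotation: "(*) c \<in> disk_measure \<rightarrow>\<^sub>M disk_measure"
    and disk_distr_rotation: "distr disk_measure disk_measure ((*) c) = disk_measure"
proof -
  show m: "(*) c \<in> disk_measure \<rightarrow>\<^sub>M disk_measure"
    unfolding disk_measure_def
    by (intro measurable_restrict_space2 measurable_restrict_space1 measurable_lebesgue_rotation c)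
       (auto simp: space_restrict_space norm_mult c)
  show "distr disk_measure disk_measure ((*) c) = disk_measure"
  proof (rule measure_eqI)
    fix A assume "A \<in> sets (distr disk_measure disk_measure ((*) c))"
    then have A: "A \<in> sets disk_measure" by simp
    then have A': "A \<in> sets lebesgue" "A \<subseteq> ball 0 1"
      by (auto simp: disk_measure_def sets_restrict_space_iff)
    have "emeasure (distr disk_measure disk_measure ((*) c)) A = emeasure disk_measure ((*) c -` A \<inter> ball 0 1)"
      using A m by (simp add: emeasure_distr)
    also have "\<dots> = emeasure lebesgue ((*) c -` A \<inter> ball 0 1)"
      unfolding disk_measure_def by (rule emeasure_restrict_space) auto
    also have "(*) c -` A \<inter> ball 0 1 = (*) c -` A \<inter> space lebesgue"
      using A'(2) by (auto simp: norm_mult c)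
    also have "emeasure lebesgue \<dots> = emeasure (distr lebesgue lebesgue ((*) c)) A"
      by (rule emeasure_distr[symmetric]) (use A' measurable_lebesgue_rotation[OF c] in auto)
    also have "\<dots> = emeasure disk_measure A"
      unfolding lebesgue_distr_rotation[OF c] disk_measure_def
      by (rule emeasure_restrict_space[symmetric]) (use A' in auto)
    finally show "emeasure (distr disk_measure disk_measure ((*) c)) A = emeasure disk_measure A" .
  qed simp
qed

lemma circle_distr_rotation:
  assumes c: "cmod c = 1"
  shows "distr circle_measure circle_measure ((*) c) = circle_measure"
proof (rule measure_eqI)
  fix A assume "A \<in> sets (distr circle_measure circle_measure ((*) c))"
  then have A [measurable]: "A \<in> sets circle_measure" by simp
  have "emeasure (distr circle_measure circle_measure ((*) c)) A =
      (\<integral>\<^sup>+z. indicator A z \<partial>distr circle_measure circle_measure ((*) c))"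
    using A by simp
  also have "\<dots> = (\<integral>\<^sup>+z. indicator A (c * z) \<partial>circle_measure)"
    by (rule nn_integral_distr[OF measurable_circle_rotation[OF c]]) (use A in measurable)
  also have "\<dots> = (\<integral>\<^sup>+z. indicator A z \<partial>circle_measure)"
    by (rule nn_integral_circle_rotation[OF _ c]) (use A in measurable)
  also have "\<dots> = emeasure circle_measure A"
    using A by simp
  finally show "emeasure (distr circle_measure circle_measure ((*) c)) A = emeasure circle_measure A" .
qed simp

section \<open>Transport of integrals and L2 functions by measure-preserving maps\<close>

lemma integral_measure_preserving:
  fixes f :: "'a \<Rightarrow> 'b::{banach, second_countable_topology}"
  assumes T: "T \<in> M \<rightarrow>\<^sub>M M" "distr M M T = M" and f: "f \<in> borel_measurable M"
  shows "(LINT x|M. f (T x)) = (LINT x|M. f x)"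
  using integral_distr[OF T(1) f] by (simp add: T(2))

lemma L2_measure_preserving:
  fixes f :: "'a \<Rightarrow> 'b::euclidean_space"
  assumes T: "T \<in> M \<rightarrow>\<^sub>M M" "distr M M T = M" and f: "f \<in> L2 M"
  shows "(\<lambda>x. f (T x)) \<in> L2 M"
proof -
  have "integrable M (\<lambda>x. (norm (f (T x)))\<^sup>2)"
    using integrable_distr[OF T(1), of "\<lambda>x. (norm (f x))\<^sup>2"] L2D[OF f] by (simp add: T(2))
  then show ?thesis
    using measurable_compose[OF T(1) L2D(1)[OF f]] by (simp add: L2_def)
qed

lemmas integral_disk_rotation = integral_measure_preserving[OF measurable_disk_rotation disk_distr_rotation]
lemmas integral_circle_rotation = integral_measure_preserving[OF measurable_circle_rotation circle_distr_rotation]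
lemmas L2_disk_rotation = L2_measure_preserving[OF measurable_disk_rotation disk_distr_rotation]
lemmas L2_circle_rotation = L2_measure_preserving[OF measurable_circle_rotation circle_distr_rotation]

text \<open>The exceptional set of the radial profile is pulled back by the rotation and remains
  null; off both null sets the two values agree since \<open>cmod\<close> is invariant.\<close>

lemma rotationally_symmetric_AE:
  assumes \<sigma>: "rotationally_symmetric \<sigma>" and c: "cmod c = 1"
  shows "AE z in disk_measure. \<sigma> (c * z) = \<sigma> z"
proof -
  obtain s where s: "AE z in disk_measure. \<sigma> z = s (cmod z)"
    using \<sigma> by (auto simp: rotationally_symmetric_def)
  then have "AE z in disk_measure. \<sigma> (c * z) = s (cmod (c * z))"
    by (intro AE_distrD[OF measurable_disk_rotation[OF c], of "\<lambda>z. \<sigma> z = s (cmod z)"])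
       (simp only: disk_distr_rotation[OF c])
  with s show ?thesis
    by eventually_elim (simp add: norm_mult c)
qed

lemma L2_mult_unimodular:
  assumes c: "cmod c = 1" and G: "G \<in> L2 M"
  shows "(\<lambda>x. c * (G x :: complex)) \<in> L2 M"
  using L2D[OF G] by (auto simp: L2_def norm_mult c)

text \<open>Rotating the C1 approximants leaves all three approximation errors unchanged.\<close>

lemma H1_trace_rotation:
  assumes c: "cmod c = 1" and H1: "H1_trace u G f"
  shows "H1_trace (\<lambda>z. u (c * z)) (\<lambda>z. cnj c * G (c * z)) (\<lambda>z. f (c * z))"
proof -
  have L2: "u \<in> L2 disk_measure" "G \<in> L2 disk_measure" "f \<in> L2 circle_measure"
    using H1 by (auto simp: H1_trace_def weak_gradient_def)
  obtain w dw where w: "\<And>k::nat. C1_with_gradient (w k) (dw k)"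
    and l: "(\<lambda>k. LINT z|disk_measure. (w k z - u z)\<^sup>2) \<longlonglongrightarrow> 0"
      "(\<lambda>k. LINT z|disk_measure. (norm (dw k z - G z))\<^sup>2) \<longlonglongrightarrow> 0"
      "(\<lambda>k. LINT z|circle_measure. (w k z - f z)\<^sup>2) \<longlonglongrightarrow> 0"
    using H1 unfolding H1_trace_def by blast
  note Lw = C1_with_gradient_L2[OF w]
  have cc: "cmod (cnj c) = 1" using c by simp
  have n: "norm (cnj c * dw k z - cnj c * G y) = norm (dw k z - G y)" for k z y
    by (metis cc mult.left_neutral norm_mult right_diff_distrib)
  have "(LINT z|disk_measure. (w k (c * z) - u (c * z))\<^sup>2) = (LINT z|disk_measure. (w k z - u z)\<^sup>2)" for k
    using L2D(1)[OF L2(1)] L2D(1)[OF Lw(1)] by (intro integral_disk_rotation[OF c c]) simp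
  moreover have "(LINT z|disk_measure. (norm (dw k (c * z) - G (c * z)))\<^sup>2) = (LINT z|disk_measure. (norm (dw k z - G z))\<^sup>2)" for k
    using L2D(1)[OF L2(2)] L2D(1)[OF Lw(2)] by (intro integral_disk_rotation[OF c c]) simp
  moreover have "(LINT z|circle_measure. (w k (c * z) - f (c * z))\<^sup>2) = (LINT z|circle_measure. (w k z - f z)\<^sup>2)" for k
    using L2D(1)[OF L2(3)] L2D(1)[OF Lw(3)] by (intro integral_circle_rotation[OF c c]) simp
  ultimately show ?thesis
    using l by (intro H1_trace_limit[of "\<lambda>k z. w k (c * z)" "\<lambda>k z. cnj c * dw k (c * z)"])
      (simp_all add: C1_with_gradient_rotation[OF w] L2_disk_rotation[OF c c] L2_circle_rotation[OF c c]
        L2_mult_unimodular[OF cc] L2 n)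
qed

text \<open>The test function is rotated backwards, inserted into the original equation, and the
  variables are rotated forwards again.\<close>

lemma weak_neumann_solution_rotation:
  assumes \<sigma>: "admissible_conductivity \<sigma>" "rotationally_symmetric \<sigma>" and c: "cmod c = 1"
    and \<psi>: "\<psi> \<in> L2 circle_measure" and sol: "weak_neumann_solution \<sigma> \<psi> u G f"
  shows "weak_neumann_solution \<sigma> (\<lambda>z. \<psi> (c * z)) (\<lambda>z. u (c * z)) (\<lambda>z. cnj c * G (c * z)) (\<lambda>z. f (c * z))"
proof -
  have H1: "H1_trace u G f" and mean: "(LINT z|circle_measure. f z) = 0"
    and test: "\<And>v H h. H1_trace v H h \<Longrightarrow>
      (LINT z|disk_measure. \<sigma> z * (G z \<bullet> H z)) = (LINT z|circle_measure. \<psi> z * h z)"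
    using sol by (auto simp: weak_neumann_solution_def)
  have L2: "G \<in> L2 disk_measure" "f \<in> L2 circle_measure"
    using H1 by (auto simp: H1_trace_def weak_gradient_def)
  have \<sigma>m [measurable]: "\<sigma> \<in> borel_measurable disk_measure"
    using \<sigma>(1) by (simp add: admissible_conductivity_def)
  have H1': "H1_trace (\<lambda>z. u (c * z)) (\<lambda>z. cnj c * G (c * z)) (\<lambda>z. f (c * z))"
    by (rule H1_trace_rotation[OF c H1])
  have cc: "cmod (cnj c) = 1" "cnj c * c = 1"
    using c complex_norm_square[of c] by (simp_all add: mult.commute)
  have "(LINT z|disk_measure. \<sigma> z * ((cnj c * G (c * z)) \<bullet> H z)) = (LINT z|circle_measure. \<psi> (c * z) * h z)"
    if "H1_trace v H h" for v H h
  proof -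
    have L2': "H \<in> L2 disk_measure" "h \<in> L2 circle_measure"
      using that by (auto simp: H1_trace_def weak_gradient_def)
    have H1r: "H1_trace (\<lambda>z. v (cnj c * z)) (\<lambda>z. c * H (cnj c * z)) (\<lambda>z. h (cnj c * z))"
      using H1_trace_rotation[OF cc(1) that] by simp
    then have L2r: "(\<lambda>z. c * H (cnj c * z)) \<in> L2 disk_measure" "(\<lambda>z. h (cnj c * z)) \<in> L2 circle_measure"
      by (auto simp: H1_trace_def weak_gradient_def)
    have cancel: "cnj c * (c * z) = z" for z
      using cc(2) by (simp flip: mult.assoc)
    have adj: "(cnj c * x) \<bullet> y = x \<bullet> (c * y)" for x y
      by (simp add: inner_complex_def algebra_simps)
    \<comment> \<open>Here the symmetry of \<open>\<sigma>\<close> is used almost everywhere, and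
      \<open>cnj c\<close> crosses the inner product as its adjoint \<open>c\<close>.\<close>
    have "(LINT z|disk_measure. \<sigma> z * ((cnj c * G (c * z)) \<bullet> H z)) =
        (LINT z|disk_measure. \<sigma> (c * z) * (G (c * z) \<bullet> (c * H (cnj c * (c * z)))))"
    proof (rule integral_cong_AE)
      have m: "(\<lambda>z. \<sigma> (c * z)) \<in> borel_measurable disk_measure" "(\<lambda>z. G (c * z)) \<in> borel_measurable disk_measure"
        using measurable_compose[OF measurable_disk_rotation[OF c]] L2D(1)[OF L2(1)] \<sigma>m by blast+
      show "(\<lambda>z. \<sigma> z * ((cnj c * G (c * z)) \<bullet> H z)) \<in> borel_measurable disk_measure"
        using m L2D(1)[OF L2'(1)] by measurable
      show "(\<lambda>z. \<sigma> (c * z) * (G (c * z) \<bullet> (c * H (cnj c * (c * z))))) \<in> borel_measurable disk_measure"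
        unfolding cancel using m L2D(1)[OF L2'(1)] by measurable
      show "AE z in disk_measure. \<sigma> z * ((cnj c * G (c * z)) \<bullet> H z) =
          \<sigma> (c * z) * (G (c * z) \<bullet> (c * H (cnj c * (c * z))))"
        using rotationally_symmetric_AE[OF \<sigma>(2) c]
        by eventually_elim (simp only: cancel adj)
    qed
    also have "\<dots> = (LINT z|disk_measure. \<sigma> z * (G z \<bullet> (c * H (cnj c * z))))"
      using L2D(1)[OF L2(1)] L2D(1)[OF L2r(1)]
      by (intro integral_disk_rotation[OF c c, of "\<lambda>z. \<sigma> z * (G z \<bullet> (c * H (cnj c * z)))"]) measurable
    also have "\<dots> = (LINT z|circle_measure. \<psi> z * h (cnj c * z))"
      by (rule test[OF H1r])
    also have "\<dots> = (LINT z|circle_measure. \<psi> (c * z) * h (cnj c * (c * z)))"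
      using L2D(1)[OF \<psi>] L2D(1)[OF L2r(2)]
      by (intro integral_circle_rotation[OF c c, of "\<lambda>z. \<psi> z * h (cnj c * z)", symmetric] borel_measurable_times)
    finally show ?thesis
      unfolding cancel .
  qed
  moreover have "(LINT z|circle_measure. f (c * z)) = 0"
    using integral_circle_rotation[OF c c L2D(1)[OF L2(2)]] mean by simp
  ultimately show ?thesis
    using H1' by (auto simp: weak_neumann_solution_def)
qed

section \<open>The ND map as a symmetric and rotation-invariant form\<close>

lemma nd_map_solution:
  assumes "admissible_conductivity \<sigma>" "\<psi> \<in> L2 circle_measure" "(LINT z|circle_measure. \<psi> z) = 0"
  shows "\<exists>u G. weak_neumann_solution \<sigma> \<psi> u G (nd_map \<sigma> \<psi>)"
proof -
  have "\<exists>f u G. weak_neumann_solution \<sigma> \<psi> u G f"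
    using weak_neumann_solution_exists[OF assms] by blast
  then show ?thesis
    unfolding nd_map_def by (rule someI_ex)
qed

lemma nd_map_L2:
  assumes "admissible_conductivity \<sigma>" "\<psi> \<in> L2 circle_measure" "(LINT z|circle_measure. \<psi> z) = 0"
  shows "nd_map \<sigma> \<psi> \<in> L2 circle_measure"
  using nd_map_solution[OF assms] by (auto simp: weak_neumann_solution_def H1_trace_def)

text \<open>Each solution serves as test function for the other, so both boundary pairings equal the
  same energy. In particular the pairing is the same for every solution with current
  \<open>\<phi>\<close>.\<close>

lemma weak_neumann_reciprocity:
  assumes f: "weak_neumann_solution \<sigma> \<phi> u G f" and h: "weak_neumann_solution \<sigma> \<psi> v H h"
  shows "circle_inner f \<psi> = circle_inner h \<phi>"
proof -
  have "(LINT z|disk_measure. \<sigma> z * (G z \<bullet> H z)) = (LINT z|circle_measure. \<phi> z * h z)"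
    and "(LINT z|disk_measure. \<sigma> z * (H z \<bullet> G z)) = (LINT z|circle_measure. \<psi> z * f z)"
    using f h by (auto simp: weak_neumann_solution_def)
  then show ?thesis
    by (simp add: circle_inner_def inner_commute mult.commute)
qed

lemma nd_map_symmetric:
  assumes "admissible_conductivity \<sigma>"
    and "\<phi> \<in> L2 circle_measure" "(LINT z|circle_measure. \<phi> z) = 0"
    and "\<psi> \<in> L2 circle_measure" "(LINT z|circle_measure. \<psi> z) = 0"
  shows "circle_inner (nd_map \<sigma> \<phi>) \<psi> = circle_inner (nd_map \<sigma> \<psi>) \<phi>"
  using nd_map_solution[OF assms(1-3)] nd_map_solution[OF assms(1,4,5)] weak_neumann_reciprocity by blast

text \<open>The representative chosen for the rotated current need not be the rotated
  representative. Reciprocity pairs it with a solution known to be rotated, namely the one for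
  \<open>\<psi>\<close>.\<close>

lemma nd_map_rotation:
  assumes \<sigma>: "admissible_conductivity \<sigma>" "rotationally_symmetric \<sigma>" and c: "cmod c = 1"
    and \<phi>: "\<phi> \<in> L2 circle_measure" "(LINT z|circle_measure. \<phi> z) = 0"
    and \<psi>: "\<psi> \<in> L2 circle_measure" "(LINT z|circle_measure. \<psi> z) = 0"
  shows "circle_inner (nd_map \<sigma> (\<lambda>z. \<phi> (c * z))) (\<lambda>z. \<psi> (c * z)) = circle_inner (nd_map \<sigma> \<phi>) \<psi>"
proof -
  have \<phi>c: "(\<lambda>z. \<phi> (c * z)) \<in> L2 circle_measure" "(LINT z|circle_measure. \<phi> (c * z)) = 0"
    using L2_circle_rotation[OF c c \<phi>(1)] integral_circle_rotation[OF c c L2D(1)[OF \<phi>(1)]] \<phi>(2) by simp_all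
  obtain u G where "weak_neumann_solution \<sigma> \<psi> u G (nd_map \<sigma> \<psi>)"
    using nd_map_solution[OF \<sigma>(1) \<psi>] by blast
  from weak_neumann_solution_rotation[OF \<sigma> c \<psi>(1) this]
  have "circle_inner (nd_map \<sigma> (\<lambda>z. \<phi> (c * z))) (\<lambda>z. \<psi> (c * z)) =
      circle_inner (\<lambda>z. nd_map \<sigma> \<psi> (c * z)) (\<lambda>z. \<phi> (c * z))"
    using nd_map_solution[OF \<sigma>(1) \<phi>c] weak_neumann_reciprocity by blast
  also have "\<dots> = circle_inner (nd_map \<sigma> \<psi>) \<phi>"
    unfolding circle_inner_def using L2D(1)[OF nd_map_L2[OF \<sigma>(1) \<psi>]] L2D(1)[OF \<phi>(1)]
    by (intro integral_circle_rotation[OF c c, of "\<lambda>z. nd_map \<sigma> \<psi> z * \<phi> z"] borel_measurable_times)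
  also have "\<dots> = circle_inner (nd_map \<sigma> \<phi>) \<psi>"
    by (rule nd_map_symmetric[OF \<sigma>(1) \<psi> \<phi>])
  finally show ?thesis .
qed

section \<open>Trigonometric eigenfunctions\<close>

text \<open>On the unit circle this is the cosine of \<open>j\<close> times the angle. Through
  integer powers the addition formulas follow from multiplicativity, free of the branch cut of
  \<open>Arg\<close>.\<close>

definition cos_mode :: "int \<Rightarrow> complex \<Rightarrow> real" where
  "cos_mode j z = Re (z powi j)"

definition sin_mode :: "int \<Rightarrow> complex \<Rightarrow> real" where
  "sin_mode j z = Im (z powi j)"

lemma mode_mult:
  "cos_mode j (w * z) = cos_mode j w * cos_mode j z - sin_mode j w * sin_mode j z"
  "sin_mode j (w * z) = sin_mode j w * cos_mode j z + cos_mode j w * sin_mode j z"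
  by (simp_all add: cos_mode_def sin_mode_def power_int_mult_distrib)

lemma mode_cnj:
  "cos_mode j (cnj z) = cos_mode j z" "sin_mode j (cnj z) = - sin_mode j z"
proof -
  have "cnj z powi j = cnj (z powi j)"
    by (auto simp: power_int_def)
  then show "cos_mode j (cnj z) = cos_mode j z" "sin_mode j (cnj z) = - sin_mode j z"
    unfolding cos_mode_def sin_mode_def by (simp_all only: cnj.sel)
qed

lemma mode_L2: "cos_mode j \<in> L2 circle_measure" "sin_mode j \<in> L2 circle_measure"
proof -
  \<comment> \<open>For negative \<open>j\<close> the power is continuous only away from the origin,
    hence the restriction to the circle.\<close>
  have c: "continuous_on (sphere 0 1) (\<lambda>z::complex. z powi j)"
    by (intro continuous_intros) auto
  have "cos_mode j \<in> borel_measurable (restrict_space borel (sphere 0 1))"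
    "sin_mode j \<in> borel_measurable (restrict_space borel (sphere 0 1))"
    unfolding cos_mode_def[abs_def] sin_mode_def[abs_def]
    by (intro borel_measurable_continuous_on_restrict continuous_intros c)+
  then have m: "cos_mode j \<in> borel_measurable circle_measure" "sin_mode j \<in> borel_measurable circle_measure"
    unfolding measurable_cong_sets[OF sets_circle_measure refl] .
  have b: "\<bar>cos_mode j z\<bar> \<le> 1" "\<bar>sin_mode j z\<bar> \<le> 1" if "z \<in> space circle_measure" for z
  proof -
    have "cmod (z powi j) = 1"
      using that by (simp add: norm_power_int)
    then show "\<bar>cos_mode j z\<bar> \<le> 1" "\<bar>sin_mode j z\<bar> \<le> 1"
      using abs_Re_le_cmod[of "z powi j"] abs_Im_le_cmod[of "z powi j"]
      by (simp_all add: cos_mode_def sin_mode_def)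
  qed
  show "cos_mode j \<in> L2 circle_measure" "sin_mode j \<in> L2 circle_measure"
    by (rule circle.L2_bounded[where C=1, OF m(1)]; use b in simp)
       (rule circle.L2_bounded[where C=1, OF m(2)]; use b in simp)
qed

text \<open>Rotation by \<open>\<pi> / j\<close> changes the sign of both modes.\<close>

lemma mode_mean_zero:
  assumes "j \<noteq> 0"
  shows "(LINT z|circle_measure. cos_mode j z) = 0" "(LINT z|circle_measure. sin_mode j z) = 0"
proof -
  define c where "c = cis (pi / of_int j)"
  have c: "cmod c = 1" by (simp add: c_def)
  have "c powi j = -1"
    using assms by (simp add: c_def cis_power_int)
  then have "cos_mode j (c * z) = - cos_mode j z" "sin_mode j (c * z) = - sin_mode j z" for z
    by (simp_all add: cos_mode_def sin_mode_def power_int_mult_distrib)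
  then show "(LINT z|circle_measure. cos_mode j z) = 0" "(LINT z|circle_measure. sin_mode j z) = 0"
    using integral_circle_rotation[OF c c L2D(1)[OF mode_L2(1)[of j]]]
      integral_circle_rotation[OF c c L2D(1)[OF mode_L2(2)[of j]]] by simp_all
qed

section \<open>Averaging over rotations against a mode\<close>

lemma circle_convolution_Fubini:
  fixes f \<phi> K :: "complex \<Rightarrow> real"
  assumes f: "f \<in> L2 circle_measure" and \<phi>: "\<phi> \<in> L2 circle_measure"
    and K: "K \<in> L2 circle_measure"
  shows "(LINT w|circle_measure. K w * (LINT z|circle_measure. f z * \<phi> (w * z))) =
      (LINT z|circle_measure. f z * (LINT w|circle_measure. K w * \<phi> (z * w)))"
    and "integrable circle_measure (\<lambda>w. K w * (LINT z|circle_measure. f z * \<phi> (w * z)))"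
    and "integrable circle_measure (\<lambda>z. f z * (LINT w|circle_measure. K w * \<phi> (z * w)))"
proof -
  interpret pair_sigma_finite circle_measure circle_measure ..
  let ?h = "\<lambda>p. K (fst p) * (f (snd p) * \<phi> (fst p * snd p))"
  have inc: "(\<lambda>z. z) \<in> borel_measurable circle_measure"
    by (intro borel_measurable_circle_measure) simp
  have "(\<lambda>p. fst p * snd p) \<in> borel_measurable (circle_measure \<Otimes>\<^sub>M circle_measure)"
    using measurable_compose[OF measurable_fst inc] measurable_compose[OF measurable_snd inc] by (rule borel_measurable_times)
  then have mult: "(\<lambda>p. fst p * snd p) \<in> (circle_measure \<Otimes>\<^sub>M circle_measure) \<rightarrow>\<^sub>M circle_measure"
    unfolding measurable_cong_sets[OF refl sets_circle_measure]
    by (intro measurable_restrict_space2) (auto simp: space_pair_measure norm_mult)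
  have m: "?h \<in> borel_measurable (circle_measure \<Otimes>\<^sub>M circle_measure)"
    by (intro borel_measurable_times measurable_compose[OF measurable_fst L2D(1)[OF K]]
        measurable_compose[OF measurable_snd L2D(1)[OF f]] measurable_compose[OF mult L2D(1)[OF \<phi>]])
  have rot: "(\<lambda>z. \<phi> (w * z)) \<in> L2 circle_measure" if "w \<in> sphere 0 1" for w
    using L2_circle_rotation[OF _ _ \<phi>, of w] that by simp
  have fa: "(\<lambda>z. \<bar>f z\<bar>) \<in> L2 circle_measure" and \<phi>a: "(\<lambda>z. \<bar>\<phi> z\<bar>) \<in> L2 circle_measure"
    using f \<phi> by (auto simp: L2_def)
  \<comment> \<open>Cauchy-Schwarz and invariance of arc length bound the integral over
    \<open>z\<close> by \<open>B\<close> uniformly in \<open>w\<close>, so integrability of the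
    kernel \<open>K\<close> suffices on the product.\<close>
  define B where "B = sqrt (LINT z|circle_measure. (norm \<bar>f z\<bar>)\<^sup>2) * sqrt (LINT z|circle_measure. (norm \<bar>\<phi> z\<bar>)\<^sup>2)"
  have int: "integrable (circle_measure \<Otimes>\<^sub>M circle_measure) ?h"
  proof (rule Fubini_integrable[OF m])
    show "integrable circle_measure (\<lambda>x. LINT y|circle_measure. norm (?h (x, y)))"
    proof (rule Bochner_Integration.integrable_bound)
      show "integrable circle_measure (\<lambda>w. B * K w)"
        using circle.integrable_L2[OF K] by simp
      show "(\<lambda>x. LINT y|circle_measure. norm (?h (x, y))) \<in> borel_measurable circle_measure"
        using m by (intro circle.borel_measurable_lebesgue_integral) simp
      show "AE w in circle_measure. norm (LINT y|circle_measure. norm (?h (w, y))) \<le> norm (B * K w)"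
      proof (rule AE_I2)
        fix w assume w: "w \<in> space circle_measure"
        then have w1: "cmod w = 1" by simp
        have "(LINT y|circle_measure. norm (?h (w, y))) = \<bar>K w\<bar> * (LINT y|circle_measure. \<bar>f y\<bar> * \<bar>\<phi> (w * y)\<bar>)"
          by (simp add: abs_mult mult.assoc)
        moreover have "0 \<le> (LINT y|circle_measure. \<bar>f y\<bar> * \<bar>\<phi> (w * y)\<bar>)"
          by (rule Bochner_Integration.integral_nonneg) simp
        moreover have "(LINT y|circle_measure. \<bar>f y\<bar> * \<bar>\<phi> (w * y)\<bar>) \<le> B"
          using Cauchy_Schwarz_L2[OF fa L2_circle_rotation[OF w1 w1 \<phi>a]]
            integral_circle_rotation[OF w1 w1, of "\<lambda>z. (norm \<bar>\<phi> z\<bar>)\<^sup>2"] L2D(1)[OF \<phi>]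
          by (simp add: B_def)
        ultimately have "norm (LINT y|circle_measure. norm (?h (w, y))) =
            \<bar>K w\<bar> * (LINT y|circle_measure. \<bar>f y\<bar> * \<bar>\<phi> (w * y)\<bar>)"
          and "\<bar>K w\<bar> * (LINT y|circle_measure. \<bar>f y\<bar> * \<bar>\<phi> (w * y)\<bar>) \<le> \<bar>K w\<bar> * \<bar>B\<bar>"
          by (simp, intro mult_left_mono) simp_all
        then show "norm (LINT y|circle_measure. norm (?h (w, y))) \<le> norm (B * K w)"
          by (simp only: real_norm_def abs_mult mult.commute)
      qed
    qed
    show "AE w in circle_measure. integrable circle_measure (\<lambda>y. ?h (w, y))"
      by (rule AE_I2) (use integrable_mult_L2[OF f rot] in simp)
  qed
  have 1: "(LINT y|circle_measure. ?h (w, y)) = K w * (LINT z|circle_measure. f z * \<phi> (w * z))" for w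
    by simp
  have 2: "(LINT x|circle_measure. ?h (x, z)) = f z * (LINT w|circle_measure. K w * \<phi> (z * w))" for z
  proof -
    have "(LINT x|circle_measure. ?h (x, z)) = (LINT x|circle_measure. f z * (K x * \<phi> (z * x)))"
      by (simp add: mult_ac)
    then show ?thesis by simp
  qed
  show "(LINT w|circle_measure. K w * (LINT z|circle_measure. f z * \<phi> (w * z))) =
      (LINT z|circle_measure. f z * (LINT w|circle_measure. K w * \<phi> (z * w)))"
    using Fubini_integral[of "\<lambda>x y. ?h (x, y)"] int unfolding 1[symmetric] 2[symmetric]
    by (simp add: split_beta')
  show "integrable circle_measure (\<lambda>w. K w * (LINT z|circle_measure. f z * \<phi> (w * z)))"
    using integrable_fst'[OF int] unfolding 1 .
  show "integrable circle_measure (\<lambda>z. f z * (LINT w|circle_measure. K w * \<phi> (z * w)))"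
    using integrable_snd[of "\<lambda>x y. ?h (x, y)"] int unfolding 2 by (simp add: split_beta')
qed

text \<open>After the substitution of \<open>cnj z * w\<close> for \<open>w\<close>, the mode splits
  by the addition formula for the difference of the two angles.\<close>

lemma mode_convolution:
  assumes \<phi>: "\<phi> \<in> L2 circle_measure" and z: "cmod z = 1"
  shows "(LINT w|circle_measure. cos_mode j w * \<phi> (z * w)) =
      cos_mode j z * circle_inner (cos_mode j) \<phi> + sin_mode j z * circle_inner (sin_mode j) \<phi>"
    and "(LINT w|circle_measure. sin_mode j w * \<phi> (z * w)) =
      cos_mode j z * circle_inner (sin_mode j) \<phi> - sin_mode j z * circle_inner (cos_mode j) \<phi>"
proof -
  have "cnj z * z = 1"
    using z complex_norm_square[of z] by (simp add: mult.commute)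
  then have zz: "cmod (cnj z) = 1" "cnj z * (z * w) = w" for w
    using z by (simp_all flip: mult.assoc)
  have i: "integrable circle_measure (\<lambda>z. cos_mode j z * \<phi> z)" "integrable circle_measure (\<lambda>z. sin_mode j z * \<phi> z)"
    by (intro integrable_mult_L2 mode_L2 \<phi>)+
  have s: "(LINT w|circle_measure. K w * \<phi> (z * w)) = (LINT w|circle_measure. K (cnj z * w) * \<phi> w)"
    if K: "K \<in> L2 circle_measure" for K
    using integral_circle_rotation[OF z z, of "\<lambda>w. K (cnj z * w) * \<phi> w"]
      L2D(1)[OF L2_circle_rotation[OF zz(1) zz(1) K]] L2D(1)[OF \<phi>]
    by (simp add: zz(2) borel_measurable_times)
  have "(LINT w|circle_measure. cos_mode j w * \<phi> (z * w)) =
      (LINT w|circle_measure. cos_mode j z * (cos_mode j w * \<phi> w) + sin_mode j z * (sin_mode j w * \<phi> w))"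
    unfolding s[OF mode_L2(1)] mode_mult mode_cnj by (simp add: algebra_simps)
  then show "(LINT w|circle_measure. cos_mode j w * \<phi> (z * w)) =
      cos_mode j z * circle_inner (cos_mode j) \<phi> + sin_mode j z * circle_inner (sin_mode j) \<phi>"
    using i by (simp add: circle_inner_def)
  have "(LINT w|circle_measure. sin_mode j w * \<phi> (z * w)) =
      (LINT w|circle_measure. cos_mode j z * (sin_mode j w * \<phi> w) - sin_mode j z * (cos_mode j w * \<phi> w))"
    unfolding s[OF mode_L2(2)] mode_mult mode_cnj by (simp add: algebra_simps)
  then show "(LINT w|circle_measure. sin_mode j w * \<phi> (z * w)) =
      cos_mode j z * circle_inner (sin_mode j) \<phi> - sin_mode j z * circle_inner (cos_mode j) \<phi>"
    using i by (simp add: circle_inner_def)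
qed

lemma circle_inner_convolution:
  assumes f: "f \<in> L2 circle_measure" and \<phi>: "\<phi> \<in> L2 circle_measure"
  shows "(LINT w|circle_measure. cos_mode j w * circle_inner f (\<lambda>z. \<phi> (w * z))) =
      circle_inner f (cos_mode j) * circle_inner (cos_mode j) \<phi> + circle_inner f (sin_mode j) * circle_inner (sin_mode j) \<phi>"
    and "(LINT w|circle_measure. sin_mode j w * circle_inner f (\<lambda>z. \<phi> (w * z))) =
      circle_inner f (cos_mode j) * circle_inner (sin_mode j) \<phi> - circle_inner f (sin_mode j) * circle_inner (cos_mode j) \<phi>"
proof -
  have i: "integrable circle_measure (\<lambda>z. f z * cos_mode j z)" "integrable circle_measure (\<lambda>z. f z * sin_mode j z)"
    by (intro integrable_mult_L2 mode_L2 f)+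
  have "(LINT w|circle_measure. cos_mode j w * circle_inner f (\<lambda>z. \<phi> (w * z))) =
      (LINT z|circle_measure. f z * (LINT w|circle_measure. cos_mode j w * \<phi> (z * w)))"
    unfolding circle_inner_def by (rule circle_convolution_Fubini(1)[OF f \<phi> mode_L2(1)])
  also have "\<dots> = (LINT z|circle_measure. (f z * cos_mode j z) * circle_inner (cos_mode j) \<phi>
      + (f z * sin_mode j z) * circle_inner (sin_mode j) \<phi>)"
    by (intro Bochner_Integration.integral_cong refl) (simp add: mode_convolution[OF \<phi>] algebra_simps)
  also have "\<dots> = circle_inner f (cos_mode j) * circle_inner (cos_mode j) \<phi> + circle_inner f (sin_mode j) * circle_inner (sin_mode j) \<phi>"
    using i by (simp add: circle_inner_def)
  finally show "(LINT w|circle_measure. cos_mode j w * circle_inner f (\<lambda>z. \<phi> (w * z))) = \<dots>" .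
  have "(LINT w|circle_measure. sin_mode j w * circle_inner f (\<lambda>z. \<phi> (w * z))) =
      (LINT z|circle_measure. f z * (LINT w|circle_measure. sin_mode j w * \<phi> (z * w)))"
    unfolding circle_inner_def by (rule circle_convolution_Fubini(1)[OF f \<phi> mode_L2(2)])
  also have "\<dots> = (LINT z|circle_measure. (f z * cos_mode j z) * circle_inner (sin_mode j) \<phi>
      - (f z * sin_mode j z) * circle_inner (cos_mode j) \<phi>)"
    by (intro Bochner_Integration.integral_cong refl) (simp add: mode_convolution[OF \<phi>] algebra_simps)
  also have "\<dots> = circle_inner f (cos_mode j) * circle_inner (sin_mode j) \<phi> - circle_inner f (sin_mode j) * circle_inner (cos_mode j) \<phi>"
    using i by (simp add: circle_inner_def)
  finally show "(LINT w|circle_measure. sin_mode j w * circle_inner f (\<lambda>z. \<phi> (w * z))) = \<dots>" .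
qed

text \<open>Average the rotation invariance of the form
  \<open>(R\<^sub>\<sigma> \<phi>, \<psi>)\<close> over all rotations; the cross terms cancel by symmetry.\<close>

lemma nd_map_mode:
  assumes \<sigma>: "admissible_conductivity \<sigma>" "rotationally_symmetric \<sigma>" and j: "j \<noteq> 0"
    and \<phi>: "\<phi> \<in> L2 circle_measure" "(LINT z|circle_measure. \<phi> z) = 0"
  defines "\<mu> \<equiv> circle_inner (nd_map \<sigma> (cos_mode j)) (cos_mode j) + circle_inner (nd_map \<sigma> (sin_mode j)) (sin_mode j)"
  shows "2 * pi * circle_inner (nd_map \<sigma> (cos_mode j)) \<phi> = \<mu> * circle_inner (cos_mode j) \<phi>"
    and "2 * pi * circle_inner (nd_map \<sigma> (sin_mode j)) \<phi> = \<mu> * circle_inner (sin_mode j) \<phi>"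
proof -
  \<comment> \<open>\<open>\<mu>\<close> is the trace of the form on the span of the two modes. Each
    of them has squared norm \<open>pi\<close>, hence the factor \<open>2 * pi\<close> in place of a
    plain eigenvalue equation.\<close>
  define C S where "C = cos_mode j" and "S = sin_mode j"
  have C: "C \<in> L2 circle_measure" "(LINT z|circle_measure. C z) = 0"
    and S: "S \<in> L2 circle_measure" "(LINT z|circle_measure. S z) = 0"
    using mode_L2 mode_mean_zero[OF j] by (simp_all add: C_def S_def)
  define f g where "f = nd_map \<sigma> C" and "g = nd_map \<sigma> S"
  have f: "f \<in> L2 circle_measure" and g: "g \<in> L2 circle_measure"
    unfolding f_def g_def by (rule nd_map_L2[OF \<sigma>(1) C] nd_map_L2[OF \<sigma>(1) S])+
  have fg: "circle_inner f S = circle_inner g C"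
    unfolding f_def g_def by (rule nd_map_symmetric[OF \<sigma>(1) C S])
  \<comment> \<open>By invariance the pairing of \<open>R \<phi>\<close> with \<open>C\<close>
    equals that of the rotated data; the addition formula expands the rotated mode, and symmetry
    returns to \<open>f\<close> and \<open>g\<close>.\<close>
  have rot: "circle_inner f \<phi> = C w * circle_inner f (\<lambda>z. \<phi> (w * z)) - S w * circle_inner g (\<lambda>z. \<phi> (w * z))"
    "circle_inner g \<phi> = S w * circle_inner f (\<lambda>z. \<phi> (w * z)) + C w * circle_inner g (\<lambda>z. \<phi> (w * z))"
    if w: "cmod w = 1" for w
  proof -
    have \<phi>w: "(\<lambda>z. \<phi> (w * z)) \<in> L2 circle_measure" "(LINT z|circle_measure. \<phi> (w * z)) = 0"
      using L2_circle_rotation[OF w w \<phi>(1)] integral_circle_rotation[OF w w L2D(1)[OF \<phi>(1)]] \<phi>(2) by simp_all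
    define h where "h = nd_map \<sigma> (\<lambda>z. \<phi> (w * z))"
    have h: "h \<in> L2 circle_measure"
      unfolding h_def by (rule nd_map_L2[OF \<sigma>(1) \<phi>w])
    have i: "integrable circle_measure (\<lambda>z. h z * C z)" "integrable circle_measure (\<lambda>z. h z * S z)"
      by (intro integrable_mult_L2 h C S)+
    have hC: "circle_inner h C = circle_inner f (\<lambda>z. \<phi> (w * z))"
      and hS: "circle_inner h S = circle_inner g (\<lambda>z. \<phi> (w * z))"
      unfolding h_def f_def g_def by (rule nd_map_symmetric[OF \<sigma>(1) \<phi>w C] nd_map_symmetric[OF \<sigma>(1) \<phi>w S])+
    have "circle_inner f \<phi> = circle_inner (nd_map \<sigma> \<phi>) C"
      unfolding f_def by (rule nd_map_symmetric[OF \<sigma>(1) C \<phi>])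
    also have "\<dots> = circle_inner h (\<lambda>z. C (w * z))"
      unfolding h_def by (rule nd_map_rotation[OF \<sigma> w \<phi> C, symmetric])
    also have "\<dots> = (LINT z|circle_measure. C w * (h z * C z) - S w * (h z * S z))"
      unfolding circle_inner_def C_def S_def mode_mult by (simp add: algebra_simps)
    also have "\<dots> = C w * circle_inner h C - S w * circle_inner h S"
      using i by (simp add: circle_inner_def)
    finally show "circle_inner f \<phi> = C w * circle_inner f (\<lambda>z. \<phi> (w * z)) - S w * circle_inner g (\<lambda>z. \<phi> (w * z))"
      unfolding hC hS .
    have "circle_inner g \<phi> = circle_inner (nd_map \<sigma> \<phi>) S"
      unfolding g_def by (rule nd_map_symmetric[OF \<sigma>(1) S \<phi>])
    also have "\<dots> = circle_inner h (\<lambda>z. S (w * z))"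
      unfolding h_def by (rule nd_map_rotation[OF \<sigma> w \<phi> S, symmetric])
    also have "\<dots> = (LINT z|circle_measure. S w * (h z * C z) + C w * (h z * S z))"
      unfolding circle_inner_def C_def S_def mode_mult by (simp add: algebra_simps)
    also have "\<dots> = S w * circle_inner h C + C w * circle_inner h S"
      using i by (simp add: circle_inner_def)
    finally show "circle_inner g \<phi> = S w * circle_inner f (\<lambda>z. \<phi> (w * z)) + C w * circle_inner g (\<lambda>z. \<phi> (w * z))"
      unfolding hC hS .
  qed
  have meas: "measure circle_measure (sphere 0 1) = 2 * pi"
    by (simp add: measure_def emeasure_circle_measure_space)
  have int: "integrable circle_measure (\<lambda>w. K w * circle_inner k (\<lambda>z. \<phi> (w * z)))"
    if "K \<in> L2 circle_measure" "k \<in> L2 circle_measure" for K k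
    unfolding circle_inner_def by (rule circle_convolution_Fubini(2)[OF that(2) \<phi>(1) that(1)])
  have "2 * pi * circle_inner f \<phi> = (LINT w|circle_measure. circle_inner f \<phi>)"
    by (simp add: meas)
  also have "\<dots> = (LINT w|circle_measure. C w * circle_inner f (\<lambda>z. \<phi> (w * z)) - S w * circle_inner g (\<lambda>z. \<phi> (w * z)))"
    by (intro Bochner_Integration.integral_cong refl rot(1)) simp
  \<comment> \<open>The averages leave the coefficient
    \<open>circle_inner f S - circle_inner g C\<close> in front of the sine mode; it vanishes by
    \<open>fg\<close>.\<close>
  also have "\<dots> = \<mu> * circle_inner (cos_mode j) \<phi>"
    using int[OF C(1) f] int[OF S(1) g] fg
      circle_inner_convolution(1)[OF f \<phi>(1), of j] circle_inner_convolution(2)[OF g \<phi>(1), of j]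
    unfolding C_def[symmetric] S_def[symmetric] \<mu>_def f_def[symmetric] g_def[symmetric]
    by (simp add: algebra_simps)
  finally show "2 * pi * circle_inner (nd_map \<sigma> (cos_mode j)) \<phi> = \<mu> * circle_inner (cos_mode j) \<phi>"
    by (simp add: f_def C_def)
  have "2 * pi * circle_inner g \<phi> = (LINT w|circle_measure. circle_inner g \<phi>)"
    by (simp add: meas)
  also have "\<dots> = (LINT w|circle_measure. S w * circle_inner f (\<lambda>z. \<phi> (w * z)) + C w * circle_inner g (\<lambda>z. \<phi> (w * z)))"
    by (intro Bochner_Integration.integral_cong refl rot(2)) simp
  also have "\<dots> = \<mu> * circle_inner (sin_mode j) \<phi>"
    using int[OF S(1) f] int[OF C(1) g] fg
      circle_inner_convolution(2)[OF f \<phi>(1), of j] circle_inner_convolution(1)[OF g \<phi>(1), of j]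
    unfolding C_def[symmetric] S_def[symmetric] \<mu>_def f_def[symmetric] g_def[symmetric]
    by (simp add: algebra_simps)
  finally show "2 * pi * circle_inner (nd_map \<sigma> (sin_mode j)) \<phi> = \<mu> * circle_inner (sin_mode j) \<phi>"
    by (simp add: g_def S_def)
qed

section \<open>The normalised basis on the circle in terms of the modes\<close>

definition trig_mode :: "int \<Rightarrow> complex \<Rightarrow> real" where
  "trig_mode n = (if n < 0 then sin_mode n else cos_mode n)"

lemma trig_eq_mode:
  assumes "cmod z = 1"
  shows "trig n z = trig_mode n z / sqrt pi"
proof -
  have "z \<noteq> 0" using assms by auto
  then have "cis (Arg z) = z"
    using assms by (simp add: cis_Arg sgn_div_norm)
  then have "z powi n = cis (of_int n * Arg z)"
    by (metis cis_power_int)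
  then show ?thesis
    by (simp add: trig_def trig_mode_def cos_mode_def sin_mode_def)
qed

lemma trig_mode_L2: "trig_mode n \<in> L2 circle_measure"
  by (simp add: trig_mode_def mode_L2)

lemma trig_L2: "trig n \<in> L2 circle_measure"
proof -
  have "(\<lambda>z. trig_mode n z / sqrt pi) \<in> borel_measurable circle_measure"
    using L2D(1)[OF trig_mode_L2[of n]] by (intro borel_measurable_divide) auto
  then have m: "trig n \<in> borel_measurable circle_measure"
    by (rule measurable_cong[THEN iffD1, rotated]) (simp add: trig_eq_mode)
  have "(\<lambda>z. (1 / sqrt pi) *\<^sub>R trig_mode n z) \<in> L2 circle_measure"
    by (rule L2_scaleR[OF trig_mode_L2])
  then show ?thesis
    by (rule L2_cong_AE[OF _ m]) (auto intro!: AE_I2 simp: trig_eq_mode)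
qed

lemma trig_mean_zero:
  assumes "n \<noteq> 0"
  shows "(LINT z|circle_measure. trig n z) = 0"
proof -
  have "(LINT z|circle_measure. trig n z) = (LINT z|circle_measure. trig_mode n z / sqrt pi)"
    by (intro Bochner_Integration.integral_cong refl) (simp add: trig_eq_mode)
  then show ?thesis
    using mode_mean_zero[OF assms] by (simp add: trig_mode_def)
qed

lemma circle_inner_trig:
  "circle_inner f (trig n) = circle_inner f (trig_mode n) / sqrt pi"
  "circle_inner (trig n) f = circle_inner (trig_mode n) f / sqrt pi"
proof -
  have "circle_inner f (trig n) = (LINT z|circle_measure. (f z * trig_mode n z) / sqrt pi)"
    unfolding circle_inner_def
    by (intro Bochner_Integration.integral_cong refl) (simp add: trig_eq_mode)
  then show "circle_inner f (trig n) = circle_inner f (trig_mode n) / sqrt pi"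
    by (simp add: circle_inner_def)
  then show "circle_inner (trig n) f = circle_inner (trig_mode n) f / sqrt pi"
    by (simp add: circle_inner_def mult.commute)
qed

lemma mode_integral:
  "(LINT z|circle_measure. cos_mode m z) = (if m = 0 then 2 * pi else 0)"
  "(LINT z|circle_measure. sin_mode m z) = 0"
proof -
  have "measure circle_measure (sphere 0 1) = 2 * pi"
    by (simp add: measure_def emeasure_circle_measure_space)
  then show "(LINT z|circle_measure. cos_mode m z) = (if m = 0 then 2 * pi else 0)"
    "(LINT z|circle_measure. sin_mode m z) = 0"
    using mode_mean_zero[of m] by (cases "m = 0"; simp add: cos_mode_def sin_mode_def)+
qed

lemma mode_add:
  assumes z: "cmod z = 1"
  shows "cos_mode (k + l) z = cos_mode k z * cos_mode l z - sin_mode k z * sin_mode l z"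
    and "sin_mode (k + l) z = sin_mode k z * cos_mode l z + cos_mode k z * sin_mode l z"
    and "cos_mode (k - l) z = cos_mode k z * cos_mode l z + sin_mode k z * sin_mode l z"
    and "sin_mode (k - l) z = sin_mode k z * cos_mode l z - cos_mode k z * sin_mode l z"
proof -
  have nz: "z \<noteq> 0" using z by auto
  have neg: "z powi (- l) = cnj (z powi l)"
  proof -
    have "cmod (z powi l) = 1" using z by (simp add: norm_power_int)
    then have "z powi l * cnj (z powi l) = 1"
      using complex_norm_square[of "z powi l"] by simp
    then show ?thesis
      unfolding power_int_minus by (rule inverse_unique)
  qed
  show "cos_mode (k + l) z = cos_mode k z * cos_mode l z - sin_mode k z * sin_mode l z"
    and "sin_mode (k + l) z = sin_mode k z * cos_mode l z + cos_mode k z * sin_mode l z"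
    using nz by (simp_all add: cos_mode_def sin_mode_def power_int_add)
  have "z powi (k - l) = z powi k * cnj (z powi l)"
    using power_int_add[of z k "- l"] nz neg by simp
  then show "cos_mode (k - l) z = cos_mode k z * cos_mode l z + sin_mode k z * sin_mode l z"
    and "sin_mode (k - l) z = sin_mode k z * cos_mode l z - cos_mode k z * sin_mode l z"
    unfolding cos_mode_def sin_mode_def by (simp_all only: times_complex.sel cnj.sel)
qed

text \<open>Product-to-sum formulas reduce to mean values of single modes. The condition
  \<open>k + l = 0\<close> appears because opposite indices give the same function up to
  sign.\<close>

lemma mode_orthogonal:
  "circle_inner (cos_mode k) (cos_mode l) = ((if k + l = 0 then 2 * pi else 0) + (if k = l then 2 * pi else 0)) / 2"
  "circle_inner (sin_mode k) (sin_mode l) = ((if k = l then 2 * pi else 0) - (if k + l = 0 then 2 * pi else 0)) / 2"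
  "circle_inner (sin_mode k) (cos_mode l) = 0"
  "circle_inner (cos_mode k) (sin_mode l) = 0"
proof -
  note i = circle.integrable_L2[OF mode_L2(1)] circle.integrable_L2[OF mode_L2(2)]
  have "circle_inner (cos_mode k) (cos_mode l) = (LINT z|circle_measure. (cos_mode (k + l) z + cos_mode (k - l) z) / 2)"
    "circle_inner (sin_mode k) (sin_mode l) = (LINT z|circle_measure. (cos_mode (k - l) z - cos_mode (k + l) z) / 2)"
    "circle_inner (sin_mode k) (cos_mode l) = (LINT z|circle_measure. (sin_mode (k + l) z + sin_mode (k - l) z) / 2)"
    "circle_inner (cos_mode k) (sin_mode l) = (LINT z|circle_measure. (sin_mode (k + l) z - sin_mode (k - l) z) / 2)"
    unfolding circle_inner_def
    by (intro Bochner_Integration.integral_cong refl; simp add: mode_add)+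
  then show "circle_inner (cos_mode k) (cos_mode l) = ((if k + l = 0 then 2 * pi else 0) + (if k = l then 2 * pi else 0)) / 2"
    "circle_inner (sin_mode k) (sin_mode l) = ((if k = l then 2 * pi else 0) - (if k + l = 0 then 2 * pi else 0)) / 2"
    "circle_inner (sin_mode k) (cos_mode l) = 0" "circle_inner (cos_mode k) (sin_mode l) = 0"
    using i by (simp_all add: mode_integral)
qed

text \<open>For opposite nonzero indices one function is a sine and the other a cosine, so only
  \<open>k = l\<close> contributes, with value \<open>pi / pi\<close>.\<close>

lemma trig_orthonormal:
  assumes "k \<noteq> 0" "l \<noteq> 0"
  shows "circle_inner (trig k) (trig l) = (if k = l then 1 else 0)"
  using assms unfolding circle_inner_trig trig_mode_def by (auto simp: mode_orthogonal)

text \<open>\<open>nd_map\<close> is evaluated at a rescaled mode, and its choices for a current and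
  its multiple are unrelated as functions. Symmetry therefore moves the factor
  \<open>1 / sqrt pi\<close> to the second argument, where it is ordinary linearity of the
  integral.\<close>

lemma nd_map_trig:
  assumes \<sigma>: "admissible_conductivity \<sigma>" "rotationally_symmetric \<sigma>" and n: "n \<noteq> 0"
  shows "\<exists>\<mu>. \<forall>\<phi>\<in>L2 circle_measure. (LINT z|circle_measure. \<phi> z) = 0 \<longrightarrow>
    circle_inner (nd_map \<sigma> (trig n)) \<phi> = \<mu> * circle_inner (trig n) \<phi>"
proof -
  obtain \<mu> where \<mu>: "2 * pi * circle_inner (nd_map \<sigma> (trig_mode n)) \<phi> = \<mu> * circle_inner (trig_mode n) \<phi>"
    if "\<phi> \<in> L2 circle_measure" "(LINT z|circle_measure. \<phi> z) = 0" for \<phi>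
    using nd_map_mode[OF \<sigma> n] unfolding trig_mode_def by (cases "n < 0") (simp_all, blast+)
  have mode: "trig_mode n \<in> L2 circle_measure" "(LINT z|circle_measure. trig_mode n z) = 0"
    using trig_mode_L2 mode_mean_zero[OF n] by (auto simp: trig_mode_def)
  have "circle_inner (nd_map \<sigma> (trig n)) \<phi> = \<mu> / (2 * pi) * circle_inner (trig n) \<phi>"
    if \<phi>: "\<phi> \<in> L2 circle_measure" "(LINT z|circle_measure. \<phi> z) = 0" for \<phi>
  proof -
    have "circle_inner (nd_map \<sigma> (trig n)) \<phi> = circle_inner (nd_map \<sigma> \<phi>) (trig n)"
      by (rule nd_map_symmetric[OF \<sigma>(1) trig_L2 trig_mean_zero[OF n] \<phi>])
    also have "\<dots> = circle_inner (nd_map \<sigma> (trig_mode n)) \<phi> / sqrt pi"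
      unfolding circle_inner_trig nd_map_symmetric[OF \<sigma>(1) \<phi> mode] ..
    also have "circle_inner (nd_map \<sigma> (trig_mode n)) \<phi> = \<mu> / (2 * pi) * circle_inner (trig_mode n) \<phi>"
      using \<mu>[OF \<phi>] by (simp add: field_simps)
    finally show ?thesis
      by (simp add: circle_inner_trig)
  qed
  then show ?thesis by blast
qed

section \<open>The difference to the constant conductivity\<close>

lemma constant_conductivity:
  "admissible_conductivity (\<lambda>_. 1)" "rotationally_symmetric (\<lambda>_. 1)"
  by (auto simp: admissible_conductivity_def rotationally_symmetric_def
      intro!: exI[of _ 1] exI[of _ "\<lambda>_. 1"])

lemma circle_inner_nd_diff:
  assumes \<sigma>: "admissible_conductivity \<sigma>"
    and \<psi>: "\<psi> \<in> L2 circle_measure" "(LINT z|circle_measure. \<psi> z) = 0" and \<phi>: "\<phi> \<in> L2 circle_measure"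
  shows "circle_inner (nd_diff \<sigma> \<psi>) \<phi> = circle_inner (nd_map \<sigma> \<psi>) \<phi> - circle_inner (nd_map (\<lambda>_. 1) \<psi>) \<phi>"
  using integrable_mult_L2[OF nd_map_L2[OF \<sigma> \<psi>] \<phi>]
    integrable_mult_L2[OF nd_map_L2[OF constant_conductivity(1) \<psi>] \<phi>]
  by (simp add: circle_inner_def nd_diff_def algebra_simps)

text \<open>The same \<open>\<mu>\<close> occurs in two roles: the first property computes the
  matrix entries, the second reads \<open>\<mu>\<close> off the measurement. It is the difference of
  the eigenvalues for \<open>\<sigma>\<close> and for 1.\<close>

lemma nd_diff_trig:
  assumes \<sigma>: "admissible_conductivity \<sigma>" "rotationally_symmetric \<sigma>" and n: "n \<noteq> 0"
  obtains \<mu> where "\<And>\<phi>. \<phi> \<in> L2 circle_measure \<Longrightarrow> (LINT z|circle_measure. \<phi> z) = 0 \<Longrightarrow>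
      circle_inner (nd_diff \<sigma> (trig n)) \<phi> = \<mu> * circle_inner (trig n) \<phi>"
    and "\<And>\<phi>. \<phi> \<in> L2 circle_measure \<Longrightarrow> (LINT z|circle_measure. \<phi> z) = 0 \<Longrightarrow>
      circle_inner (nd_diff \<sigma> \<phi>) (trig n) = \<mu> * circle_inner \<phi> (trig n)"
proof -
  note t = trig_L2[of n] trig_mean_zero[OF n]
  obtain \<mu>1 \<mu>2 where 1: "\<And>\<phi>. \<phi> \<in> L2 circle_measure \<Longrightarrow> (LINT z|circle_measure. \<phi> z) = 0 \<Longrightarrow>
      circle_inner (nd_map \<sigma> (trig n)) \<phi> = \<mu>1 * circle_inner (trig n) \<phi>"
    and 2: "\<And>\<phi>. \<phi> \<in> L2 circle_measure \<Longrightarrow> (LINT z|circle_measure. \<phi> z) = 0 \<Longrightarrow>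
      circle_inner (nd_map (\<lambda>_. 1) (trig n)) \<phi> = \<mu>2 * circle_inner (trig n) \<phi>"
    using nd_map_trig[OF \<sigma> n] nd_map_trig[OF constant_conductivity n] by metis
  show thesis
  proof (rule that)
    fix \<phi> :: "complex \<Rightarrow> real" assume \<phi>: "\<phi> \<in> L2 circle_measure" "(LINT z|circle_measure. \<phi> z) = 0"
    show *: "circle_inner (nd_diff \<sigma> (trig n)) \<phi> = (\<mu>1 - \<mu>2) * circle_inner (trig n) \<phi>"
      unfolding circle_inner_nd_diff[OF \<sigma>(1) t \<phi>(1)] 1[OF \<phi>] 2[OF \<phi>] by (simp add: algebra_simps)
    have "circle_inner (nd_diff \<sigma> \<phi>) (trig n) = circle_inner (nd_diff \<sigma> (trig n)) \<phi>"
      unfolding circle_inner_nd_diff[OF \<sigma>(1) t \<phi>(1)] circle_inner_nd_diff[OF \<sigma>(1) \<phi> t(1)]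
        nd_map_symmetric[OF \<sigma>(1) t \<phi>] nd_map_symmetric[OF constant_conductivity(1) t \<phi>] ..
    with * show "circle_inner (nd_diff \<sigma> \<phi>) (trig n) = (\<mu>1 - \<mu>2) * circle_inner \<phi> (trig n)"
      by (simp add: circle_inner_def mult.commute)
  qed
qed

section \<open>Electrode currents\<close>

text \<open>A connected proper subset of the circle is an arc, and closing it adds at most its two
  endpoints. This is what makes closures that cover the circle as good as a cover up to a null
  set.\<close>

lemma finite_closure_minus_connected_circle:
  assumes U: "U \<subseteq> sphere (0::complex) 1" "connected U"
  shows "finite (closure U - U)"
proof (cases "U = sphere 0 1 \<or> U = {}")
  case True
  then show ?thesis by auto
next
  case False
  then obtain p where p: "cmod p = 1" "p \<notin> U"
    using U(1) by auto
  have "p \<noteq> 0" using p by auto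
  \<comment> \<open>The factor \<open>- 1 / p\<close> turns the missing point \<open>p\<close> into
    -1, so the branch cut of \<open>Arg\<close> avoids \<open>U\<close> and the angle is continuous
    there; \<open>h\<close> inverts it.\<close>
  define g where "g = (\<lambda>z. Arg (- z / p))"
  define h where "h = (\<lambda>t. - p * cis t)"
  have U1: "cmod (- z / p) = 1" "- z / p \<noteq> -1" if "z \<in> U" for z
    using that U(1) p \<open>p \<noteq> 0\<close> by (auto simp: norm_divide field_simps)
  have hg: "h (g z) = z" if "z \<in> U" for z
  proof -
    have "- z / p \<noteq> 0"
      using U1(1)[OF that] by (metis norm_zero zero_neq_one)
    then have "cis (g z) = - z / p"
      unfolding g_def using U1(1)[OF that] by (simp add: cis_Arg sgn_div_norm)
    then show ?thesis
      using \<open>p \<noteq> 0\<close> by (simp add: h_def)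
  qed
  have "continuous_on U g"
    unfolding g_def
  proof (intro continuous_intros)
    fix z assume z: "z \<in> U"
    show "- z / p \<notin> \<real>\<^sub>\<le>\<^sub>0"
    proof
      assume "- z / p \<in> \<real>\<^sub>\<le>\<^sub>0"
      then obtain r where r: "r \<le> 0" "- z / p = of_real r"
        by (rule nonpos_Reals_cases)
      have "r = -1"
        using U1(1)[OF z] r(1) unfolding r(2) norm_of_real by simp
      then show False
        using U1(2)[OF z] unfolding r(2) by simp
    qed
  qed (use \<open>p \<noteq> 0\<close> in auto)
  then have conn: "connected (g ` U)"
    using U(2) by (rule connected_continuous_image)
  have ne: "g ` U \<noteq> {}" using False by auto
  have bd: "bdd_below (g ` U)" "bdd_above (g ` U)"
    unfolding g_def by (intro bdd_belowI[of _ "-pi"] bdd_aboveI[of _ pi];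
        use Arg_bounded less_imp_le in fastforce)+
  define a b where "a = Inf (g ` U)" and "b = Sup (g ` U)"
  \<comment> \<open>A connected set of angles contains everything strictly between its infimum and
    supremum.\<close>
  have Ioo: "{a<..<b} \<subseteq> g ` U"
  proof
    fix t assume t: "t \<in> {a<..<b}"
    obtain x where "x \<in> g ` U" "x < t"
      using t cInf_lessD[OF ne, of t] by (auto simp: a_def)
    moreover obtain y where "y \<in> g ` U" "t < y"
      using t less_cSupD[OF ne, of t] by (auto simp: b_def)
    ultimately show "t \<in> g ` U"
      using conn unfolding connected_iff_interval by (metis less_imp_le)
  qed
  have "U \<subseteq> h ` {a..b}"
  proof
    fix z assume z: "z \<in> U"
    then have "g z \<in> {a..b}"
      using cInf_lower[OF _ bd(1)] cSup_upper[OF _ bd(2)] by (auto simp: a_def b_def)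
    then show "z \<in> h ` {a..b}"
      using hg[OF z] by (metis image_eqI)
  qed
  moreover have "closed (h ` {a..b})"
    unfolding h_def by (intro compact_imp_closed compact_continuous_image continuous_intros) auto
  ultimately have "closure U \<subseteq> h ` {a..b}"
    by (rule closure_minimal)
  moreover have "h ` {a<..<b} \<subseteq> U"
  proof
    fix z assume "z \<in> h ` {a<..<b}"
    then obtain y where "y \<in> U" "z = h (g y)"
      using Ioo by auto
    then show "z \<in> U" using hg by simp
  qed
  \<comment> \<open>The closure lies over the closed interval and \<open>U\<close> contains
    everything over the open one, so only the images of \<open>a\<close> and \<open>b\<close>
    remain.\<close>
  ultimately have "closure U - U \<subseteq> h ` {a, b}"
    by (smt (verit, ccfv_threshold) DiffE atLeastAtMost_iff greaterThanLessThan_iff image_iff insertCI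
        nless_le subset_iff)
  then show ?thesis
    by (rule finite_subset) simp
qed

text \<open>A point of the circle is hit by \<open>cis\<close> at a single angle of the
  period.\<close>

lemma AE_circle_neq: "AE z in circle_measure. z \<noteq> a"
proof (cases "cmod a = 1")
  case True
  have "{a} \<in> sets (restrict_space borel (sphere 0 1))"
    using True by (auto simp: sets_restrict_space_iff)
  then have a: "{a} \<in> sets circle_measure" by (simp only: sets_circle_measure)
  have "emeasure circle_measure {a} = (\<integral>\<^sup>+z. indicator {a} z \<partial>circle_measure)"
    using a by (subst nn_integral_indicator) simp_all
  also have "\<dots> = (\<integral>\<^sup>+\<theta>. indicator {a} (cis \<theta>) * indicator {0..<2 * pi} \<theta> \<partial>lborel)"
    by (rule nn_integral_circle_measure) (use a in \<open>intro borel_measurable_indicator\<close>)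
  also have "\<dots> = (\<integral>\<^sup>+\<theta>. 0 \<partial>(lborel :: real measure))"
  proof (rule nn_integral_cong_AE)
    show "AE \<theta> in lborel. indicator {a} (cis \<theta>) * indicator {0..<2 * pi} \<theta> = (0::ennreal)"
      using AE_lborel_singleton[of "Arg2pi a"]
    proof eventually_elim
      case (elim \<theta>)
      have "Arg2pi a = \<theta>" if "cis \<theta> = a" "0 \<le> \<theta>" "\<theta> < 2 * pi"
        using that by (intro Arg2pi_unique[of 1]) (simp_all add: cis_conv_exp)
      with elim show ?case by (auto split: split_indicator)
    qed
  qed
  finally have "{a} \<in> null_sets circle_measure"
    using a by (simp add: null_sets_def)
  from AE_not_in[OF this] show ?thesis by simp
qed (auto intro!: AE_I2)

lemma AE_circle_finite: "finite A \<Longrightarrow> AE z in circle_measure. z \<notin> A"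
proof (induction rule: finite_induct)
  case (insert a A)
  from AE_circle_neq[of a] insert.IH show ?case
    by eventually_elim simp
qed simp

lemma openin_circle_sets:
  assumes "openin (top_of_set (sphere 0 1)) A"
  shows "A \<in> sets circle_measure"
proof -
  obtain T where "open T" "A = sphere 0 1 \<inter> T"
    using assms by (auto simp: openin_open)
  then show ?thesis
    by (auto simp: sets_circle_measure sets_restrict_space)
qed

lemma Q_map_L2:
  assumes "\<And>m. m < M \<Longrightarrow> E m \<in> sets circle_measure"
  shows "Q_map M E Et \<phi> \<in> L2 circle_measure"
proof -
  have "(\<lambda>z. \<Sum>m\<in>A. indicator (E m) z * c m) \<in> L2 circle_measure" if "finite A" "A \<subseteq> {..<M}" for A and c :: "nat \<Rightarrow> real"
    using that
  proof (induction rule: finite_induct)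
    case empty
    then show ?case by (simp add: L2_def)
  next
    case (insert m A)
    have "indicator (E m) \<in> borel_measurable circle_measure"
      using insert.prems assms by (intro borel_measurable_indicator) auto
    then have "(indicator (E m) :: complex \<Rightarrow> real) \<in> L2 circle_measure"
      by (rule circle.L2_bounded[where C=1]) (simp add: indicator_def)
    from L2_scaleR[OF this, of "c m"] have "(\<lambda>z. indicator (E m) z * c m) \<in> L2 circle_measure"
      by (simp add: mult.commute)
    moreover have "(\<lambda>z. \<Sum>m\<in>A. indicator (E m) z * c m) \<in> L2 circle_measure"
      using insert.IH insert.prems by simp
    ultimately show ?case
      unfolding sum.insert[OF insert.hyps] by (rule L2_add)
  qed
  from this[of "{..<M}" "\<lambda>m. (LINT x:Et m|circle_measure. \<phi> x) / measure circle_measure (E m)"]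
  show ?thesis
    by (simp add: Q_map_def[abs_def])
qed

text \<open>Each normalised electrode indicator integrates to 1, so what remains is the sum of the
  integrals of \<open>\<phi>\<close> over the extended electrodes, which tile the circle up to
  finitely many points.\<close>

lemma Q_map_mean:
  assumes conf: "electrode_configuration M E Et" and \<phi>: "\<phi> \<in> L2 circle_measure"
  shows "(LINT z|circle_measure. Q_map M E Et \<phi> z) = (LINT z|circle_measure. \<phi> z)"
proof -
  have E: "E m \<in> sets circle_measure" and Et: "Et m \<in> sets circle_measure" "connected (Et m)" "Et m \<subseteq> sphere 0 1"
    if "m < M" for m
    using conf that by (auto simp: electrode_configuration_def intro: openin_circle_sets dest: openin_imp_subset)
  have pos: "measure circle_measure (E m) \<noteq> 0" if "m < M" for m
    using conf that by (auto simp: electrode_configuration_def)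
  have disj: "disjoint_family_on Et {..<M}" and cover: "(\<Union>m<M. closure (Et m)) = sphere 0 1"
    using conf by (auto simp: electrode_configuration_def)
  have int\<phi>: "integrable circle_measure \<phi>"
    by (rule circle.integrable_L2[OF \<phi>])
  have intE: "integrable circle_measure (indicator (E m) :: complex \<Rightarrow> real)" if "m < M" for m
    using circle.emeasure_finite[of "E m"]
    by (intro integrable_real_indicator E[OF that]) (simp add: less_top[symmetric])
  have "(LINT z|circle_measure. Q_map M E Et \<phi> z) =
      (\<Sum>m<M. LINT z|circle_measure. indicator (E m) z / measure circle_measure (E m) * (LINT x:Et m|circle_measure. \<phi> x))"
    unfolding Q_map_def by (rule Bochner_Integration.integral_sum) (use intE in auto)
  also have "\<dots> = (\<Sum>m<M. LINT x:Et m|circle_measure. \<phi> x)"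
  proof (rule sum.cong)
    fix m assume "m \<in> {..<M}"
    then have m: "m < M" by simp
    have "E m \<inter> sphere 0 1 = E m"
      using sets.sets_into_space[OF E[OF m]] by auto
    then show "(LINT z|circle_measure. indicator (E m) z / measure circle_measure (E m) * (LINT x:Et m|circle_measure. \<phi> x))
        = (LINT x:Et m|circle_measure. \<phi> x)"
      using pos[OF m] by simp
  qed simp
  also have "\<dots> = (LINT z|circle_measure. (\<Sum>m<M. indicator (Et m) z *\<^sub>R \<phi> z))"
    unfolding set_lebesgue_integral_def
    by (rule Bochner_Integration.integral_sum[symmetric]) (rule integrable_mult_indicator, use Et int\<phi> in auto)
  also have "\<dots> = (LINT z|circle_measure. \<phi> z)"
  proof (rule integral_cong_AE)
    \<comment> \<open>The configuration covers the circle only by closures; the points lost on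
      passing to the open arcs form a finite set.\<close>
    have "finite (\<Union>m<M. closure (Et m) - Et m)"
      using Et by (intro finite_UN_I finite_closure_minus_connected_circle) auto
    from AE_circle_finite[OF this] AE_space
    show "AE z in circle_measure. (\<Sum>m<M. indicator (Et m) z *\<^sub>R \<phi> z) = \<phi> z"
    proof eventually_elim
      case (elim z)
      from elim(2) have "z \<in> (\<Union>m<M. closure (Et m))"
        unfolding cover by simp
      with elim(1) have "z \<in> (\<Union>m<M. Et m)"
        by blast
      then have "indicator (\<Union>m<M. Et m) z = (1::real)"
        by (rule indicator_simps(1))
      then have "(\<Sum>m<M. indicator (Et m) z) = (1::real)"
        unfolding indicator_UN_disjoint[OF finite_lessThan disj] .
      then show ?case
        by (simp only: real_scaleR_def mult_1 flip: sum_distrib_right)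
    qed
    show "(\<lambda>z. \<Sum>m<M. indicator (Et m) z *\<^sub>R \<phi> z) \<in> borel_measurable circle_measure"
      by (intro borel_measurable_sum borel_measurable_scaleR borel_measurable_indicator
          borel_measurable_integrable[OF int\<phi>]) (use Et in simp)
    show "\<phi> \<in> borel_measurable circle_measure"
      by (rule borel_measurable_integrable[OF int\<phi>])
  qed
  finally show ?thesis .
qed

lemma current_L2:
  assumes "electrode_configuration M E Et"
  shows "current M E Et n \<in> L2 circle_measure"
  unfolding current_def
  using assms by (intro Q_map_L2) (auto simp: electrode_configuration_def intro: openin_circle_sets)

lemma current_mean_zero:
  assumes "electrode_configuration M E Et" "n \<noteq> 0"
  shows "(LINT z|circle_measure. current M E Et n z) = 0"
  unfolding current_def Q_map_mean[OF assms(1) trig_L2] by (rule trig_mean_zero[OF assms(2)])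

section \<open>Indexing of the modes and recovery of the matrix\<close>

lemma mode_in_modes:
  assumes "even N" "k < N"
  shows "mode N k \<in> modes N"
proof -
  have f: "finite (modes N)" by (simp add: modes_def)
  \<comment> \<open>For even \<open>N\<close> the symmetric interval has \<open>N + 1\<close>
    integers, and removing 0 leaves \<open>N\<close>; every index below \<open>N\<close> is thus a
    valid list position.\<close>
  have "card (modes N) = N"
    using assms(1) by (auto simp: modes_def card_Diff_singleton_if elim!: evenE)
  then show ?thesis
    using assms(2) f unfolding mode_def by (metis length_sorted_list_of_set nth_mem set_sorted_list_of_set)
qed

lemma mode_inj:
  assumes "even N" "k < N" "l < N"
  shows "mode N k = mode N l \<longleftrightarrow> k = l"
proof -
  have "card (modes N) = N"
    using assms(1) by (auto simp: modes_def card_Diff_singleton_if elim!: evenE)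
  then show ?thesis
    using assms unfolding mode_def by (intro nth_eq_iff_index_eq) simp_all
qed

text \<open>Recoverability means one function \<open>F\<close> of the data, fixed before the
  conductivity. Admitting every \<open>g\<close> that agrees almost everywhere with the measurement
  prevents \<open>F\<close> from exploiting the representative picked by
  \<open>nd_map\<close>.\<close>

theorem corollary3p2:
  fixes M N :: nat and E Et :: "nat \<Rightarrow> complex set" and n :: int
  assumes "even N" and "0 < N" and "N < M"
    and "electrode_configuration M E Et"
    and "vec_space.rank (N\<^sup>2) (Psi M E Et N) = N\<^sup>2"
    and "n \<in> modes N"
    and "\<forall>j\<in>modes N. circle_inner (current M E Et n) (trig j) \<noteq> 0"
  shows "\<exists>F :: (complex \<Rightarrow> real) \<Rightarrow> real Matrix.mat.
    \<forall>\<sigma>. admissible_conductivity \<sigma> \<longrightarrow> rotationally_symmetric \<sigma> \<longrightarrow> one_near_boundary \<sigma> \<longrightarrow>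
      (\<forall>g \<in> L2 circle_measure.
         (AE z in circle_measure. g z = nd_diff \<sigma> (current M E Et n) z) \<longrightarrow>
         F g = nd_matrix N \<sigma>)"
proof -
  define \<psi> where "\<psi> = current M E Et n"
  have nz: "j \<noteq> 0" if "j \<in> modes N" for j
    using that by (simp add: modes_def)
  have \<psi>: "\<psi> \<in> L2 circle_measure" "(LINT z|circle_measure. \<psi> z) = 0"
    unfolding \<psi>_def using current_L2[OF assms(4)] current_mean_zero[OF assms(4) nz[OF assms(6)]] by auto
  \<comment> \<open>The candidate is diagonal, each entry being the quotient of the coefficients of
    measurement and current. It involves the electrodes but not \<open>\<sigma>\<close>.\<close>
  define F where "F = (\<lambda>g. Matrix.mat N N (\<lambda>(k, l).
    if k = l then circle_inner g (trig (mode N k)) / circle_inner \<psi> (trig (mode N k)) else 0))"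
  have "F g = nd_matrix N \<sigma>"
    if \<sigma>: "admissible_conductivity \<sigma>" "rotationally_symmetric \<sigma>" and g: "g \<in> L2 circle_measure"
      and ae: "AE z in circle_measure. g z = nd_diff \<sigma> \<psi> z" for \<sigma> g
    unfolding F_def nd_matrix_def
  proof (intro cong_mat refl, clarify)
    fix k l assume kl: "k < N" "l < N"
    note m = mode_in_modes[OF assms(1) kl(1)] mode_in_modes[OF assms(1) kl(2)]
    obtain \<mu> where \<mu>: "\<And>\<phi>. \<phi> \<in> L2 circle_measure \<Longrightarrow> (LINT z|circle_measure. \<phi> z) = 0 \<Longrightarrow>
        circle_inner (nd_diff \<sigma> (trig (mode N k))) \<phi> = \<mu> * circle_inner (trig (mode N k)) \<phi>"
      "\<And>\<phi>. \<phi> \<in> L2 circle_measure \<Longrightarrow> (LINT z|circle_measure. \<phi> z) = 0 \<Longrightarrow>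
        circle_inner (nd_diff \<sigma> \<phi>) (trig (mode N k)) = \<mu> * circle_inner \<phi> (trig (mode N k))"
      using nd_diff_trig[OF \<sigma> nz[OF m(1)]] by blast
    have "nd_diff \<sigma> \<psi> \<in> L2 circle_measure"
      unfolding nd_diff_def using nd_map_L2[OF \<sigma>(1) \<psi>] nd_map_L2[OF constant_conductivity(1) \<psi>] by (rule L2_diff)
    \<comment> \<open>\<open>F\<close> sees \<open>g\<close> only through integrals, so almost
      everywhere equality is enough.\<close>
    then have "circle_inner g (trig (mode N k)) = circle_inner (nd_diff \<sigma> \<psi>) (trig (mode N k))"
      unfolding circle_inner_def using ae L2D(1)[OF g] L2D(1)[OF trig_L2]
      by (intro integral_cong_AE borel_measurable_times L2D(1)[where f="nd_diff \<sigma> \<psi>"]) (auto elim: eventually_mono)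
    also have "\<dots> = \<mu> * circle_inner \<psi> (trig (mode N k))"
      by (rule \<mu>(2)[OF \<psi>])
    finally have g\<mu>: "circle_inner g (trig (mode N k)) / circle_inner \<psi> (trig (mode N k)) = \<mu>"
      using assms(7) m(1) by (simp add: \<psi>_def)
    show "(if k = l then circle_inner g (trig (mode N k)) / circle_inner \<psi> (trig (mode N k)) else 0) =
        circle_inner (nd_diff \<sigma> (trig (mode N k))) (trig (mode N l))"
      \<comment> \<open>The matrix entry is \<open>\<mu>\<close> times the pairing of two basis
        functions, and orthonormality makes it \<open>\<mu>\<close> on the diagonal and 0
        elsewhere.\<close>
      unfolding g\<mu> \<mu>(1)[OF trig_L2 trig_mean_zero[OF nz[OF m(2)]]] trig_orthonormal[OF nz[OF m(1)] nz[OF m(2)]]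
      using mode_inj[OF assms(1) kl] by simp
  qed
  then show ?thesis
    unfolding \<psi>_def by blast
qed

end
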